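(* Let $R$ be a ring, $M$ an $R$-bimodule, $n\ge 1$, and let $(X,f)$ be a left $R\ltimes_n M$-module. (1) $(X,f)$ is a finitely generated left $R\ltimes_n M$-module if and only if $\operatorname{coker}(f)$ is a finitely generated left $R$-module. (2) If $(X,f)$ is a finitely presented left $R\ltimes_n M$-module, then $\operatorname{coker}(f)$ is a finitely presented left $R$-module. The converse holds if $\ker(f)$ is a finitely generated left $R$-module.
   Context: All rings are nonzero, associative, with identity; all modules are unitary. $M^{\otimes_R 0}=R$, $M^{\otimes_R 1}=M$, $M^{\otimes_R (i+1)}=M\otimes_R M^{\otimes_R i}$. The $n$-trivial extension $R\ltimes_n M$ is the abelian group $\coprod_{i=0}^n M^{\otimes_R i}$ with multiplication $(m_0,\dots,m_n)(m_0',\dots,m_n')=\big(\sum_{i+j=k}m_i\otimes m_j'\big)_{0\le k\le n}$ (using the canonical identifications $R\otimes_R N=N=N\otimes_R R$). Left $R\ltimes_n M$-modules are identified with pairs $(X,f)$, where $X$ is a left $R$-module and $f: M\otimes_R X\to X$ is a left $R$-homomorphism such that the composite $f(M\otimes f)\cdots(M^{\otimes_R n}\otimes f): M^{\otimes_R(n+1)}\otimes_R X\to X$ is zero; here $M^{\otimes_R i}\otimes f$ denotes $\mathrm{id}\otimes f$, and explicitly $f(m\otimes x)=(0,m,0,\dots,0)x$. A morphism $(X,f)\to(Y,g)$ is an $R$-homomorphism $\gamma:X\to Y$ with $\gamma f=g(M\otimes\gamma)$. *)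

theory Defs
  imports "HOL-Algebra.Free_Abelian_Groups" "HOL-Algebra.Generated_Groups"
    "HOL-Algebra.AbelCoset" "HOL-Algebra.Module"
begin

section \<open>Left modules and bimodules over a not necessarily commutative ring\<close>

text \<open>The library's \<^locale>\<open>module\<close> demands a commutative ring of scalars; this is the same list
  of axioms over an arbitrary ring.  As in the library, the fields \<^const>\<open>mult\<close> and \<^const>\<open>one\<close> of a
  module record play no role.\<close>

locale left_module = R?: ring R + M?: abelian_group M
  for R :: "('r, 'a) ring_scheme" (structure) and M :: "('r, 'm, 'b) module_scheme" (structure) +
  assumes smult_closed [simp, intro]:
      "\<lbrakk>a \<in> carrier R; x \<in> carrier M\<rbrakk> \<Longrightarrow> a \<odot>\<^bsub>M\<^esub> x \<in> carrier M"
    and smult_l_distr: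
      "\<lbrakk>a \<in> carrier R; b \<in> carrier R; x \<in> carrier M\<rbrakk> \<Longrightarrow>
       (a \<oplus>\<^bsub>R\<^esub> b) \<odot>\<^bsub>M\<^esub> x = a \<odot>\<^bsub>M\<^esub> x \<oplus>\<^bsub>M\<^esub> b \<odot>\<^bsub>M\<^esub> x"
    and smult_r_distr:
      "\<lbrakk>a \<in> carrier R; x \<in> carrier M; y \<in> carrier M\<rbrakk> \<Longrightarrow>
       a \<odot>\<^bsub>M\<^esub> (x \<oplus>\<^bsub>M\<^esub> y) = a \<odot>\<^bsub>M\<^esub> x \<oplus>\<^bsub>M\<^esub> a \<odot>\<^bsub>M\<^esub> y"
    and smult_assoc1:
      "\<lbrakk>a \<in> carrier R; b \<in> carrier R; x \<in> carrier M\<rbrakk> \<Longrightarrow>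
       (a \<otimes>\<^bsub>R\<^esub> b) \<odot>\<^bsub>M\<^esub> x = a \<odot>\<^bsub>M\<^esub> (b \<odot>\<^bsub>M\<^esub> x)"
    and smult_one [simp]:
      "x \<in> carrier M \<Longrightarrow> \<one>\<^bsub>R\<^esub> \<odot>\<^bsub>M\<^esub> x = x"

record ('r, 'm) bimod = "('r, 'm) module" +
  rsmult :: "'m \<Rightarrow> 'r \<Rightarrow> 'm" (infixl \<open>\<odot>r\<index>\<close> 70)

locale bimodule = left_module R M
  for R :: "('r, 'a) ring_scheme" (structure) and M :: "('r, 'm, 'b) bimod_scheme" (structure) +
  assumes rsmult_closed [simp, intro]:
      "\<lbrakk>x \<in> carrier M; a \<in> carrier R\<rbrakk> \<Longrightarrow> x \<odot>r\<^bsub>M\<^esub> a \<in> carrier M"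
    and rsmult_r_distr:
      "\<lbrakk>x \<in> carrier M; a \<in> carrier R; b \<in> carrier R\<rbrakk> \<Longrightarrow>
       x \<odot>r\<^bsub>M\<^esub> (a \<oplus>\<^bsub>R\<^esub> b) = x \<odot>r\<^bsub>M\<^esub> a \<oplus>\<^bsub>M\<^esub> x \<odot>r\<^bsub>M\<^esub> b"
    and rsmult_l_distr:
      "\<lbrakk>x \<in> carrier M; y \<in> carrier M; a \<in> carrier R\<rbrakk> \<Longrightarrow>
       (x \<oplus>\<^bsub>M\<^esub> y) \<odot>r\<^bsub>M\<^esub> a = x \<odot>r\<^bsub>M\<^esub> a \<oplus>\<^bsub>M\<^esub> y \<odot>r\<^bsub>M\<^esub> a"
    and rsmult_assoc:
      "\<lbrakk>x \<in> carrier M; a \<in> carrier R; b \<in> carrier R\<rbrakk> \<Longrightarrow>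
       x \<odot>r\<^bsub>M\<^esub> (a \<otimes>\<^bsub>R\<^esub> b) = (x \<odot>r\<^bsub>M\<^esub> a) \<odot>r\<^bsub>M\<^esub> b"
    and rsmult_one [simp]:
      "x \<in> carrier M \<Longrightarrow> x \<odot>r\<^bsub>M\<^esub> \<one>\<^bsub>R\<^esub> = x"
    and smult_rsmult:
      "\<lbrakk>a \<in> carrier R; x \<in> carrier M; b \<in> carrier R\<rbrakk> \<Longrightarrow>
       (a \<odot>\<^bsub>M\<^esub> x) \<odot>r\<^bsub>M\<^esub> b = a \<odot>\<^bsub>M\<^esub> (x \<odot>r\<^bsub>M\<^esub> b)"

definition lmod_hom ::
  "('r, 'a) ring_scheme \<Rightarrow> ('r, 'x, 'b) module_scheme \<Rightarrow> ('r, 'y, 'c) module_scheme \<Rightarrow> ('x \<Rightarrow> 'y) set"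
  where "lmod_hom R X Y = {h \<in> carrier X \<rightarrow> carrier Y.
    (\<forall>x\<in>carrier X. \<forall>y\<in>carrier X. h (x \<oplus>\<^bsub>X\<^esub> y) = h x \<oplus>\<^bsub>Y\<^esub> h y) \<and>
    (\<forall>r\<in>carrier R. \<forall>x\<in>carrier X. h (r \<odot>\<^bsub>X\<^esub> x) = r \<odot>\<^bsub>Y\<^esub> h x)}"

definition lmod_ker ::
  "('r, 'x) module \<Rightarrow> ('r, 'y, 'c) module_scheme \<Rightarrow> ('x \<Rightarrow> 'y) \<Rightarrow> ('r, 'x) module"
  where "lmod_ker X Y h = X\<lparr>carrier := {x \<in> carrier X. h x = \<zero>\<^bsub>Y\<^esub>}\<rparr>"

definition quot_lmod :: "('r, 'x, 'c) module_scheme \<Rightarrow> 'x set \<Rightarrow> ('r, 'x set) module"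
  where "quot_lmod X N = \<lparr>carrier = a_rcosets\<^bsub>X\<^esub> N, mult = undefined, one = undefined,
    zero = N, add = set_add X, smult = (\<lambda>r C. \<Union>x\<in>C. N +>\<^bsub>X\<^esub> (r \<odot>\<^bsub>X\<^esub> x))\<rparr>"

definition lmod_coker ::
  "('r, 'x, 'b) module_scheme \<Rightarrow> ('r, 'y, 'c) module_scheme \<Rightarrow> ('x \<Rightarrow> 'y) \<Rightarrow> ('r, 'y set) module"
  where "lmod_coker X Y h = quot_lmod Y (h ` carrier X)"

definition reg_lmod :: "('r, 'a) ring_scheme \<Rightarrow> ('r, 'r) module"
  where "reg_lmod R = \<lparr>carrier = carrier R, mult = mult R, one = \<one>\<^bsub>R\<^esub>,
    zero = \<zero>\<^bsub>R\<^esub>, add = add R, smult = mult R\<rparr>"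

definition free_lmod :: "('r, 'a) ring_scheme \<Rightarrow> nat \<Rightarrow> ('r, nat \<Rightarrow> 'r) module"
  where "free_lmod R k = \<lparr>carrier = {..<k} \<rightarrow>\<^sub>E carrier R, mult = undefined, one = undefined,
    zero = (\<lambda>i\<in>{..<k}. \<zero>\<^bsub>R\<^esub>), add = (\<lambda>v w. \<lambda>i\<in>{..<k}. v i \<oplus>\<^bsub>R\<^esub> w i),
    smult = (\<lambda>r v. \<lambda>i\<in>{..<k}. r \<otimes>\<^bsub>R\<^esub> v i)\<rparr>"

definition fin_gen :: "('r, 'a) ring_scheme \<Rightarrow> ('r, 'x, 'c) module_scheme \<Rightarrow> bool"
  where "fin_gen R X \<longleftrightarrow> (\<exists>S. finite S \<and> S \<subseteq> carrier X \<and>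
    (\<forall>x\<in>carrier X. \<exists>a \<in> S \<rightarrow> carrier R. x = (\<Oplus>\<^bsub>X\<^esub>s\<in>S. a s \<odot>\<^bsub>X\<^esub> s)))"

definition fin_pres :: "('r, 'a) ring_scheme \<Rightarrow> ('r, 'x, 'c) module_scheme \<Rightarrow> bool"
  where "fin_pres R X \<longleftrightarrow> (\<exists>k. \<exists>h \<in> lmod_hom R (free_lmod R k) X.
    h ` carrier (free_lmod R k) = carrier X \<and> fin_gen R (lmod_ker (free_lmod R k) X h))"

section \<open>Tensor products\<close>

text \<open>For a bimodule \<open>M\<close> and a left module \<open>N\<close> over \<open>R\<close>, \<open>tensor_chain R M i N\<close> below is the
  left \<open>R\<close>-module \<open>M \<otimes> (M \<otimes> \<dots> (M \<otimes> N))\<close> with \<open>i\<close> factors \<open>M\<close>.  Iterating a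
  binary tensor product would change the type at each step, so all factors are tensored at once:
  the module is the free abelian group on the generators \<open>([m\<^sub>1, \<dots>, m\<^sub>i], x)\<close>, standing for
  \<open>m\<^sub>1 \<otimes> \<dots> \<otimes> m\<^sub>i \<otimes> x\<close>, modulo additivity in each entry and \<open>R\<close>-balancedness
  between neighbours.  For \<open>i = 0\<close> it is \<open>N\<close>, for
  \<open>i = 1\<close> it is the usual construction of \<open>M \<otimes> N\<close>, and sending \<open>m \<otimes> [ms, x]\<close> to
  \<open>[m # ms, x]\<close> identifies \<open>M \<otimes> tensor_chain R M i N\<close> with \<open>tensor_chain R M (i + 1) N\<close>.\<close>

definition chain_gens ::
  "('r, 'm, 'b) bimod_scheme \<Rightarrow> nat \<Rightarrow> ('r, 'x, 'c) module_scheme \<Rightarrow> ('m list \<times> 'x) set"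
  where "chain_gens M i N = {(ms, x). length ms = i \<and> set ms \<subseteq> carrier M \<and> x \<in> carrier N}"

inductive_set chain_rels ::
  "('r, 'a) ring_scheme \<Rightarrow> ('r, 'm, 'b) bimod_scheme \<Rightarrow> nat \<Rightarrow> ('r, 'x, 'c) module_scheme
    \<Rightarrow> ('m list \<times> 'x \<Rightarrow>\<^sub>0 int) set"
  for R M i N where
  add_left: "\<lbrakk>(us @ a # vs, x) \<in> chain_gens M i N; b \<in> carrier M\<rbrakk> \<Longrightarrow>
    frag_of (us @ (a \<oplus>\<^bsub>M\<^esub> b) # vs, x) - frag_of (us @ a # vs, x) - frag_of (us @ b # vs, x)
      \<in> chain_rels R M i N"
| add_right: "\<lbrakk>(us, x) \<in> chain_gens M i N; y \<in> carrier N\<rbrakk> \<Longrightarrow>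
    frag_of (us, x \<oplus>\<^bsub>N\<^esub> y) - frag_of (us, x) - frag_of (us, y) \<in> chain_rels R M i N"
| balanced: "\<lbrakk>(us @ a # b # vs, x) \<in> chain_gens M i N; r \<in> carrier R\<rbrakk> \<Longrightarrow>
    frag_of (us @ (a \<odot>r\<^bsub>M\<^esub> r) # b # vs, x) - frag_of (us @ a # (r \<odot>\<^bsub>M\<^esub> b) # vs, x)
      \<in> chain_rels R M i N"
| balanced_last: "\<lbrakk>(us @ [a], x) \<in> chain_gens M i N; r \<in> carrier R\<rbrakk> \<Longrightarrow>
    frag_of (us @ [a \<odot>r\<^bsub>M\<^esub> r], x) - frag_of (us @ [a], r \<odot>\<^bsub>N\<^esub> x) \<in> chain_rels R M i N"

definition chain_group ::
  "('r, 'a) ring_scheme \<Rightarrow> ('r, 'm, 'b) bimod_scheme \<Rightarrow> nat \<Rightarrow> ('r, 'x, 'c) module_scheme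
    \<Rightarrow> ('m list \<times> 'x \<Rightarrow>\<^sub>0 int) set monoid"
  where "chain_group R M i N =
    (let F = free_Abelian_group (chain_gens M i N) in F Mod generate F (chain_rels R M i N))"

definition chain_of ::
  "('r, 'a) ring_scheme \<Rightarrow> ('r, 'm, 'b) bimod_scheme \<Rightarrow> nat \<Rightarrow> ('r, 'x, 'c) module_scheme
    \<Rightarrow> 'm list \<times> 'x \<Rightarrow> ('m list \<times> 'x \<Rightarrow>\<^sub>0 int) set"
  where "chain_of R M i N p =
    (let F = free_Abelian_group (chain_gens M i N)
     in generate F (chain_rels R M i N) #>\<^bsub>F\<^esub> frag_of p)"

text \<open>The homomorphism from \<open>chain_group R M i N\<close> to an abelian group \<open>A\<close> that extends a map
  \<open>\<phi>\<close> of the generators; meaningful only if \<open>\<phi>\<close> respects the relations, in which case the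
  chosen representative does not matter.\<close>

definition chain_lift :: "('c, 'd) monoid_scheme \<Rightarrow> ('g \<Rightarrow> 'c) \<Rightarrow> ('g \<Rightarrow>\<^sub>0 int) set \<Rightarrow> 'c"
  where "chain_lift A \<phi> C =
    (let c = (SOME c. c \<in> C)
     in finprod A (\<lambda>p. \<phi> p [^]\<^bsub>A\<^esub> Poly_Mapping.lookup c p) (Poly_Mapping.keys c))"

fun gen_smult ::
  "('r, 'm, 'b) bimod_scheme \<Rightarrow> ('r, 'x, 'c) module_scheme \<Rightarrow> 'r \<Rightarrow> 'm list \<times> 'x \<Rightarrow> 'm list \<times> 'x"
  where
  "gen_smult M N r ([], x) = ([], r \<odot>\<^bsub>N\<^esub> x)"
| "gen_smult M N r (m # ms, x) = ((r \<odot>\<^bsub>M\<^esub> m) # ms, x)"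

definition tensor_chain ::
  "('r, 'a) ring_scheme \<Rightarrow> ('r, 'm, 'b) bimod_scheme \<Rightarrow> nat \<Rightarrow> ('r, 'x, 'c) module_scheme
    \<Rightarrow> ('r, ('m list \<times> 'x \<Rightarrow>\<^sub>0 int) set) module"
  where "tensor_chain R M i N =
    (let G = chain_group R M i N in
     \<lparr>carrier = carrier G, mult = undefined, one = undefined, zero = \<one>\<^bsub>G\<^esub>, add = mult G,
      smult = (\<lambda>r. chain_lift G (\<lambda>p. chain_of R M i N (gen_smult M N r p)))\<rparr>)"

abbreviation tensor_prod where "tensor_prod R M X \<equiv> tensor_chain R M 1 X"

text \<open>The tensor powers are realised with a last factor \<open>R\<close>, i.e. as \<open>M \<otimes> \<dots> \<otimes> M \<otimes> R\<close>,
  which is uniform in \<open>i\<close> and gives \<open>R\<close> itself for \<open>i = 0\<close> and \<open>M\<close> for \<open>i = 1\<close>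
  under the canonical identifications.\<close>

definition tensor_pow ::
  "('r, 'a) ring_scheme \<Rightarrow> ('r, 'm, 'b) bimod_scheme \<Rightarrow> nat
    \<Rightarrow> ('r, ('m list \<times> 'r \<Rightarrow>\<^sub>0 int) set) module"
  where "tensor_pow R M i = tensor_chain R M i (reg_lmod R)"

text \<open>The canonical map from the \<open>i\<close>-th tensor power times \<open>tensor_chain R M j N\<close> to
  \<open>tensor_chain R M (i + j) N\<close>, sending
  \<open>(m\<^sub>1 \<otimes> \<dots> \<otimes> m\<^sub>i \<otimes> r, m'\<^sub>1 \<otimes> \<dots> \<otimes> m'\<^sub>j \<otimes> x)\<close> to
  \<open>m\<^sub>1 \<otimes> \<dots> \<otimes> m\<^sub>i \<otimes> r m'\<^sub>1 \<otimes> \<dots> \<otimes> m'\<^sub>j \<otimes> x\<close>.\<close>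

definition gen_join ::
  "('r, 'm, 'b) bimod_scheme \<Rightarrow> ('r, 'x, 'c) module_scheme
    \<Rightarrow> 'm list \<times> 'r \<Rightarrow> 'm list \<times> 'x \<Rightarrow> 'm list \<times> 'x"
  where "gen_join M N p q = (case gen_smult M N (snd p) q of (ms, x) \<Rightarrow> (fst p @ ms, x))"

definition tensor_join ::
  "('r, 'a) ring_scheme \<Rightarrow> ('r, 'm, 'b) bimod_scheme \<Rightarrow> ('r, 'x, 'c) module_scheme \<Rightarrow> nat \<Rightarrow> nat
    \<Rightarrow> ('m list \<times> 'r \<Rightarrow>\<^sub>0 int) set \<Rightarrow> ('m list \<times> 'x \<Rightarrow>\<^sub>0 int) set \<Rightarrow> ('m list \<times> 'x \<Rightarrow>\<^sub>0 int) set"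
  where "tensor_join R M N i j s t =
    (let G = chain_group R M (i + j) N in
     chain_lift G (\<lambda>p. chain_lift G (\<lambda>q. chain_of R M (i + j) N (gen_join M N p q)) t) s)"

section \<open>The n-trivial extension and its modules\<close>

definition triv_ext ::
  "('r, 'a) ring_scheme \<Rightarrow> ('r, 'm, 'b) bimod_scheme \<Rightarrow> nat
    \<Rightarrow> (nat \<Rightarrow> ('m list \<times> 'r \<Rightarrow>\<^sub>0 int) set) ring"
  where "triv_ext R M n =
    \<lparr>carrier = (\<Pi>\<^sub>E k\<in>{..n}. carrier (tensor_pow R M k)),
     mult = (\<lambda>a b. \<lambda>k\<in>{..n}. \<Oplus>\<^bsub>tensor_pow R M k\<^esub>i\<in>{..k}.
        tensor_join R M (reg_lmod R) i (k - i) (a i) (b (k - i))),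
     one = (\<lambda>k\<in>{..n}. if k = 0 then chain_of R M 0 (reg_lmod R) ([], \<one>\<^bsub>R\<^esub>)
        else \<zero>\<^bsub>tensor_pow R M k\<^esub>),
     zero = (\<lambda>k\<in>{..n}. \<zero>\<^bsub>tensor_pow R M k\<^esub>),
     add = (\<lambda>a b. \<lambda>k\<in>{..n}. a k \<oplus>\<^bsub>tensor_pow R M k\<^esub> b k)\<rparr>"

text \<open>The composite \<open>f (M \<otimes> f) \<dots> (M \<otimes> \<dots> \<otimes> M \<otimes> f)\<close> with \<open>i\<close> factors, from
  \<open>tensor_chain R M i X\<close> to \<open>X\<close>: it sends \<open>m\<^sub>1 \<otimes> \<dots> \<otimes> m\<^sub>i \<otimes> x\<close> to
  \<open>f (m\<^sub>1 \<otimes> f (m\<^sub>2 \<otimes> \<dots> f (m\<^sub>i \<otimes> x)))\<close>.\<close>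

definition iter_map ::
  "('r, 'a) ring_scheme \<Rightarrow> ('r, 'm, 'b) bimod_scheme \<Rightarrow> ('r, 'x, 'c) module_scheme
    \<Rightarrow> (('m list \<times> 'x \<Rightarrow>\<^sub>0 int) set \<Rightarrow> 'x) \<Rightarrow> ('m list \<times> 'x \<Rightarrow>\<^sub>0 int) set \<Rightarrow> 'x"
  where "iter_map R M X f =
    chain_lift (add_monoid X) (\<lambda>(ms, x). foldr (\<lambda>m y. f (chain_of R M 1 X ([m], y))) ms x)"

definition triv_ext_pair ::
  "('r, 'a) ring_scheme \<Rightarrow> ('r, 'm, 'b) bimod_scheme \<Rightarrow> nat \<Rightarrow> ('r, 'x, 'c) module_scheme
    \<Rightarrow> (('m list \<times> 'x \<Rightarrow>\<^sub>0 int) set \<Rightarrow> 'x) \<Rightarrow> bool"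
  where "triv_ext_pair R M n X f \<longleftrightarrow>
    left_module R X \<and> f \<in> lmod_hom R (tensor_prod R M X) X \<and>
    (\<forall>t \<in> carrier (tensor_chain R M (n + 1) X). iter_map R M X f t = \<zero>\<^bsub>X\<^esub>)"

text \<open>The module over the \<open>n\<close>-trivial extension that a pair \<open>(X, f)\<close> is identified with:
  \<open>a x\<close> is the sum over \<open>i \<le> n\<close> of the images of \<open>a\<^sub>i \<otimes> x\<close> under \<open>iter_map\<close>, so that
  \<open>(0, m, 0, \<dots>, 0) x = f (m \<otimes> x)\<close>.\<close>

definition triv_ext_module ::
  "('r, 'a) ring_scheme \<Rightarrow> ('r, 'm, 'b) bimod_scheme \<Rightarrow> nat \<Rightarrow> ('r, 'x, 'c) module_scheme
    \<Rightarrow> (('m list \<times> 'x \<Rightarrow>\<^sub>0 int) set \<Rightarrow> 'x)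
    \<Rightarrow> (nat \<Rightarrow> ('m list \<times> 'r \<Rightarrow>\<^sub>0 int) set, 'x) module"
  where "triv_ext_module R M n X f =
    \<lparr>carrier = carrier X, mult = undefined, one = undefined, zero = \<zero>\<^bsub>X\<^esub>, add = add X,
     smult = (\<lambda>a x. \<Oplus>\<^bsub>X\<^esub>i\<in>{..n}. iter_map R M X f
        (tensor_join R M X i 0 (a i) (chain_of R M 0 X ([], x))))\<rparr>"

end

theory Submission
  imports Defs
begin

text \<open>Put \<open>S = R \<ltimes>\<^sub>n M\<close>, with the inclusion \<open>\<eta> : R \<rightarrow> S\<close>, the projection \<open>\<epsilon> : S \<rightarrow> R\<close> and the
  degree-one part \<open>\<mu> : M \<rightarrow> S\<close>.  Any product of \<open>n + 1\<close> elements of \<open>\<mu> M\<close> vanishes and \<open>s\<close> acts as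
  \<open>\<eta> (\<epsilon> s)\<close> modulo \<open>M Y\<close> on every \<open>S\<close>-module \<open>Y\<close>, so Nakayama's lemma holds in the form
  \<open>Y = N + M Y \<Longrightarrow> Y = N\<close>; with \<open>coker f = X / M X\<close> this gives (1).  For (2), compare a map
  \<open>h : F = S\<^sup>k \<rightarrow> X\<close> with its reduction \<open>R\<^sup>k \<rightarrow> coker f\<close>.  If \<open>h\<close> is onto with kernel \<open>K\<close>, the kernel of
  the reduction is \<open>\<epsilon> K\<close>.  Conversely, the snake map \<open>ker f \<rightarrow> K / M K\<close> covers those elements of \<open>K\<close>
  that \<open>\<epsilon>\<close> kills, so \<open>K / M K\<close> is an extension of a finitely generated module by a finitely generated
  one, and Nakayama applies to \<open>K\<close>.\<close>

section \<open>Additive maps and additive spans\<close>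

text \<open>A tensor is a coset of formal sums and an element of S a tuple of such cosets, so
  identities can hardly be checked elementwise; even the ring axioms of S have to be proved.
  Everything is therefore reduced to generators: the maps involved are additive in each argument,
  and additive maps that agree on an additive generating set are equal. Once this is done, a short
  list of properties of S is isolated in the locale \<open>augmented_ring\<close>, and the actual
  argument runs there. Where the finiteness of ker f enters: for 0 -> K -> F -> X -> 0 with F = S^k,
  the snake lemma, applied to the actions of M on K, F and X, yields the exact sequence ker f -> K /
  M K -> F / M F -> coker f, and F / M F is R^k. The row tensored with M is only right exact, which
  is what the snake lemma asks of it. The image of ker f is (K \<inter> M F) / M K, the part of K /
  M K that reduction modulo M F does not see.\<close>

definition add_hom :: "('x, 'c) ring_scheme \<Rightarrow> ('y, 'd) ring_scheme \<Rightarrow> ('x \<Rightarrow> 'y) set"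
  where "add_hom X Y = {h \<in> carrier X \<rightarrow> carrier Y.
    \<forall>x\<in>carrier X. \<forall>y\<in>carrier X. h (x \<oplus>\<^bsub>X\<^esub> y) = h x \<oplus>\<^bsub>Y\<^esub> h y}"

lemma add_homI:
  assumes "\<And>x. x \<in> carrier X \<Longrightarrow> h x \<in> carrier Y"
    and "\<And>x y. \<lbrakk>x \<in> carrier X; y \<in> carrier X\<rbrakk> \<Longrightarrow> h (x \<oplus>\<^bsub>X\<^esub> y) = h x \<oplus>\<^bsub>Y\<^esub> h y"
  shows "h \<in> add_hom X Y"
  using assms by (auto simp: add_hom_def)

lemma add_hom_closed: "\<lbrakk>h \<in> add_hom X Y; x \<in> carrier X\<rbrakk> \<Longrightarrow> h x \<in> carrier Y"
  by (auto simp: add_hom_def)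

lemma add_hom_add:
  "\<lbrakk>h \<in> add_hom X Y; x \<in> carrier X; y \<in> carrier X\<rbrakk> \<Longrightarrow> h (x \<oplus>\<^bsub>X\<^esub> y) = h x \<oplus>\<^bsub>Y\<^esub> h y"
  by (auto simp: add_hom_def)

lemma add_hom_abelian_group_hom:
  assumes "abelian_group X" "abelian_group Y" "h \<in> add_hom X Y"
  shows "abelian_group_hom X Y h"
  using assms
  by (intro abelian_group_homI group_hom.intro abelian_group.a_group group_hom_axioms.intro homI)
     (auto simp: add_hom_def)

lemma add_hom_zero:
  "\<lbrakk>abelian_group X; abelian_group Y; h \<in> add_hom X Y\<rbrakk> \<Longrightarrow> h \<zero>\<^bsub>X\<^esub> = \<zero>\<^bsub>Y\<^esub>"
  using abelian_group_hom.hom_zero[OF add_hom_abelian_group_hom] .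

lemma add_hom_a_inv:
  "\<lbrakk>abelian_group X; abelian_group Y; h \<in> add_hom X Y; x \<in> carrier X\<rbrakk>
    \<Longrightarrow> h (\<ominus>\<^bsub>X\<^esub> x) = \<ominus>\<^bsub>Y\<^esub> h x"
  using abelian_group_hom.hom_a_inv[OF add_hom_abelian_group_hom] .

lemma add_hom_comp: "\<lbrakk>h \<in> add_hom X Y; g \<in> add_hom Y Z\<rbrakk> \<Longrightarrow> (\<lambda>x. g (h x)) \<in> add_hom X Z"
  by (auto simp: add_hom_def Pi_iff)

lemma add_hom_sum:
  assumes "abelian_monoid Y" "h \<in> add_hom X Y" "g \<in> add_hom X Y"
  shows "(\<lambda>x. h x \<oplus>\<^bsub>Y\<^esub> g x) \<in> add_hom X Y"
proof -
  interpret Y: abelian_monoid Y by fact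
  show ?thesis using assms by (auto simp: add_hom_def Pi_iff Y.a_ac)
qed

lemma add_hom_finsum:
  assumes "abelian_monoid Y" "\<And>i. i \<in> I \<Longrightarrow> h i \<in> add_hom X Y"
  shows "(\<lambda>x. \<Oplus>\<^bsub>Y\<^esub>i\<in>I. h i x) \<in> add_hom X Y"
proof -
  interpret Y: abelian_monoid Y by fact
  show ?thesis
  proof (rule add_homI)
    fix x y assume xy: "x \<in> carrier X" "y \<in> carrier X"
    show "(\<Oplus>\<^bsub>Y\<^esub>i\<in>I. h i x) \<in> carrier Y"
      using assms(2) xy by (intro Y.finsum_closed) (auto simp: add_hom_def)
    have "(\<Oplus>\<^bsub>Y\<^esub>i\<in>I. h i (x \<oplus>\<^bsub>X\<^esub> y)) = (\<Oplus>\<^bsub>Y\<^esub>i\<in>I. h i x \<oplus>\<^bsub>Y\<^esub> h i y)"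
      using assms(2) xy by (intro Y.finsum_cong') (auto simp: add_hom_def Pi_iff)
    also have "\<dots> = (\<Oplus>\<^bsub>Y\<^esub>i\<in>I. h i x) \<oplus>\<^bsub>Y\<^esub> (\<Oplus>\<^bsub>Y\<^esub>i\<in>I. h i y)"
      using assms(2) xy by (intro Y.finsum_addf) (auto simp: add_hom_def)
    finally show "(\<Oplus>\<^bsub>Y\<^esub>i\<in>I. h i (x \<oplus>\<^bsub>X\<^esub> y)) = (\<Oplus>\<^bsub>Y\<^esub>i\<in>I. h i x) \<oplus>\<^bsub>Y\<^esub> (\<Oplus>\<^bsub>Y\<^esub>i\<in>I. h i y)" .
  qed
qed

lemma zero_add_hom: "abelian_monoid Y \<Longrightarrow> (\<lambda>_. \<zero>\<^bsub>Y\<^esub>) \<in> add_hom X Y"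
  by (rule add_homI) (auto simp: abelian_monoid.zero_closed abelian_monoid.l_zero)

text \<open>Sums without negatives, so that an induction has a single step. The generating sets used
  below contain the negatives of their elements, hence the span is a subgroup nevertheless.\<close>

inductive_set aspan :: "('x, 'c) ring_scheme \<Rightarrow> 'x set \<Rightarrow> 'x set" for X G where
  zero: "\<zero>\<^bsub>X\<^esub> \<in> aspan X G"
| add: "\<lbrakk>g \<in> G; y \<in> aspan X G\<rbrakk> \<Longrightarrow> g \<oplus>\<^bsub>X\<^esub> y \<in> aspan X G"

text \<open>The span depends on zero and addition only, so it can be carried between records that
  share them but differ in carrier or scalars.\<close>

lemma aspan_cong:
  assumes "\<zero>\<^bsub>X\<^esub> = \<zero>\<^bsub>Y\<^esub>" "add X = add Y"
  shows "aspan X G = aspan Y G"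
proof -
  have "x \<in> aspan Y G" if "x \<in> aspan X G" for x
    using that by induction (auto simp: assms intro: aspan.intros)
  moreover have "x \<in> aspan X G" if "x \<in> aspan Y G" for x
    using that by induction (auto simp: assms[symmetric] intro: aspan.intros)
  ultimately show ?thesis by blast
qed

context abelian_monoid
begin

lemma aspan_closed: "\<lbrakk>x \<in> aspan G A; A \<subseteq> carrier G\<rbrakk> \<Longrightarrow> x \<in> carrier G"
  by (induction rule: aspan.induct) auto

lemma aspan_base:
  assumes "g \<in> A" "A \<subseteq> carrier G" shows "g \<in> aspan G A"
  using aspan.add[OF assms(1) aspan.zero, of G] assms by (metis r_zero subsetD)

lemma aspan_add:
  assumes "x \<in> aspan G A" "y \<in> aspan G A" "A \<subseteq> carrier G"
  shows "x \<oplus> y \<in> aspan G A"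
  using assms
proof (induction rule: aspan.induct)
  case zero then show ?case by (simp add: aspan_closed)
next
  case (add g x)
  then have "(g \<oplus> x) \<oplus> y = g \<oplus> (x \<oplus> y)"
    by (meson a_assoc aspan_closed subsetD)
  then show ?case using add by (auto intro: aspan.add)
qed

lemma aspan_subset:
  assumes "A \<subseteq> aspan G B" "B \<subseteq> carrier G" shows "aspan G A \<subseteq> aspan G B"
proof
  fix x assume "x \<in> aspan G A"
  then show "x \<in> aspan G B"
    by induction (use assms aspan_add in \<open>auto intro: aspan.zero\<close>)
qed

end

lemma aspan_image:
  assumes "abelian_group X" "abelian_group Y" "h \<in> add_hom X Y" "A \<subseteq> carrier X"
    and "\<And>g. g \<in> A \<Longrightarrow> h g \<in> aspan Y B" "B \<subseteq> carrier Y" "x \<in> aspan X A"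
  shows "h x \<in> aspan Y B"
  using assms(7)
proof induction
  case zero then show ?case using assms by (simp add: add_hom_zero aspan.zero)
next
  case (add g y)
  interpret X: abelian_group X by fact
  interpret Y: abelian_group Y by fact
  have "g \<in> carrier X" "y \<in> carrier X"
    using add assms X.aspan_closed by blast+
  then show ?case using add assms by (simp add: add_hom_add Y.aspan_add)
qed

lemma (in abelian_group) a_inv_zero: "\<ominus> \<zero> = \<zero>"
  by (metis l_neg r_zero zero_closed a_inv_closed)

lemma (in abelian_group) eq_if_minus_zero:
  "\<lbrakk>x \<in> carrier G; y \<in> carrier G; x \<ominus> y = \<zero>\<rbrakk> \<Longrightarrow> x = y"
  by (metis minus_eq minus_equality minus_minus a_inv_closed)

lemma (in abelian_group) eq_if_minus_eq:
  assumes "x \<in> carrier G" "y \<in> carrier G" "x \<ominus> y = z"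
  shows "x = y \<oplus> z"
  unfolding assms(3)[symmetric] minus_eq using assms(1,2)
  by (metis a_inv_closed a_lcomm r_neg r_zero)

lemma (in abelian_group) add_hom_uminus: "(\<lambda>x. \<ominus> x) \<in> add_hom G G"
  by (rule add_homI) (auto simp: minus_add a_comm)

lemma (in abelian_group) aspan_a_inv:
  assumes "x \<in> aspan G A" "\<And>g. g \<in> A \<Longrightarrow> \<ominus> g \<in> aspan G A" "A \<subseteq> carrier G"
  shows "\<ominus> x \<in> aspan G A"
  using aspan_image[OF abelian_group_axioms abelian_group_axioms add_hom_uminus] assms by blast

text \<open>The standard way to prove an identity here: fix all arguments but one, observe that both
  sides are additive in it, and compare them on generators.\<close>

lemma add_hom_eqI:
  assumes "abelian_group X" "abelian_group Y" "h \<in> add_hom X Y" "g \<in> add_hom X Y"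
    and "\<And>a. a \<in> A \<Longrightarrow> h a = g a" "A \<subseteq> carrier X" "x \<in> aspan X A"
  shows "h x = g x"
  using assms(7)
proof induction
  case zero then show ?case using assms by (simp add: add_hom_zero)
next
  case (add a y)
  interpret X: abelian_group X by fact
  have "a \<in> carrier X" "y \<in> carrier X"
    using add assms X.aspan_closed by blast+
  then show ?case using add assms by (simp add: add_hom_add)
qed

section \<open>Left modules\<close>

context left_module
begin

lemma smult_add_hom: "a \<in> carrier R \<Longrightarrow> (\<lambda>x. a \<odot>\<^bsub>M\<^esub> x) \<in> add_hom M M"
  by (rule add_homI) (auto simp: smult_r_distr)

lemma smult_add_hom': "x \<in> carrier M \<Longrightarrow> (\<lambda>a. a \<odot>\<^bsub>M\<^esub> x) \<in> add_hom R M"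
  by (rule add_homI) (auto simp: smult_l_distr)

lemma smult_l_null [simp]: "x \<in> carrier M \<Longrightarrow> \<zero>\<^bsub>R\<^esub> \<odot>\<^bsub>M\<^esub> x = \<zero>\<^bsub>M\<^esub>"
  using add_hom_zero[OF R.abelian_group_axioms M.abelian_group_axioms smult_add_hom'] .

lemma smult_r_null [simp]: "a \<in> carrier R \<Longrightarrow> a \<odot>\<^bsub>M\<^esub> \<zero>\<^bsub>M\<^esub> = \<zero>\<^bsub>M\<^esub>"
  using add_hom_zero[OF M.abelian_group_axioms M.abelian_group_axioms smult_add_hom] .

lemma smult_l_minus:
  "\<lbrakk>a \<in> carrier R; x \<in> carrier M\<rbrakk> \<Longrightarrow> (\<ominus>\<^bsub>R\<^esub> a) \<odot>\<^bsub>M\<^esub> x = \<ominus>\<^bsub>M\<^esub> (a \<odot>\<^bsub>M\<^esub> x)"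
  using add_hom_a_inv[OF R.abelian_group_axioms M.abelian_group_axioms smult_add_hom'] .

lemma minus_eq_smult: "x \<in> carrier M \<Longrightarrow> \<ominus>\<^bsub>M\<^esub> x = (\<ominus>\<^bsub>R\<^esub> \<one>\<^bsub>R\<^esub>) \<odot>\<^bsub>M\<^esub> x"
  by (simp add: smult_l_minus)

end

text \<open>\<open>fin_gen\<close> sums over a set, with one coefficient per element. The inductive
  span avoids this indexing, so that a generating set can be pushed along a map that is not
  injective on it; \<open>fin_gen_iff\<close> links the two.\<close>

definition lspan :: "('r, 'a) ring_scheme \<Rightarrow> ('r, 'x, 'c) module_scheme \<Rightarrow> 'x set \<Rightarrow> 'x set"
  where "lspan R X S = aspan X {a \<odot>\<^bsub>X\<^esub> s | a s. a \<in> carrier R \<and> s \<in> S}"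

context left_module
begin

lemma lspan_gens: "S \<subseteq> carrier M \<Longrightarrow> {a \<odot>\<^bsub>M\<^esub> s | a s. a \<in> carrier R \<and> s \<in> S} \<subseteq> carrier M"
  by auto

lemma lspan_closed: "\<lbrakk>S \<subseteq> carrier M; x \<in> lspan R M S\<rbrakk> \<Longrightarrow> x \<in> carrier M"
  unfolding lspan_def using M.aspan_closed lspan_gens by blast

lemma lspan_zero: "\<zero>\<^bsub>M\<^esub> \<in> lspan R M S"
  unfolding lspan_def by (rule aspan.zero)

lemma lspan_add:
  "\<lbrakk>S \<subseteq> carrier M; x \<in> lspan R M S; y \<in> lspan R M S\<rbrakk> \<Longrightarrow> x \<oplus>\<^bsub>M\<^esub> y \<in> lspan R M S"
  unfolding lspan_def using M.aspan_add lspan_gens by blast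

lemma lspan_smult:
  assumes "S \<subseteq> carrier M" "r \<in> carrier R" "x \<in> lspan R M S"
  shows "r \<odot>\<^bsub>M\<^esub> x \<in> lspan R M S"
  using assms(3) unfolding lspan_def
proof (rule aspan_image[OF M.abelian_group_axioms M.abelian_group_axioms smult_add_hom[OF assms(2)], rotated 3])
  show "r \<odot>\<^bsub>M\<^esub> g \<in> aspan M {a \<odot>\<^bsub>M\<^esub> s |a s. a \<in> carrier R \<and> s \<in> S}"
    if "g \<in> {a \<odot>\<^bsub>M\<^esub> s |a s. a \<in> carrier R \<and> s \<in> S}" for g
  proof -
    from that obtain a s where g: "g = a \<odot>\<^bsub>M\<^esub> s" "a \<in> carrier R" "s \<in> S" by blast
    then have "r \<odot>\<^bsub>M\<^esub> g = (r \<otimes>\<^bsub>R\<^esub> a) \<odot>\<^bsub>M\<^esub> s"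
      using assms by (auto simp: smult_assoc1)
    then show ?thesis
      using g assms by (intro M.aspan_base[OF _ lspan_gens[OF assms(1)]]) auto
  qed
qed (use assms in auto)

lemma lspan_base:
  assumes "S \<subseteq> carrier M" "s \<in> S" shows "s \<in> lspan R M S"
proof -
  have "s = \<one>\<^bsub>R\<^esub> \<odot>\<^bsub>M\<^esub> s" using assms by auto
  then have "s \<in> {a \<odot>\<^bsub>M\<^esub> s | a s. a \<in> carrier R \<and> s \<in> S}" using assms(2) R.one_closed by blast
  then show ?thesis unfolding lspan_def by (rule M.aspan_base) (rule lspan_gens[OF assms(1)])
qed

lemma lspan_finsum:
  assumes "finite S" "S \<subseteq> carrier M" "a \<in> S \<rightarrow> carrier R" "T \<subseteq> S"
  shows "(\<Oplus>\<^bsub>M\<^esub>s\<in>T. a s \<odot>\<^bsub>M\<^esub> s) \<in> lspan R M S"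
proof -
  have "finite T" using assms finite_subset by blast
  then show ?thesis using \<open>T \<subseteq> S\<close>
  proof (induction T)
    case empty then show ?case by (simp add: lspan_zero)
  next
    case (insert s T)
    have eq: "(\<Oplus>\<^bsub>M\<^esub>s\<in>insert s T. a s \<odot>\<^bsub>M\<^esub> s) = a s \<odot>\<^bsub>M\<^esub> s \<oplus>\<^bsub>M\<^esub> (\<Oplus>\<^bsub>M\<^esub>s\<in>T. a s \<odot>\<^bsub>M\<^esub> s)"
      using insert assms by (intro M.finsum_insert) (auto simp: Pi_iff intro!: smult_closed)
    have "a s \<odot>\<^bsub>M\<^esub> s \<in> lspan R M S"
      using insert.prems assms by (intro lspan_smult lspan_base) auto
    then show ?case
      unfolding eq using lspan_add[OF assms(2) _ insert.IH] insert.prems by simp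
  qed
qed

lemma lspan_imp_finsum:
  assumes "finite S" "S \<subseteq> carrier M" "x \<in> lspan R M S"
  shows "\<exists>a \<in> S \<rightarrow> carrier R. x = (\<Oplus>\<^bsub>M\<^esub>s\<in>S. a s \<odot>\<^bsub>M\<^esub> s)"
  using assms(3) unfolding lspan_def
proof induction
  case zero
  have "(\<Oplus>\<^bsub>M\<^esub>s\<in>S. \<zero>\<^bsub>R\<^esub> \<odot>\<^bsub>M\<^esub> s) = (\<Oplus>\<^bsub>M\<^esub>s\<in>S. \<zero>\<^bsub>M\<^esub>)"
    using assms by (intro M.finsum_cong') auto
  then show ?case by (intro bexI[of _ "\<lambda>_. \<zero>\<^bsub>R\<^esub>"]) (auto simp: M.finsum_zero)
next
  case (add g y)
  then obtain b t a where *: "b \<in> carrier R" "t \<in> S" "g = b \<odot>\<^bsub>M\<^esub> t" "a \<in> S \<rightarrow> carrier R"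
    "y = (\<Oplus>\<^bsub>M\<^esub>s\<in>S. a s \<odot>\<^bsub>M\<^esub> s)" by blast
  \<comment> \<open>t already has a coefficient in \<open>a\<close>; the new multiple of t is merged
    into it.\<close>
  let ?c = "\<lambda>s. if s = t then b \<oplus>\<^bsub>R\<^esub> a s else a s"
  have S: "S = insert t (S - {t})" "t \<notin> S - {t}" "finite (S - {t})" using * assms by auto
  have "(\<Oplus>\<^bsub>M\<^esub>s\<in>S. ?c s \<odot>\<^bsub>M\<^esub> s) = (b \<oplus>\<^bsub>R\<^esub> a t) \<odot>\<^bsub>M\<^esub> t \<oplus>\<^bsub>M\<^esub> (\<Oplus>\<^bsub>M\<^esub>s\<in>S-{t}. ?c s \<odot>\<^bsub>M\<^esub> s)"
    by (subst S(1), subst M.finsum_insert) (use * assms in \<open>auto simp: Pi_iff\<close>)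
  also have "(\<Oplus>\<^bsub>M\<^esub>s\<in>S-{t}. ?c s \<odot>\<^bsub>M\<^esub> s) = (\<Oplus>\<^bsub>M\<^esub>s\<in>S-{t}. a s \<odot>\<^bsub>M\<^esub> s)"
    using * assms by (intro M.finsum_cong') (auto simp: Pi_iff)
  also have "(b \<oplus>\<^bsub>R\<^esub> a t) \<odot>\<^bsub>M\<^esub> t \<oplus>\<^bsub>M\<^esub> (\<Oplus>\<^bsub>M\<^esub>s\<in>S-{t}. a s \<odot>\<^bsub>M\<^esub> s)
    = b \<odot>\<^bsub>M\<^esub> t \<oplus>\<^bsub>M\<^esub> (a t \<odot>\<^bsub>M\<^esub> t \<oplus>\<^bsub>M\<^esub> (\<Oplus>\<^bsub>M\<^esub>s\<in>S-{t}. a s \<odot>\<^bsub>M\<^esub> s))"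
    using * assms by (subst M.a_assoc[symmetric]) (auto simp: Pi_iff smult_l_distr subset_iff)
  also have "a t \<odot>\<^bsub>M\<^esub> t \<oplus>\<^bsub>M\<^esub> (\<Oplus>\<^bsub>M\<^esub>s\<in>S-{t}. a s \<odot>\<^bsub>M\<^esub> s) = y"
    unfolding *(5)
    by (subst (2) S(1), subst M.finsum_insert) (use * assms in \<open>auto simp: Pi_iff\<close>)
  finally show ?case
    using * assms by (intro bexI[of _ ?c]) (auto simp: Pi_iff)
qed

lemma fin_gen_iff:
  "fin_gen R M \<longleftrightarrow> (\<exists>S. finite S \<and> S \<subseteq> carrier M \<and> carrier M \<subseteq> lspan R M S)"
proof
  assume "fin_gen R M"
  then obtain S where "finite S" "S \<subseteq> carrier M"
    "\<forall>x\<in>carrier M. \<exists>a \<in> S \<rightarrow> carrier R. x = (\<Oplus>\<^bsub>M\<^esub>s\<in>S. a s \<odot>\<^bsub>M\<^esub> s)"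
    unfolding fin_gen_def by blast
  then show "\<exists>S. finite S \<and> S \<subseteq> carrier M \<and> carrier M \<subseteq> lspan R M S"
    using lspan_finsum[of S _ S] by (intro exI[of _ S]) auto
next
  assume "\<exists>S. finite S \<and> S \<subseteq> carrier M \<and> carrier M \<subseteq> lspan R M S"
  then obtain S where S: "finite S" "S \<subseteq> carrier M" "carrier M \<subseteq> lspan R M S" by blast
  then have "\<exists>a \<in> S \<rightarrow> carrier R. x = (\<Oplus>\<^bsub>M\<^esub>s\<in>S. a s \<odot>\<^bsub>M\<^esub> s)" if "x \<in> carrier M" for x
    using lspan_imp_finsum[OF S(1,2)] S(3) that by blast
  then show "fin_gen R M"
    unfolding fin_gen_def using S(1,2) by (intro exI[of _ S] conjI ballI)
qed

end

lemma lmod_hom_add_hom: "h \<in> lmod_hom R X Y \<Longrightarrow> h \<in> add_hom X Y"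
  by (auto simp: lmod_hom_def add_hom_def)

lemma lmod_hom_smult:
  "\<lbrakk>h \<in> lmod_hom R X Y; r \<in> carrier R; x \<in> carrier X\<rbrakk> \<Longrightarrow> h (r \<odot>\<^bsub>X\<^esub> x) = r \<odot>\<^bsub>Y\<^esub> h x"
  by (auto simp: lmod_hom_def)

lemma lmod_hom_iff:
  "h \<in> lmod_hom R X Y \<longleftrightarrow> h \<in> add_hom X Y \<and>
    (\<forall>r\<in>carrier R. \<forall>x\<in>carrier X. h (r \<odot>\<^bsub>X\<^esub> x) = r \<odot>\<^bsub>Y\<^esub> h x)"
  by (auto simp: lmod_hom_def add_hom_def)

text \<open>The two rings may differ: semilinearity along \<open>e\<close>, on the generators, is
  enough. It is used with \<epsilon> for reduction modulo M Y and with \<eta> for the snake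
  map.\<close>

lemma lspan_map:
  assumes "left_module R A" "left_module S B" "h \<in> add_hom A B" "G \<subseteq> carrier A"
    and semi: "\<And>r g. \<lbrakk>r \<in> carrier R; g \<in> G\<rbrakk> \<Longrightarrow> e r \<in> carrier S \<and> h (r \<odot>\<^bsub>A\<^esub> g) = e r \<odot>\<^bsub>B\<^esub> h g"
    and "x \<in> lspan R A G"
  shows "h x \<in> lspan S B (h ` G)"
proof -
  interpret A: left_module R A by fact
  interpret B: left_module S B by fact
  have hG: "h ` G \<subseteq> carrier B" using assms(3,4) by (auto simp: add_hom_def)
  show ?thesis
    using assms(6) unfolding lspan_def
  proof (rule aspan_image[OF A.M.abelian_group_axioms B.M.abelian_group_axioms assms(3), rotated 3])
    fix g assume "g \<in> {a \<odot>\<^bsub>A\<^esub> s |a s. a \<in> carrier R \<and> s \<in> G}"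
    then obtain a s where as: "g = a \<odot>\<^bsub>A\<^esub> s" "a \<in> carrier R" "s \<in> G" by blast
    then have "h g \<in> {a \<odot>\<^bsub>B\<^esub> s |a s. a \<in> carrier S \<and> s \<in> h ` G}" using semi[OF as(2,3)] by blast
    then show "h g \<in> aspan B {a \<odot>\<^bsub>B\<^esub> s |a s. a \<in> carrier S \<and> s \<in> h ` G}"
      by (rule B.M.aspan_base) (rule B.lspan_gens[OF hG])
  qed (use A.lspan_gens[OF assms(4)] B.lspan_gens[OF hG] in blast)+
qed

text \<open>The counterpart of \<open>lspan_map\<close>: a combination of images is lifted term by
  term, each coefficient being lifted through \<open>e\<close>.\<close>

lemma lspan_lift:
  assumes "left_module S A" "abelian_group B" "\<pi> \<in> add_hom A B" "G \<subseteq> carrier A"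
    and semi: "\<And>r g. \<lbrakk>r \<in> carrier R; g \<in> G\<rbrakk> \<Longrightarrow> e r \<in> carrier S \<and> \<pi> (e r \<odot>\<^bsub>A\<^esub> g) = r \<odot>\<^bsub>B\<^esub> \<pi> g"
    and "c \<in> lspan R B (\<pi> ` G)"
  shows "\<exists>u\<in>lspan S A G. c = \<pi> u"
  using assms(6) unfolding lspan_def[of R B]
proof induction
  interpret A: left_module S A by fact
  case zero
  then show ?case
    using add_hom_zero[OF A.M.abelian_group_axioms assms(2,3)] A.lspan_zero[of G] by metis
next
  interpret A: left_module S A by fact
  case (add b y)
  then obtain r g u where *: "b = r \<odot>\<^bsub>B\<^esub> \<pi> g" "r \<in> carrier R" "g \<in> G" "u \<in> lspan S A G" "y = \<pi> u" by blast
  then have e: "e r \<odot>\<^bsub>A\<^esub> g \<in> lspan S A G" "b = \<pi> (e r \<odot>\<^bsub>A\<^esub> g)"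
    using semi[of r g] A.lspan_smult[OF assms(4) _ A.lspan_base[OF assms(4)]] by auto
  have "b \<oplus>\<^bsub>B\<^esub> y = \<pi> (e r \<odot>\<^bsub>A\<^esub> g \<oplus>\<^bsub>A\<^esub> u)"
    using * e A.lspan_closed[OF assms(4)] by (simp add: add_hom_add[OF assms(3)])
  then show ?case using A.lspan_add[OF assms(4) e(1) *(4)] by blast
qed

section \<open>Submodules and quotient modules\<close>

definition lsubmod :: "('r, 'a) ring_scheme \<Rightarrow> ('r, 'x, 'c) module_scheme \<Rightarrow> 'x set \<Rightarrow> bool"
  where "lsubmod R X N \<longleftrightarrow> N \<subseteq> carrier X \<and> \<zero>\<^bsub>X\<^esub> \<in> N \<and>
    (\<forall>x\<in>N. \<forall>y\<in>N. x \<oplus>\<^bsub>X\<^esub> y \<in> N) \<and> (\<forall>r\<in>carrier R. \<forall>x\<in>N. r \<odot>\<^bsub>X\<^esub> x \<in> N)"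

lemma lsubmod_trans:
  assumes "lsubmod R X K" "lsubmod R (X\<lparr>carrier := K\<rparr>) N" shows "lsubmod R X N"
  using assms by (auto simp: lsubmod_def)

lemma (in left_module) lsubmod_lspan: "S \<subseteq> carrier M \<Longrightarrow> lsubmod R M (lspan R M S)"
  by (auto simp: lsubmod_def lspan_closed lspan_zero lspan_add lspan_smult)

lemma (in left_module) lspan_least:
  assumes "lsubmod R M N" "S \<subseteq> N" shows "lspan R M S \<subseteq> N"
proof
  fix x assume "x \<in> lspan R M S"
  then show "x \<in> N" unfolding lspan_def
    by induction (use assms in \<open>auto simp: lsubmod_def\<close>)
qed

lemma (in left_module) lsubmod_minus:
  assumes "lsubmod R M N" "x \<in> N" shows "\<ominus>\<^bsub>M\<^esub> x \<in> N"
  using assms minus_eq_smult[of x] by (auto simp: lsubmod_def)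

lemma (in left_module) lsubmod_left_module:
  assumes "lsubmod R M N" shows "left_module R (M\<lparr>carrier := N\<rparr>)"
proof -
  have *: "x \<in> carrier M" if "x \<in> N" for x using that assms by (auto simp: lsubmod_def)
  have "abelian_group (M\<lparr>carrier := N\<rparr>)"
  proof (rule abelian_groupI, simp_all)
    show "\<exists>y\<in>N. y \<oplus>\<^bsub>M\<^esub> x = \<zero>\<^bsub>M\<^esub>" if "x \<in> N" for x
      using that * lsubmod_minus[OF assms] M.l_neg by blast
  qed (use assms in \<open>auto simp: lsubmod_def * M.a_ac\<close>)
  then show ?thesis
    using assms R.ring_axioms *
    by (intro left_module.intro left_module_axioms.intro)
       (auto simp: lsubmod_def smult_l_distr smult_r_distr smult_assoc1)
qed

text \<open>Apart from closure and the existence of negatives, the module axioms are equations, and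
  all of them pass along a surjection that respects the operations. For cosets this avoids any
  calculation with \<open>set_add\<close>.\<close>

lemma left_module_surj_image:
  assumes "left_module R X" and surj: "\<pi> ` carrier X = carrier Q"
    and add: "\<And>x y. \<lbrakk>x \<in> carrier X; y \<in> carrier X\<rbrakk> \<Longrightarrow> \<pi> (x \<oplus>\<^bsub>X\<^esub> y) = \<pi> x \<oplus>\<^bsub>Q\<^esub> \<pi> y"
    and zero: "\<pi> \<zero>\<^bsub>X\<^esub> = \<zero>\<^bsub>Q\<^esub>"
    and smult: "\<And>r x. \<lbrakk>r \<in> carrier R; x \<in> carrier X\<rbrakk> \<Longrightarrow> \<pi> (r \<odot>\<^bsub>X\<^esub> x) = r \<odot>\<^bsub>Q\<^esub> \<pi> x"
  shows "left_module R Q"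
proof -
  interpret X: left_module R X by fact
  have cl: "\<pi> x \<in> carrier Q" if "x \<in> carrier X" for x using that surj by blast
  have ex: "\<exists>x\<in>carrier X. q = \<pi> x" if "q \<in> carrier Q" for q using that surj by blast
  have "abelian_group Q"
  proof (rule abelian_groupI)
    fix x y assume "x \<in> carrier Q" "y \<in> carrier Q"
    then obtain a b where *: "a \<in> carrier X" "b \<in> carrier X" "x = \<pi> a" "y = \<pi> b" using ex by metis
    show "x \<oplus>\<^bsub>Q\<^esub> y \<in> carrier Q" using * by (auto simp: add[symmetric] cl)
    show "x \<oplus>\<^bsub>Q\<^esub> y = y \<oplus>\<^bsub>Q\<^esub> x" using * by (auto simp: add[symmetric] X.M.a_comm)
    fix z assume "z \<in> carrier Q"
    then obtain c where c: "c \<in> carrier X" "z = \<pi> c" using ex by metis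
    show "x \<oplus>\<^bsub>Q\<^esub> y \<oplus>\<^bsub>Q\<^esub> z = x \<oplus>\<^bsub>Q\<^esub> (y \<oplus>\<^bsub>Q\<^esub> z)" using * c by (auto simp: add[symmetric] X.M.a_assoc)
  next
    show "\<zero>\<^bsub>Q\<^esub> \<in> carrier Q" by (auto simp: zero[symmetric] cl)
    fix x assume "x \<in> carrier Q"
    then obtain a where *: "a \<in> carrier X" "x = \<pi> a" using ex by metis
    show "\<zero>\<^bsub>Q\<^esub> \<oplus>\<^bsub>Q\<^esub> x = x" using * by (auto simp: add[symmetric] zero[symmetric])
    show "\<exists>y\<in>carrier Q. y \<oplus>\<^bsub>Q\<^esub> x = \<zero>\<^bsub>Q\<^esub>"
      using * by (intro bexI[of _ "\<pi> (\<ominus>\<^bsub>X\<^esub> a)"]) (auto simp: add[symmetric] zero[symmetric] cl X.M.l_neg)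
  qed
  moreover have "left_module_axioms R Q"
  proof
    fix a b x assume *: "a \<in> carrier R" "b \<in> carrier R" "x \<in> carrier Q"
    then obtain c where c: "c \<in> carrier X" "x = \<pi> c" using ex by metis
    show "(a \<oplus>\<^bsub>R\<^esub> b) \<odot>\<^bsub>Q\<^esub> x = a \<odot>\<^bsub>Q\<^esub> x \<oplus>\<^bsub>Q\<^esub> b \<odot>\<^bsub>Q\<^esub> x"
      using * c by (auto simp: add[symmetric] smult[symmetric] X.smult_l_distr)
    show "(a \<otimes>\<^bsub>R\<^esub> b) \<odot>\<^bsub>Q\<^esub> x = a \<odot>\<^bsub>Q\<^esub> (b \<odot>\<^bsub>Q\<^esub> x)"
      using * c by (auto simp: smult[symmetric] X.smult_assoc1)
  next
    fix a x assume *: "a \<in> carrier R" "x \<in> carrier Q"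
    then obtain c where c: "c \<in> carrier X" "x = \<pi> c" using ex by metis
    show "a \<odot>\<^bsub>Q\<^esub> x \<in> carrier Q" using * c by (auto simp: smult[symmetric] cl)
    fix y assume "y \<in> carrier Q"
    then obtain d where d: "d \<in> carrier X" "y = \<pi> d" using ex by metis
    show "a \<odot>\<^bsub>Q\<^esub> (x \<oplus>\<^bsub>Q\<^esub> y) = a \<odot>\<^bsub>Q\<^esub> x \<oplus>\<^bsub>Q\<^esub> a \<odot>\<^bsub>Q\<^esub> y"
      using * c d by (auto simp: add[symmetric] smult[symmetric] X.smult_r_distr)
  next
    fix x assume *: "x \<in> carrier Q"
    then obtain c where c: "c \<in> carrier X" "x = \<pi> c" using ex by metis
    show "\<one>\<^bsub>R\<^esub> \<odot>\<^bsub>Q\<^esub> x = x" using c by (auto simp: smult[symmetric])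
  qed
  ultimately show ?thesis using X.R.ring_axioms by (intro left_module.intro)
qed

context left_module
begin

context
  fixes N assumes N: "lsubmod R M N"
begin

lemma lsubmod_abelian_subgroup: "abelian_subgroup N M"
proof (rule abelian_subgroupI3)
  show "additive_subgroup N M"
    by (rule additive_subgroupI, rule M.add.subgroupI)
       (use N lsubmod_minus[OF N] in \<open>auto simp: lsubmod_def a_inv_def[symmetric]\<close>)
qed (rule M.abelian_group_axioms)

interpretation N: abelian_subgroup N M by (rule lsubmod_abelian_subgroup)

lemma quot_carrier: "carrier (quot_lmod M N) = (\<lambda>x. N +>\<^bsub>M\<^esub> x) ` carrier M"
  by (auto simp: quot_lmod_def A_RCOSETS_def' )

lemma quot_zero: "N +>\<^bsub>M\<^esub> \<zero>\<^bsub>M\<^esub> = \<zero>\<^bsub>quot_lmod M N\<^esub>"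
  using N by (simp add: quot_lmod_def lsubmod_def M.a_coset_add_zero)

lemma quot_add:
  "\<lbrakk>x \<in> carrier M; y \<in> carrier M\<rbrakk>
    \<Longrightarrow> N +>\<^bsub>M\<^esub> (x \<oplus>\<^bsub>M\<^esub> y) = (N +>\<^bsub>M\<^esub> x) \<oplus>\<^bsub>quot_lmod M N\<^esub> (N +>\<^bsub>M\<^esub> y)"
  by (simp add: quot_lmod_def N.a_rcos_sum)

lemma quot_eq_iff:
  assumes "x \<in> carrier M" "y \<in> carrier M"
  shows "N +>\<^bsub>M\<^esub> x = N +>\<^bsub>M\<^esub> y \<longleftrightarrow> x \<oplus>\<^bsub>M\<^esub> \<ominus>\<^bsub>M\<^esub> y \<in> N"
  using assms N.a_rcos_module[of y x] N.a_repr_independence'[of x y] N.a_rcos_self[of x]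
  by (auto simp: M.minus_eq)

text \<open>The scalar action on cosets is a union over all representatives. Two representatives
  differ by an element of N, and so do their multiples; hence all members of the union are the same
  coset.\<close>

lemma quot_smult:
  assumes "r \<in> carrier R" "x \<in> carrier M"
  shows "N +>\<^bsub>M\<^esub> (r \<odot>\<^bsub>M\<^esub> x) = r \<odot>\<^bsub>quot_lmod M N\<^esub> (N +>\<^bsub>M\<^esub> x)"
proof -
  have "N +>\<^bsub>M\<^esub> (r \<odot>\<^bsub>M\<^esub> y) = N +>\<^bsub>M\<^esub> (r \<odot>\<^bsub>M\<^esub> x)" if y: "y \<in> N +>\<^bsub>M\<^esub> x" for y
  proof -
    have yc: "y \<in> carrier M" using y assms N.a_elemrcos_carrier by blast
    have "y \<oplus>\<^bsub>M\<^esub> \<ominus>\<^bsub>M\<^esub> x \<in> N" using N.a_rcos_module[of x y] y yc assms by simp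
    then have "r \<odot>\<^bsub>M\<^esub> (y \<oplus>\<^bsub>M\<^esub> \<ominus>\<^bsub>M\<^esub> x) \<in> N" using N assms by (simp add: lsubmod_def)
    then have "r \<odot>\<^bsub>M\<^esub> y \<oplus>\<^bsub>M\<^esub> \<ominus>\<^bsub>M\<^esub> (r \<odot>\<^bsub>M\<^esub> x) \<in> N"
      using yc assms add_hom_a_inv[OF M.abelian_group_axioms M.abelian_group_axioms smult_add_hom, of r x]
      by (simp add: smult_r_distr)
    then show ?thesis using yc assms by (simp add: quot_eq_iff)
  qed
  then have "(\<Union>y\<in>N +>\<^bsub>M\<^esub> x. N +>\<^bsub>M\<^esub> (r \<odot>\<^bsub>M\<^esub> y)) = (\<Union>y\<in>N +>\<^bsub>M\<^esub> x. N +>\<^bsub>M\<^esub> (r \<odot>\<^bsub>M\<^esub> x))"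
    by (intro SUP_cong) auto
  also have "\<dots> = N +>\<^bsub>M\<^esub> (r \<odot>\<^bsub>M\<^esub> x)"
    using N.a_rcos_self[OF assms(2)] by auto
  finally show ?thesis by (simp add: quot_lmod_def)
qed

lemma quot_left_module: "left_module R (quot_lmod M N)"
  by (rule left_module_surj_image[OF left_module_axioms, of "\<lambda>x. N +>\<^bsub>M\<^esub> x"])
     (auto simp: quot_carrier quot_add quot_zero quot_smult)

lemma quot_lmod_hom: "(\<lambda>x. N +>\<^bsub>M\<^esub> x) \<in> lmod_hom R M (quot_lmod M N)"
  by (auto simp: lmod_hom_def quot_carrier quot_add quot_smult)

lemma quot_eq_zero_iff:
  "x \<in> carrier M \<Longrightarrow> N +>\<^bsub>M\<^esub> x = \<zero>\<^bsub>quot_lmod M N\<^esub> \<longleftrightarrow> x \<in> N"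
  using quot_eq_iff[of x "\<zero>\<^bsub>M\<^esub>"] M.add.inv_one by (simp add: quot_zero a_inv_def)

end

end

lemma lsubmod_ker:
  assumes "left_module R X" "left_module R Y" "h \<in> lmod_hom R X Y"
  shows "lsubmod R X {x \<in> carrier X. h x = \<zero>\<^bsub>Y\<^esub>}"
proof -
  interpret X: left_module R X by fact
  interpret Y: left_module R Y by fact
  show ?thesis
    using assms(3) add_hom_zero[OF X.M.abelian_group_axioms Y.M.abelian_group_axioms lmod_hom_add_hom[OF assms(3)]]
    by (auto simp: lsubmod_def lmod_hom_def)
qed

text \<open>\<open>lmod_ker\<close> changes the carrier alone, and a span never consults the
  carrier. This permits moving between spans in a kernel and in the ambient module.\<close>

lemma lspan_lmod_ker: "lspan R (lmod_ker A B h) G = lspan R A G"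
proof -
  have "smult (lmod_ker A B h) = smult A" by (simp add: lmod_ker_def)
  then show ?thesis unfolding lspan_def by (simp only:) (rule aspan_cong; simp add: lmod_ker_def)
qed

lemma ker_left_module:
  assumes "left_module R X" "left_module R Y" "h \<in> lmod_hom R X Y"
  shows "left_module R (lmod_ker X Y h)"
  unfolding lmod_ker_def by (rule left_module.lsubmod_left_module[OF assms(1) lsubmod_ker[OF assms]])

lemma reg_left_module: "ring R \<Longrightarrow> left_module R (reg_lmod R)"
proof -
  assume "ring R"
  then interpret ring R .
  have "abelian_group (reg_lmod R)"
    by (rule abelian_groupI) (auto simp: reg_lmod_def a_ac intro: l_neg)
  then show ?thesis
    by (intro left_module.intro left_module_axioms.intro ring_axioms)
       (auto simp: reg_lmod_def l_distr r_distr m_assoc)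
qed

section \<open>Products of abelian groups and free modules\<close>

lemma abelian_group_PiE:
  assumes ab: "\<And>i. i \<in> I \<Longrightarrow> abelian_group (T i)"
    and G: "carrier G = (\<Pi>\<^sub>E i\<in>I. carrier (T i))" "\<zero>\<^bsub>G\<^esub> = (\<lambda>i\<in>I. \<zero>\<^bsub>T i\<^esub>)"
      "\<And>v w. v \<oplus>\<^bsub>G\<^esub> w = (\<lambda>i\<in>I. v i \<oplus>\<^bsub>T i\<^esub> w i)"
  shows "abelian_group G"
proof -
  note abm = abelian_group.axioms(1)[OF ab]
  show ?thesis
  proof (rule abelian_groupI, goal_cases)
    case (1 x y)
    then show ?case by (auto simp: G PiE_iff abelian_monoid.a_closed[OF abm])
  next
    case 2 then show ?case by (auto simp: G abelian_monoid.zero_closed[OF abm])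
  next
    case (3 x y z)
    then show ?case by (auto simp: G PiE_iff abelian_monoid.a_assoc[OF abm] restrict_def fun_eq_iff)
  next
    case (4 x y)
    then show ?case by (auto simp: G PiE_iff abelian_monoid.a_comm[OF abm] restrict_def fun_eq_iff)
  next
    case (5 x)
    then show ?case
      by (auto simp: G PiE_iff abelian_monoid.l_zero[OF abm] extensional_def restrict_def fun_eq_iff)
  next
    case (6 x)
    then show ?case
      by (intro bexI[of _ "\<lambda>i\<in>I. \<ominus>\<^bsub>T i\<^esub> x i"])
         (auto simp: G PiE_iff abelian_group.l_neg[OF ab] abelian_group.a_inv_closed[OF ab] intro!: restrict_ext)
  qed
qed

definition free_unit :: "('r, 'a) ring_scheme \<Rightarrow> nat \<Rightarrow> nat \<Rightarrow> 'r \<Rightarrow> nat \<Rightarrow> 'r"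
  where "free_unit R k l a = (\<lambda>i\<in>{..<k}. if i = l then a else \<zero>\<^bsub>R\<^esub>)"

context ring
begin

lemma free_left_module: "left_module R (free_lmod R k)"
proof -
  have "abelian_group (free_lmod R k)"
    by (rule abelian_group_PiE[of "{..<k}" "\<lambda>_. R"]) (auto simp: free_lmod_def intro: abelian_group_axioms)
  then show ?thesis
    by (intro left_module.intro left_module_axioms.intro ring_axioms)
       (auto simp: free_lmod_def l_distr r_distr m_assoc PiE_iff restrict_def fun_eq_iff extensional_def)
qed

lemma free_unit_closed: "a \<in> carrier R \<Longrightarrow> free_unit R k l a \<in> carrier (free_lmod R k)"
  by (auto simp: free_unit_def free_lmod_def)

lemma free_unit_smult:
  "\<lbrakk>a \<in> carrier R; b \<in> carrier R\<rbrakk> \<Longrightarrow> free_unit R k l (a \<otimes> b) = a \<odot>\<^bsub>free_lmod R k\<^esub> free_unit R k l b"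
  by (auto simp: free_unit_def free_lmod_def intro!: restrict_ext)

lemma free_lmod_induct:
  assumes v: "v \<in> carrier (free_lmod R k)"
    and zero: "P \<zero>\<^bsub>free_lmod R k\<^esub>"
    and add: "\<And>l a u. \<lbrakk>l < k; a \<in> carrier R; u \<in> carrier (free_lmod R k); P u; a = v l\<rbrakk> \<Longrightarrow>
      P (free_unit R k l a \<oplus>\<^bsub>free_lmod R k\<^esub> u)"
  shows "P v"
proof -
  \<comment> \<open>Truncation of v to its first m entries: it starts at zero, ends at v, and each
    step adds one unit vector.\<close>
  define w where "w m = (\<lambda>i\<in>{..<k}. if i < m then v i else \<zero>)" for m
  have wc: "w m \<in> carrier (free_lmod R k)" for m
    using v by (auto simp: w_def free_lmod_def PiE_iff)
  have "m \<le> k \<Longrightarrow> P (w m)" for m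
  proof (induction m)
    case 0
    have "w 0 = \<zero>\<^bsub>free_lmod R k\<^esub>" by (auto simp: w_def free_lmod_def)
    then show ?case using zero by simp
  next
    case (Suc m)
    have ac: "v m \<in> carrier R" using Suc.prems v by (auto simp: free_lmod_def PiE_iff)
    have "w (Suc m) = free_unit R k m (v m) \<oplus>\<^bsub>free_lmod R k\<^esub> w m"
      using less_Suc_eq v Suc.prems ac
      by (auto simp: w_def free_lmod_def free_unit_def PiE_iff intro!: restrict_ext)
    then show ?case using add[OF _ ac wc _ refl] Suc by simp
  qed
  moreover have "w k = v"
    using v by (auto simp: w_def free_lmod_def PiE_iff extensional_def fun_eq_iff)
  ultimately show ?thesis by (metis order_refl)
qed

lemma free_lmod_hom_eqI:
  assumes "left_module R Y" "h \<in> lmod_hom R (free_lmod R k) Y" "g \<in> lmod_hom R (free_lmod R k) Y"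
    and "\<And>l. l < k \<Longrightarrow> h (free_unit R k l \<one>) = g (free_unit R k l \<one>)"
    and "v \<in> carrier (free_lmod R k)"
  shows "h v = g v"
  using assms(5)
proof (rule free_lmod_induct)
  interpret F: left_module R "free_lmod R k" by (rule free_left_module)
  interpret Y: left_module R Y by fact
  show "h \<zero>\<^bsub>free_lmod R k\<^esub> = g \<zero>\<^bsub>free_lmod R k\<^esub>"
    using add_hom_zero[OF F.M.abelian_group_axioms Y.M.abelian_group_axioms] assms(2,3)
    by (metis lmod_hom_add_hom)
next
  fix l a u assume *: "l < k" "a \<in> carrier R" "u \<in> carrier (free_lmod R k)" "h u = g u"
  have "free_unit R k l a = a \<odot>\<^bsub>free_lmod R k\<^esub> free_unit R k l \<one>"
    using free_unit_smult[of a \<one>] * by simp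
  then have "h (free_unit R k l a) = g (free_unit R k l a)"
    using * assms by (simp add: lmod_hom_smult free_unit_closed)
  then show "h (free_unit R k l a \<oplus>\<^bsub>free_lmod R k\<^esub> u) = g (free_unit R k l a \<oplus>\<^bsub>free_lmod R k\<^esub> u)"
    using * add_hom_add[OF lmod_hom_add_hom[OF assms(2)]] add_hom_add[OF lmod_hom_add_hom[OF assms(3)]]
    by (simp add: free_unit_closed)
qed

end

definition free_lift :: "('r, 'x, 'c) module_scheme \<Rightarrow> nat \<Rightarrow> (nat \<Rightarrow> 'x) \<Rightarrow> (nat \<Rightarrow> 'r) \<Rightarrow> 'x"
  where "free_lift X k x v = (\<Oplus>\<^bsub>X\<^esub>l\<in>{..<k}. v l \<odot>\<^bsub>X\<^esub> x l)"

context left_module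
begin

lemma smult_finsum:
  assumes "a \<in> carrier R" "f \<in> I \<rightarrow> carrier M"
  shows "a \<odot>\<^bsub>M\<^esub> (\<Oplus>\<^bsub>M\<^esub>i\<in>I. f i) = (\<Oplus>\<^bsub>M\<^esub>i\<in>I. a \<odot>\<^bsub>M\<^esub> f i)"
proof (cases "finite I")
  case True
  then show ?thesis using assms(2)
    by (induction I) (use assms in \<open>auto simp: smult_r_distr Pi_iff\<close>)
next
  case False
  then show ?thesis using assms by (simp add: M.finsum_infinite)
qed

lemma free_lift_hom:
  assumes "x \<in> {..<k} \<rightarrow> carrier M"
  shows "free_lift M k x \<in> lmod_hom R (free_lmod R k) M"
  unfolding lmod_hom_iff
proof (intro conjI ballI)
  show "free_lift M k x \<in> add_hom (free_lmod R k) M"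
    unfolding free_lift_def
    by (rule add_hom_finsum[OF M.abelian_monoid_axioms], rule add_homI)
       (use assms in \<open>auto simp: free_lmod_def PiE_iff Pi_iff smult_l_distr\<close>)
  show "free_lift M k x (r \<odot>\<^bsub>free_lmod R k\<^esub> v) = r \<odot>\<^bsub>M\<^esub> free_lift M k x v"
    if "r \<in> carrier R" "v \<in> carrier (free_lmod R k)" for r v
    unfolding free_lift_def
    by (subst smult_finsum) (use assms that in \<open>auto simp: free_lmod_def PiE_iff Pi_iff smult_assoc1 intro!: M.finsum_cong'\<close>)
qed

lemma free_lift_unit:
  assumes "x \<in> {..<k} \<rightarrow> carrier M" "l < k" "a \<in> carrier R"
  shows "free_lift M k x (free_unit R k l a) = a \<odot>\<^bsub>M\<^esub> x l"
proof -
  have "free_lift M k x (free_unit R k l a) = (\<Oplus>\<^bsub>M\<^esub>i\<in>{..<k}. if l = i then a \<odot>\<^bsub>M\<^esub> x i else \<zero>\<^bsub>M\<^esub>)"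
    unfolding free_lift_def free_unit_def
    by (rule M.finsum_cong') (use assms in \<open>auto simp: Pi_iff\<close>)
  also have "\<dots> = a \<odot>\<^bsub>M\<^esub> x l"
    by (rule M.finsum_singleton) (use assms in \<open>auto simp: Pi_iff\<close>)
  finally show ?thesis .
qed

end

section \<open>Tensor chains\<close>

locale bimodule_pair = bimodule R M + N: left_module R N
  for R :: "('r, 'a) ring_scheme" (structure) and M :: "('r, 'm, 'b) bimod_scheme" (structure)
    and N :: "('r, 'x, 'c) module_scheme"

lemma (in bimodule) bimodule_pair_reg: "bimodule_pair R M (reg_lmod R)"
  using bimodule_axioms reg_left_module[OF R.ring_axioms] by (intro bimodule_pair.intro)

text \<open>After closure there is one clause for each constructor of \<open>chain_rels\<close>:
  this is what a map of generators needs in order to descend to the quotient.\<close>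

definition chain_multilinear ::
  "('r, 'a) ring_scheme \<Rightarrow> ('r, 'm, 'b) bimod_scheme \<Rightarrow> nat \<Rightarrow> ('r, 'x, 'c) module_scheme
    \<Rightarrow> ('y, 'd) ring_scheme \<Rightarrow> ('m list \<times> 'x \<Rightarrow> 'y) \<Rightarrow> bool"
  where "chain_multilinear R M i N Y \<phi> \<longleftrightarrow> \<phi> \<in> chain_gens M i N \<rightarrow> carrier Y \<and>
    (\<forall>us a vs x b. (us @ a # vs, x) \<in> chain_gens M i N \<longrightarrow> b \<in> carrier M \<longrightarrow>
      \<phi> (us @ (a \<oplus>\<^bsub>M\<^esub> b) # vs, x) = \<phi> (us @ a # vs, x) \<oplus>\<^bsub>Y\<^esub> \<phi> (us @ b # vs, x)) \<and>
    (\<forall>us x y. (us, x) \<in> chain_gens M i N \<longrightarrow> y \<in> carrier N \<longrightarrow>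
      \<phi> (us, x \<oplus>\<^bsub>N\<^esub> y) = \<phi> (us, x) \<oplus>\<^bsub>Y\<^esub> \<phi> (us, y)) \<and>
    (\<forall>us a b vs x r. (us @ a # b # vs, x) \<in> chain_gens M i N \<longrightarrow> r \<in> carrier R \<longrightarrow>
      \<phi> (us @ (a \<odot>r\<^bsub>M\<^esub> r) # b # vs, x) = \<phi> (us @ a # (r \<odot>\<^bsub>M\<^esub> b) # vs, x)) \<and>
    (\<forall>us a x r. (us @ [a], x) \<in> chain_gens M i N \<longrightarrow> r \<in> carrier R \<longrightarrow>
      \<phi> (us @ [a \<odot>r\<^bsub>M\<^esub> r], x) = \<phi> (us @ [a], r \<odot>\<^bsub>N\<^esub> x))"

lemma chain_multilinear_closed:
  "\<lbrakk>chain_multilinear R M i N Y \<phi>; p \<in> chain_gens M i N\<rbrakk> \<Longrightarrow> \<phi> p \<in> carrier Y"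
  by (auto simp: chain_multilinear_def)

lemma chain_multilinear_add_left:
  "\<lbrakk>chain_multilinear R M i N Y \<phi>; (us @ a # vs, x) \<in> chain_gens M i N; b \<in> carrier M\<rbrakk>
    \<Longrightarrow> \<phi> (us @ (a \<oplus>\<^bsub>M\<^esub> b) # vs, x) = \<phi> (us @ a # vs, x) \<oplus>\<^bsub>Y\<^esub> \<phi> (us @ b # vs, x)"
  by (simp add: chain_multilinear_def)

lemma chain_multilinear_add_right:
  "\<lbrakk>chain_multilinear R M i N Y \<phi>; (us, x) \<in> chain_gens M i N; y \<in> carrier N\<rbrakk>
    \<Longrightarrow> \<phi> (us, x \<oplus>\<^bsub>N\<^esub> y) = \<phi> (us, x) \<oplus>\<^bsub>Y\<^esub> \<phi> (us, y)"
  by (simp add: chain_multilinear_def)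

lemma chain_multilinear_balanced:
  "\<lbrakk>chain_multilinear R M i N Y \<phi>; (us @ a # b # vs, x) \<in> chain_gens M i N; r \<in> carrier R\<rbrakk>
    \<Longrightarrow> \<phi> (us @ (a \<odot>r\<^bsub>M\<^esub> r) # b # vs, x) = \<phi> (us @ a # (r \<odot>\<^bsub>M\<^esub> b) # vs, x)"
  by (simp add: chain_multilinear_def)

lemma chain_multilinear_balanced_last:
  "\<lbrakk>chain_multilinear R M i N Y \<phi>; (us @ [a], x) \<in> chain_gens M i N; r \<in> carrier R\<rbrakk>
    \<Longrightarrow> \<phi> (us @ [a \<odot>r\<^bsub>M\<^esub> r], x) = \<phi> (us @ [a], r \<odot>\<^bsub>N\<^esub> x)"
  by (simp add: chain_multilinear_def)

lemma chain_gens_iff: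
  "(ms, x) \<in> chain_gens M i N \<longleftrightarrow> length ms = i \<and> set ms \<subseteq> carrier M \<and> x \<in> carrier N"
  by (simp add: chain_gens_def)

lemma tensor_chain_simps:
  "carrier (tensor_chain R M i N) = carrier (chain_group R M i N)"
  "add (tensor_chain R M i N) = mult (chain_group R M i N)"
  "\<zero>\<^bsub>tensor_chain R M i N\<^esub> = \<one>\<^bsub>chain_group R M i N\<^esub>"
  by (simp_all add: tensor_chain_def Let_def)

text \<open>The definitions apply \<open>chain_lift\<close> to \<open>chain_group\<close>, whereas
  the universal property below speaks of the additive monoid of a ring record. Products and integer
  powers, with the inverses that the latter involve, look only at carrier, multiplication and unit,
  so the two uses agree.\<close>

lemma chain_lift_cong:
  assumes "carrier A = carrier B" "mult A = mult B" "\<one>\<^bsub>A\<^esub> = \<one>\<^bsub>B\<^esub>"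
  shows "chain_lift A = chain_lift B"
proof -
  have "inv\<^bsub>A\<^esub> x = inv\<^bsub>B\<^esub> x" for x by (simp add: m_inv_def assms)
  then show ?thesis
    by (intro ext) (simp add: chain_lift_def finprod_def int_pow_def nat_pow_def assms Let_def cong: if_cong)
qed

lemma chain_lift_chain_group:
  "chain_lift (chain_group R M i N) = chain_lift (add_monoid (tensor_chain R M i N))"
  by (rule chain_lift_cong) (simp_all add: tensor_chain_simps)

section \<open>The universal property of tensor chains\<close>

context bimodule_pair
begin

lemma free_Abelian_group_diff_closed:
  "\<lbrakk>x \<in> carrier (free_Abelian_group S); y \<in> carrier (free_Abelian_group S)\<rbrakk>
    \<Longrightarrow> x - y \<in> carrier (free_Abelian_group S)"
  using keys_diff[of x y] by auto

lemma chain_rels_closed: "chain_rels R M i N \<subseteq> carrier (free_Abelian_group (chain_gens M i N))"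
proof
  fix c assume "c \<in> chain_rels R M i N"
  then show "c \<in> carrier (free_Abelian_group (chain_gens M i N))"
    by cases (auto simp: chain_gens_iff simp del: carrier_free_Abelian_group_iff
        intro!: free_Abelian_group_diff_closed)
qed

lemma chain_rels_normal:
  "generate (free_Abelian_group (chain_gens M i N)) (chain_rels R M i N)
    \<lhd> free_Abelian_group (chain_gens M i N)"
  by (intro comm_group.subgroup_imp_normal abelian_free_Abelian_group
      group.generate_is_subgroup group_free_Abelian_group chain_rels_closed)

lemma tensor_chain_abelian_group: "abelian_group (tensor_chain R M i N)"
proof -
  have "comm_group (chain_group R M i N)"
    unfolding chain_group_def Let_def
    by (intro comm_group.abelian_FactGroup abelian_free_Abelian_group
      group.generate_is_subgroup group_free_Abelian_group chain_rels_closed)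
  then interpret G: comm_group "chain_group R M i N" .
  show ?thesis
    by (rule abelian_groupI) (simp_all add: tensor_chain_simps G.m_ac G.l_inv_ex)
qed

lemma chain_class_hom:
  "(\<lambda>c. generate (free_Abelian_group (chain_gens M i N)) (chain_rels R M i N)
      #>\<^bsub>free_Abelian_group (chain_gens M i N)\<^esub> c)
    \<in> hom (free_Abelian_group (chain_gens M i N)) (add_monoid (tensor_chain R M i N))"
  using normal.r_coset_hom_Mod[OF chain_rels_normal]
  by (simp add: hom_def tensor_chain_simps chain_group_def Let_def)

lemma chain_of_closed: "p \<in> chain_gens M i N \<Longrightarrow> chain_of R M i N p \<in> carrier (tensor_chain R M i N)"
  using hom_in_carrier[OF chain_class_hom[of i], of "frag_of p"] by (simp add: chain_of_def Let_def)

text \<open>A relation lies in the subgroup that is divided out, so its class is zero; since taking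
  classes is a homomorphism, each formal difference becomes an equation in the quotient.\<close>

lemma chain_of_multilinear:
  "chain_multilinear R M i N (tensor_chain R M i N) (chain_of R M i N)"
proof -
  let ?F = "free_Abelian_group (chain_gens M i N)" and ?T = "tensor_chain R M i N"
  let ?K = "generate ?F (chain_rels R M i N)"
  let ?q = "\<lambda>c. ?K #>\<^bsub>?F\<^esub> c"
  interpret T: abelian_group ?T by (rule tensor_chain_abelian_group)
  interpret q: group_hom ?F "add_monoid ?T" ?q
    by (intro group_hom.intro group_hom_axioms.intro chain_class_hom) (auto intro: T.a_group)
  have diff: "?q (c - d) = ?q c \<ominus>\<^bsub>?T\<^esub> ?q d" if "c \<in> carrier ?F" "d \<in> carrier ?F" for c d
    using q.hom_mult[of c "inv\<^bsub>?F\<^esub> d"] q.hom_inv[of d] that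
    by (simp add: a_inv_def a_minus_def)
  have rel: "?q c = \<zero>\<^bsub>?T\<^esub>" if "c \<in> chain_rels R M i N" for c
  proof -
    have "c \<in> ?K" using that by (rule generate.incl)
    then have "?q c = ?K"
      by (intro group.coset_join2 group_free_Abelian_group normal_imp_subgroup chain_rels_normal)
         (use that chain_rels_closed in blast)+
    then show ?thesis
      using q.hom_one by (simp add: tensor_chain_simps chain_group_def Let_def FactGroup_def)
  qed
  have eq: "chain_of R M i N p = ?q (frag_of p)" for p
    by (simp add: chain_of_def Let_def)
  have cl: "?q (frag_of p) \<in> carrier ?T" if "p \<in> chain_gens M i N" for p
    using chain_of_closed[OF that] by (simp add: eq)
  have sum_rel: "chain_of R M i N p = chain_of R M i N p' \<oplus>\<^bsub>?T\<^esub> chain_of R M i N p''"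
    if "frag_of p - frag_of p' - frag_of p'' \<in> chain_rels R M i N"
      "p \<in> chain_gens M i N" "p' \<in> chain_gens M i N" "p'' \<in> chain_gens M i N" for p p' p''
  proof -
    have "?q (frag_of p - frag_of p' - frag_of p'')
      = ?q (frag_of p) \<ominus>\<^bsub>?T\<^esub> ?q (frag_of p') \<ominus>\<^bsub>?T\<^esub> ?q (frag_of p'')"
      using that by (subst diff, (auto intro!: free_Abelian_group_diff_closed simp del: carrier_free_Abelian_group_iff)[2])+ simp
    then have "?q (frag_of p) \<ominus>\<^bsub>?T\<^esub> ?q (frag_of p') \<ominus>\<^bsub>?T\<^esub> ?q (frag_of p'') = \<zero>\<^bsub>?T\<^esub>"
      using rel[OF that(1)] by simp
    then show ?thesis
      using that(2-) cl unfolding eq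
      using T.eq_if_minus_zero[OF T.minus_closed] T.eq_if_minus_eq by metis
  qed
  have eq_rel: "chain_of R M i N p = chain_of R M i N p'"
    if "frag_of p - frag_of p' \<in> chain_rels R M i N"
      "p \<in> chain_gens M i N" "p' \<in> chain_gens M i N" for p p'
    using rel[OF that(1)] diff[of "frag_of p" "frag_of p'"] that cl unfolding eq
    by (simp add: T.eq_if_minus_zero)
  show ?thesis
    unfolding chain_multilinear_def
  proof (intro conjI allI impI, goal_cases)
    case 1 then show ?case by (auto simp: chain_of_closed)
  next
    case (2 us a vs x b)
    then show ?case by (intro sum_rel chain_rels.add_left) (auto simp: chain_gens_iff)
  next
    case (3 us x y)
    then show ?case by (intro sum_rel chain_rels.add_right) (auto simp: chain_gens_iff)
  next
    case (4 us a b vs x r)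
    then show ?case by (intro eq_rel chain_rels.balanced) (auto simp: chain_gens_iff)
  next
    case (5 us a x r)
    then show ?case by (intro eq_rel chain_rels.balanced_last) (auto simp: chain_gens_iff)
  qed
qed

lemma chain_of_uminus:
  assumes "(ms, x) \<in> chain_gens M i N"
  shows "\<ominus>\<^bsub>tensor_chain R M i N\<^esub> chain_of R M i N (ms, x) = chain_of R M i N (ms, \<ominus>\<^bsub>N\<^esub> x)"
proof -
  have "(\<lambda>x. chain_of R M i N (ms, x)) \<in> add_hom N (tensor_chain R M i N)"
    using assms chain_of_multilinear[of i]
    by (intro add_homI) (auto simp: chain_multilinear_def chain_gens_iff chain_of_closed)
  from add_hom_a_inv[OF N.M.abelian_group_axioms tensor_chain_abelian_group this] show ?thesis
    using assms by (simp add: chain_gens_iff)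
qed

lemma chain_of_gens_closed:
  "chain_of R M i N ` chain_gens M i N \<subseteq> carrier (tensor_chain R M i N)"
  using chain_of_closed by blast

text \<open>Induction over the free abelian group meets differences. The negative of a generator is
  again a generator, with the sign moved into the last entry by \<open>chain_of_uminus\<close>, so a
  span without negatives reaches everything.\<close>

lemma tensor_chain_aspan:
  assumes "t \<in> carrier (tensor_chain R M i N)"
  shows "t \<in> aspan (tensor_chain R M i N) (chain_of R M i N ` chain_gens M i N)"
proof -
  let ?F = "free_Abelian_group (chain_gens M i N)" and ?T = "tensor_chain R M i N"
  let ?q = "\<lambda>c. generate ?F (chain_rels R M i N) #>\<^bsub>?F\<^esub> c"
  let ?A = "aspan ?T (chain_of R M i N ` chain_gens M i N)"
  interpret T: abelian_group ?T by (rule tensor_chain_abelian_group)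
  interpret q: group_hom ?F "add_monoid ?T" ?q
    by (intro group_hom.intro group_hom_axioms.intro chain_class_hom) (auto intro: T.a_group)
  have inv: "\<ominus>\<^bsub>?T\<^esub> x \<in> ?A" if "x \<in> ?A" for x
    using that
  proof (rule T.aspan_a_inv)
    fix g assume "g \<in> chain_of R M i N ` chain_gens M i N"
    then obtain ms x where *: "(ms, x) \<in> chain_gens M i N" "g = chain_of R M i N (ms, x)" by auto
    then have "(ms, \<ominus>\<^bsub>N\<^esub> x) \<in> chain_gens M i N" by (simp add: chain_gens_iff)
    then show "\<ominus>\<^bsub>?T\<^esub> g \<in> ?A"
      using * by (simp add: chain_of_uminus T.aspan_base chain_of_gens_closed)
  qed (rule chain_of_gens_closed)
  obtain c where c: "c \<in> carrier ?F" "t = ?q c"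
    using assms by (auto simp: tensor_chain_simps chain_group_def Let_def FactGroup_def RCOSETS_def)
  have "?q c \<in> ?A"
    using c(1)[unfolded carrier_free_Abelian_group_iff]
  proof (induction c rule: free_Abelian_group_induct[consumes 1, case_names zero diff gen])
    case zero then show ?case using q.hom_one by (simp add: aspan.zero)
  next
    case (diff x y)
    then have "?q (x - y) = ?q x \<oplus>\<^bsub>?T\<^esub> \<ominus>\<^bsub>?T\<^esub> ?q y"
      using q.hom_mult[of x "inv\<^bsub>?F\<^esub> y"] q.hom_inv[of y] by (simp add: a_inv_def)
    then show ?case using diff inv by (simp add: T.aspan_add chain_of_gens_closed)
  next
    case (gen a)
    then have "chain_of R M i N a \<in> ?A" by (intro T.aspan_base chain_of_gens_closed) auto
    then show ?case by (simp add: chain_of_def Let_def)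
  qed
  then show ?thesis using c by simp
qed

lemma tensor_chain_hom_eqI:
  assumes "abelian_group Y" "h \<in> add_hom (tensor_chain R M i N) Y" "g \<in> add_hom (tensor_chain R M i N) Y"
    and "\<And>ms x. (ms, x) \<in> chain_gens M i N \<Longrightarrow> h (chain_of R M i N (ms, x)) = g (chain_of R M i N (ms, x))"
    and "t \<in> carrier (tensor_chain R M i N)"
  shows "h t = g t"
  by (rule add_hom_eqI[OF tensor_chain_abelian_group assms(1-3) _ chain_of_gens_closed tensor_chain_aspan[OF assms(5)]])
     (use assms(4) in auto)

text \<open>Freeness gives a homomorphism h that extends \<phi>. It kills the relations, hence is
  constant on cosets, and expanding a representative over its support turns h into the product that
  \<open>chain_lift\<close> computes.\<close>

lemma chain_lift_class:
  assumes Y: "abelian_group Y" and \<phi>: "chain_multilinear R M i N Y \<phi>"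
  obtains h where "h \<in> hom (free_Abelian_group (chain_gens M i N)) (add_monoid Y)"
    "\<And>p. p \<in> chain_gens M i N \<Longrightarrow> h (frag_of p) = \<phi> p"
    "\<And>c. c \<in> carrier (free_Abelian_group (chain_gens M i N)) \<Longrightarrow>
      chain_lift (add_monoid Y) \<phi> (generate (free_Abelian_group (chain_gens M i N)) (chain_rels R M i N)
        #>\<^bsub>free_Abelian_group (chain_gens M i N)\<^esub> c) = h c"
proof -
  let ?F = "free_Abelian_group (chain_gens M i N)"
  let ?K = "generate ?F (chain_rels R M i N)"
  interpret Y: abelian_group Y by fact
  have \<phi>cl: "\<phi> p \<in> carrier Y" if "p \<in> chain_gens M i N" for p
    using \<phi> that by (auto simp: chain_multilinear_def)
  obtain h where h: "h \<in> hom ?F (add_monoid Y)" "\<And>p. p \<in> chain_gens M i N \<Longrightarrow> h (frag_of p) = \<phi> p"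
    using comm_group.free_Abelian_group_universal[OF Y.a_comm_group, of \<phi> "chain_gens M i N"] \<phi>cl
    by (auto simp: image_subset_iff)
  interpret h: group_hom ?F "add_monoid Y" h
    by (intro group_hom.intro group_hom_axioms.intro h) (auto intro: Y.a_group)
  have diff: "h (c - d) = h c \<ominus>\<^bsub>Y\<^esub> h d" if "c \<in> carrier ?F" "d \<in> carrier ?F" for c d
    using h.hom_mult[of c "inv\<^bsub>?F\<^esub> d"] h.hom_inv[of d] that by (simp add: a_inv_def a_minus_def)
  have sum0: "h (frag_of p - frag_of p' - frag_of p'') = \<zero>\<^bsub>Y\<^esub>"
    if "p \<in> chain_gens M i N" "p' \<in> chain_gens M i N" "p'' \<in> chain_gens M i N"
      "\<phi> p = \<phi> p' \<oplus>\<^bsub>Y\<^esub> \<phi> p''" for p p' p''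
  proof -
    have "h (frag_of p - frag_of p' - frag_of p'') = \<phi> p \<ominus>\<^bsub>Y\<^esub> \<phi> p' \<ominus>\<^bsub>Y\<^esub> \<phi> p''"
      using that by (subst diff, (auto intro!: free_Abelian_group_diff_closed simp del: carrier_free_Abelian_group_iff)[2])+ (simp add: h)
    also have "\<dots> = \<zero>\<^bsub>Y\<^esub>"
    proof -
      have "\<phi> p' \<oplus>\<^bsub>Y\<^esub> \<phi> p'' \<ominus>\<^bsub>Y\<^esub> \<phi> p' = \<phi> p''"
        using that \<phi>cl by (simp add: Y.a_comm[of "\<phi> p'"] Y.minus_eq Y.a_assoc Y.r_neg)
      then show ?thesis using that \<phi>cl by (simp add: Y.minus_eq Y.r_neg)
    qed
    finally show ?thesis .
  qed
  have eq0: "h (frag_of p - frag_of p') = \<zero>\<^bsub>Y\<^esub>"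
    if "p \<in> chain_gens M i N" "p' \<in> chain_gens M i N" "\<phi> p = \<phi> p'" for p p'
    using that \<phi>cl by (subst diff) (auto simp: h Y.minus_eq Y.r_neg)
  have "h c = \<zero>\<^bsub>Y\<^esub>" if "c \<in> chain_rels R M i N" for c
    using that
    by cases (use \<phi> in \<open>auto simp: chain_multilinear_def chain_gens_iff intro!: sum0 eq0\<close>)
  then have "chain_rels R M i N \<subseteq> kernel ?F (add_monoid Y) h"
    unfolding kernel_def using subsetD[OF chain_rels_closed]
    by (simp add: subset_iff del: carrier_free_Abelian_group_iff)
  then have K: "?K \<subseteq> kernel ?F (add_monoid Y) h"
    by (intro group.generate_subgroup_incl group_free_Abelian_group h.subgroup_kernel)
  have lift: "chain_lift (add_monoid Y) \<phi> (?K #>\<^bsub>?F\<^esub> c) = h c" if c: "c \<in> carrier ?F" for c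
  proof -
    \<comment> \<open>The representative that \<open>chain_lift\<close> selects; it differs from c
      by an element of the subgroup, on which h vanishes.\<close>
    define d where "d = (SOME d. d \<in> ?K #>\<^bsub>?F\<^esub> c)"
    have "d \<in> ?K #>\<^bsub>?F\<^esub> c"
      unfolding d_def using group.rcos_self[OF group_free_Abelian_group c normal_imp_subgroup[OF chain_rels_normal]]
      by (rule someI)
    then obtain k where k: "k \<in> ?K" "d = k + c" by (auto simp: r_coset_def)
    then have kF: "k \<in> carrier ?F" "h k = \<zero>\<^bsub>Y\<^esub>" using K by (auto simp: kernel_def)
    have dF: "d \<in> carrier ?F" and hd: "h d = h c"
      using h.hom_mult[OF kF(1) c] kF k hom_in_carrier[OF h(1) c]
        monoid.m_closed[OF group.is_monoid[OF group_free_Abelian_group] kF(1) c] by auto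
    \<comment> \<open>The coefficients stay those of d while the finite index set grows to the
      support of d; this is what makes the induction go through.\<close>
    have "h (\<Sum>p\<in>S. frag_cmul (Poly_Mapping.lookup d p) (frag_of p))
      = finprod (add_monoid Y) (\<lambda>p. \<phi> p [^]\<^bsub>add_monoid Y\<^esub> Poly_Mapping.lookup d p) S"
      if "finite S" "S \<subseteq> chain_gens M i N" for S
      using that
    proof (induction S)
      case empty then show ?case
        using h.hom_one by (simp add: comm_monoid.finprod_empty[OF comm_group.axioms(1)[OF Y.a_comm_group]])
    next
      case (insert p S)
      have pw: "h (frag_cmul n (frag_of p)) = \<phi> p [^]\<^bsub>add_monoid Y\<^esub> n" for n :: int
        using h insert.prems int_pow_free_Abelian_group[of "frag_of p" "chain_gens M i N" n]
          h.hom_int_pow[of "frag_of p" n]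
        by simp
      have pc: "\<phi> q [^]\<^bsub>add_monoid Y\<^esub> n \<in> carrier Y" if "q \<in> chain_gens M i N" for q and n :: int
        using group.int_pow_closed[OF Y.a_group, of "\<phi> q" n] \<phi>cl[OF that] by simp
      have 1: "frag_cmul (Poly_Mapping.lookup d p) (frag_of p) \<in> carrier ?F"
        using insert.prems by auto
      have 2: "(\<Sum>p\<in>S. frag_cmul (Poly_Mapping.lookup d p) (frag_of p)) \<in> carrier ?F"
        using insert.prems by (intro sum_closed_free_Abelian_group) auto
      have "finprod (add_monoid Y) (\<lambda>p. \<phi> p [^]\<^bsub>add_monoid Y\<^esub> Poly_Mapping.lookup d p) (insert p S)
        = \<phi> p [^]\<^bsub>add_monoid Y\<^esub> Poly_Mapping.lookup d p \<otimes>\<^bsub>add_monoid Y\<^esub>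
          finprod (add_monoid Y) (\<lambda>p. \<phi> p [^]\<^bsub>add_monoid Y\<^esub> Poly_Mapping.lookup d p) S"
        using insert pc
        by (intro comm_monoid.finprod_insert comm_group.axioms Y.a_comm_group) auto
      then show ?case
        using insert h.hom_mult[OF 1 2] by (simp add: pw)
    qed
    from this[of "Poly_Mapping.keys d"] dF
    have "h d = finprod (add_monoid Y) (\<lambda>p. \<phi> p [^]\<^bsub>add_monoid Y\<^esub> Poly_Mapping.lookup d p) (Poly_Mapping.keys d)"
      using frag_expansion[of d] by (simp add: frag_extend_def)
    then show ?thesis using hd by (simp add: chain_lift_def Let_def d_def)
  qed
  show thesis by (rule that[OF h lift])
qed

lemma chain_lift_of:
  assumes "abelian_group Y" "chain_multilinear R M i N Y \<phi>" "p \<in> chain_gens M i N"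
  shows "chain_lift (add_monoid Y) \<phi> (chain_of R M i N p) = \<phi> p"
proof -
  obtain h where h: "\<And>p. p \<in> chain_gens M i N \<Longrightarrow> h (frag_of p) = \<phi> p"
    "\<And>c. c \<in> carrier (free_Abelian_group (chain_gens M i N)) \<Longrightarrow>
      chain_lift (add_monoid Y) \<phi> (generate (free_Abelian_group (chain_gens M i N)) (chain_rels R M i N)
        #>\<^bsub>free_Abelian_group (chain_gens M i N)\<^esub> c) = h c"
    using chain_lift_class[OF assms(1,2)] by metis
  show ?thesis using h(1)[OF assms(3)] h(2)[of "frag_of p"] assms(3) by (simp add: chain_of_def Let_def)
qed

lemma chain_lift_add_hom:
  assumes "abelian_group Y" "chain_multilinear R M i N Y \<phi>"
  shows "chain_lift (add_monoid Y) \<phi> \<in> add_hom (tensor_chain R M i N) Y"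
proof -
  let ?F = "free_Abelian_group (chain_gens M i N)" and ?T = "tensor_chain R M i N"
  let ?q = "\<lambda>c. generate ?F (chain_rels R M i N) #>\<^bsub>?F\<^esub> c"
  obtain h where h: "h \<in> hom ?F (add_monoid Y)"
    "\<And>c. c \<in> carrier ?F \<Longrightarrow> chain_lift (add_monoid Y) \<phi> (?q c) = h c"
    using chain_lift_class[OF assms] by metis
  have ex: "\<exists>c\<in>carrier ?F. t = ?q c" if "t \<in> carrier ?T" for t
    using that by (auto simp: tensor_chain_simps chain_group_def Let_def FactGroup_def RCOSETS_def)
  show ?thesis
  proof (rule add_homI)
    fix t assume "t \<in> carrier ?T"
    then obtain c where c: "c \<in> carrier ?F" "t = ?q c" using ex by blast
    then show "chain_lift (add_monoid Y) \<phi> t \<in> carrier Y"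
      using hom_in_carrier[OF h(1) c(1)] h(2) by simp
    fix s assume "s \<in> carrier ?T"
    then obtain d where d: "d \<in> carrier ?F" "s = ?q d" using ex by blast
    have cd: "c \<otimes>\<^bsub>?F\<^esub> d \<in> carrier ?F"
      using monoid.m_closed[OF group.is_monoid[OF group_free_Abelian_group] c(1) d(1)] .
    have "t \<oplus>\<^bsub>?T\<^esub> s = ?q (c \<otimes>\<^bsub>?F\<^esub> d)"
      using hom_mult[OF chain_class_hom c(1) d(1)] c d by simp
    then show "chain_lift (add_monoid Y) \<phi> (t \<oplus>\<^bsub>?T\<^esub> s)
        = chain_lift (add_monoid Y) \<phi> t \<oplus>\<^bsub>Y\<^esub> chain_lift (add_monoid Y) \<phi> s"
      using h(2)[OF cd] hom_mult[OF h(1) c(1) d(1)] h(2)[OF c(1)] h(2)[OF d(1)] c d by simp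
  qed
qed

section \<open>Joining tensors, and the scalar action on a tensor chain\<close>

lemma gen_smult_closed:
  "\<lbrakk>r \<in> carrier R; q \<in> chain_gens M j N\<rbrakk> \<Longrightarrow> gen_smult M N r q \<in> chain_gens M j N"
  by (cases "(M, N, r, q)" rule: gen_smult.cases) (auto simp: chain_gens_iff)

lemma gen_join_eq:
  "gen_join M N (us, r) ([], x) = (us, r \<odot>\<^bsub>N\<^esub> x)"
  "gen_join M N (us, r) (v # vs, x) = (us @ (r \<odot>\<^bsub>M\<^esub> v) # vs, x)"
  by (simp_all add: gen_join_def)

lemma gen_join_closed:
  assumes "p \<in> chain_gens M i (reg_lmod R)" "q \<in> chain_gens M j N"
  shows "gen_join M N p q \<in> chain_gens M (i + j) N"
proof -
  obtain us r ms x where "p = (us, r)" "q = (ms, x)" by fastforce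
  then show ?thesis
    using assms by (cases ms) (auto simp: gen_join_eq chain_gens_iff reg_lmod_def)
qed

text \<open>The scalar at the end of p acts on the first entry of q. If that is the entry being
  altered, distributivity or the bimodule law \<open>smult_rsmult\<close> is called for; otherwise
  the scalar stays with an entry further left and the relation applies directly.\<close>

lemma gen_join_multilinear_right:
  assumes p: "p \<in> chain_gens M i (reg_lmod R)"
  shows "chain_multilinear R M j N (tensor_chain R M (i + j) N)
    (\<lambda>q. chain_of R M (i + j) N (gen_join M N p q))"
proof -
  obtain us r where p_eq: "p = (us, r)" by fastforce
  have us: "set us \<subseteq> carrier M" "length us = i" "r \<in> carrier R"
    using p by (auto simp: p_eq chain_gens_iff reg_lmod_def)
  note ml = chain_of_multilinear[of "i + j"]
  show ?thesis
    unfolding chain_multilinear_def p_eq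
  proof (intro conjI allI impI, goal_cases)
    case 1
    then show ?case using gen_join_closed[OF p] chain_of_closed by (auto simp: p_eq)
  next
    case (2 vs a ws x b)
    show ?case
    proof (cases vs)
      case Nil
      then show ?thesis
        using 2 us chain_multilinear_add_left[OF ml, of us "r \<odot>\<^bsub>M\<^esub> a" ws x "r \<odot>\<^bsub>M\<^esub> b"]
        by (auto simp: gen_join_eq chain_gens_iff smult_r_distr)
    next
      case (Cons v vs')
      then show ?thesis
        using 2 us chain_multilinear_add_left[OF ml, of "us @ (r \<odot>\<^bsub>M\<^esub> v) # vs'" a ws x b]
        by (auto simp: gen_join_eq chain_gens_iff)
    qed
  next
    case (3 vs x y)
    then show ?case
      using us chain_multilinear_add_right[OF ml, of us "r \<odot>\<^bsub>N\<^esub> x" "r \<odot>\<^bsub>N\<^esub> y"]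
        chain_multilinear_add_right[OF ml, of "us @ (r \<odot>\<^bsub>M\<^esub> hd vs) # tl vs" x y]
      by (cases vs) (auto simp: gen_join_eq chain_gens_iff N.smult_r_distr)
  next
    case (4 vs a b ws x s)
    show ?case
    proof (cases vs)
      case Nil
      then show ?thesis
        using 4 us chain_multilinear_balanced[OF ml, of us "r \<odot>\<^bsub>M\<^esub> a" b ws x s]
        by (auto simp: gen_join_eq chain_gens_iff smult_rsmult)
    next
      case (Cons v vs')
      then show ?thesis
        using 4 us chain_multilinear_balanced[OF ml, of "us @ (r \<odot>\<^bsub>M\<^esub> v) # vs'" a b ws x s]
        by (auto simp: gen_join_eq chain_gens_iff)
    qed
  next
    case (5 vs a x s)
    show ?case
    proof (cases vs)
      case Nil
      then show ?thesis
        using 5 us chain_multilinear_balanced_last[OF ml, of us "r \<odot>\<^bsub>M\<^esub> a" x s]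
        by (auto simp: gen_join_eq chain_gens_iff smult_rsmult)
    next
      case (Cons v vs')
      then show ?thesis
        using 5 us chain_multilinear_balanced_last[OF ml, of "us @ (r \<odot>\<^bsub>M\<^esub> v) # vs'" a x s]
        by (auto simp: gen_join_eq chain_gens_iff)
    qed
  qed
qed

text \<open>At the junction the last factor R of p is absorbed by q. Additivity in that factor
  becomes additivity in the first entry of q, and balancedness against it becomes balancedness
  between the last letter of p and the first entry of q.\<close>

lemma gen_join_multilinear_left:
  assumes q: "q \<in> chain_gens M j N"
  shows "chain_multilinear R M i (reg_lmod R) (tensor_chain R M (i + j) N)
    (\<lambda>p. chain_of R M (i + j) N (gen_join M N p q))"
proof -
  note ml = chain_of_multilinear[of "i + j"]
  show ?thesis
    unfolding chain_multilinear_def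
  proof (intro conjI allI impI, goal_cases)
    case 1
    then show ?case using gen_join_closed[OF _ q] chain_of_closed by auto
  next
    case (2 us a vs r b)
    then have "gen_smult M N r q \<in> chain_gens M j N"
      using q by (intro gen_smult_closed) (auto simp: chain_gens_iff reg_lmod_def)
    then show ?case
      using 2 chain_multilinear_add_left[OF ml, of us a "vs @ fst (gen_smult M N r q)" "snd (gen_smult M N r q)" b]
      by (auto simp: gen_join_def chain_gens_def split: prod.splits)
  next
    case (3 us r s)
    show ?case
    proof (cases q)
      case (Pair ms x)
      then show ?thesis
        using 3 q chain_multilinear_add_right[OF ml, of us "r \<odot>\<^bsub>N\<^esub> x" "s \<odot>\<^bsub>N\<^esub> x"]
          chain_multilinear_add_left[OF ml, of us "r \<odot>\<^bsub>M\<^esub> hd ms" "tl ms" x "s \<odot>\<^bsub>M\<^esub> hd ms"]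
        by (cases ms)
           (auto simp: gen_join_eq chain_gens_iff N.smult_l_distr smult_l_distr reg_lmod_def)
    qed
  next
    case (4 us a b vs r s)
    then have "gen_smult M N r q \<in> chain_gens M j N"
      using q by (intro gen_smult_closed) (auto simp: chain_gens_iff reg_lmod_def)
    then show ?case
      using 4 chain_multilinear_balanced[OF ml, of us a b "vs @ fst (gen_smult M N r q)" "snd (gen_smult M N r q)" s]
      by (auto simp: gen_join_def chain_gens_def split: prod.splits)
  next
    case (5 us a r s)
    show ?case
    proof (cases q)
      case (Pair ms x)
      then show ?thesis
        using 5 q chain_multilinear_balanced_last[OF ml, of us a "r \<odot>\<^bsub>N\<^esub> x" s]
          chain_multilinear_balanced[OF ml, of us a "r \<odot>\<^bsub>M\<^esub> hd ms" "tl ms" x s]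
        by (cases ms)
           (auto simp: gen_join_eq chain_gens_iff N.smult_assoc1 smult_assoc1 reg_lmod_def)
    qed
  qed
qed

text \<open>\<open>tensor_join\<close> nests two lifts, so the inner one, as a function of p with t
  fixed, must itself respect the relations. Each required identity equates two additive maps of t,
  and for a generator t it is \<open>gen_join_multilinear_left\<close>.\<close>

lemma tensor_join_inner:
  fixes i j :: nat and t
  defines "L \<equiv> \<lambda>p. chain_lift (add_monoid (tensor_chain R M (i + j) N))
    (\<lambda>q. chain_of R M (i + j) N (gen_join M N p q)) t"
  assumes t: "t \<in> carrier (tensor_chain R M j N)"
  shows "chain_multilinear R M i (reg_lmod R) (tensor_chain R M (i + j) N) L"
proof -
  let ?T = "tensor_chain R M j N" and ?T' = "tensor_chain R M (i + j) N"
  let ?L = "\<lambda>p. chain_lift (add_monoid ?T') (\<lambda>q. chain_of R M (i + j) N (gen_join M N p q))"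
  interpret T': abelian_group ?T' by (rule tensor_chain_abelian_group)
  interpret reg: bimodule_pair R M "reg_lmod R" by (rule bimodule_pair_reg)
  have hom: "?L p \<in> add_hom ?T ?T'" if "p \<in> chain_gens M i (reg_lmod R)" for p
    by (rule chain_lift_add_hom[OF tensor_chain_abelian_group gen_join_multilinear_right[OF that]])
  have of: "?L p (chain_of R M j N q) = chain_of R M (i + j) N (gen_join M N p q)"
    if "p \<in> chain_gens M i (reg_lmod R)" "q \<in> chain_gens M j N" for p q
    by (rule chain_lift_of[OF tensor_chain_abelian_group gen_join_multilinear_right[OF that(1)] that(2)])
  have sum: "?L p t = ?L p' t \<oplus>\<^bsub>?T'\<^esub> ?L p'' t"
    if p: "p \<in> chain_gens M i (reg_lmod R)" "p' \<in> chain_gens M i (reg_lmod R)" "p'' \<in> chain_gens M i (reg_lmod R)"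
    and eq: "\<And>q. q \<in> chain_gens M j N \<Longrightarrow> chain_of R M (i + j) N (gen_join M N p q)
      = chain_of R M (i + j) N (gen_join M N p' q) \<oplus>\<^bsub>?T'\<^esub> chain_of R M (i + j) N (gen_join M N p'' q)"
    for p p' p''
    by (rule tensor_chain_hom_eqI[OF tensor_chain_abelian_group hom[OF p(1)]
          add_hom_sum[OF T'.abelian_monoid_axioms hom[OF p(2)] hom[OF p(3)]] _ t])
       (simp add: of p eq)
  have eq: "?L p t = ?L p' t"
    if p: "p \<in> chain_gens M i (reg_lmod R)" "p' \<in> chain_gens M i (reg_lmod R)"
    and eq: "\<And>q. q \<in> chain_gens M j N \<Longrightarrow>
      chain_of R M (i + j) N (gen_join M N p q) = chain_of R M (i + j) N (gen_join M N p' q)"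
    for p p'
    by (rule tensor_chain_hom_eqI[OF tensor_chain_abelian_group hom[OF p(1)] hom[OF p(2)] _ t])
       (simp add: of p eq)
  note ml = gen_join_multilinear_left[of _ j i]
  show ?thesis
    unfolding chain_multilinear_def L_def
  proof (intro conjI allI impI, goal_cases)
    case 1 then show ?case by (auto intro!: add_hom_closed[OF hom t])
  next
    case (2 us a vs x b)
    then show ?case
      by (intro sum chain_multilinear_add_left[OF ml]) (auto simp: chain_gens_iff)
  next
    case (3 us x y)
    then show ?case
      by (intro sum chain_multilinear_add_right[OF ml]) (auto simp: chain_gens_iff)
  next
    case (4 us a b vs x r)
    then show ?case
      by (intro eq chain_multilinear_balanced[OF ml]) (auto simp: chain_gens_iff)
  next
    case (5 us a x r)
    then show ?case
      by (intro eq chain_multilinear_balanced_last[OF ml]) (auto simp: chain_gens_iff)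
  qed
qed

lemma tensor_join_add_hom_left:
  assumes "t \<in> carrier (tensor_chain R M j N)"
  shows "(\<lambda>s. tensor_join R M N i j s t) \<in> add_hom (tensor_pow R M i) (tensor_chain R M (i + j) N)"
proof -
  interpret reg: bimodule_pair R M "reg_lmod R" by (rule bimodule_pair_reg)
  show ?thesis
    using reg.chain_lift_add_hom[OF tensor_chain_abelian_group tensor_join_inner[OF assms]]
    by (simp add: tensor_join_def Let_def tensor_pow_def chain_lift_chain_group)
qed

lemma tensor_join_of_left:
  assumes "t \<in> carrier (tensor_chain R M j N)" "p \<in> chain_gens M i (reg_lmod R)"
  shows "tensor_join R M N i j (chain_of R M i (reg_lmod R) p) t
    = chain_lift (add_monoid (tensor_chain R M (i + j) N)) (\<lambda>q. chain_of R M (i + j) N (gen_join M N p q)) t"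
proof -
  interpret reg: bimodule_pair R M "reg_lmod R" by (rule bimodule_pair_reg)
  show ?thesis
    using reg.chain_lift_of[OF tensor_chain_abelian_group tensor_join_inner[OF assms(1)] assms(2)]
    by (simp add: tensor_join_def Let_def chain_lift_chain_group)
qed

lemma tensor_join_of:
  assumes "p \<in> chain_gens M i (reg_lmod R)" "q \<in> chain_gens M j N"
  shows "tensor_join R M N i j (chain_of R M i (reg_lmod R) p) (chain_of R M j N q)
    = chain_of R M (i + j) N (gen_join M N p q)"
  unfolding tensor_join_of_left[OF chain_of_closed[OF assms(2)] assms(1)]
  by (rule chain_lift_of[OF tensor_chain_abelian_group gen_join_multilinear_right[OF assms(1)] assms(2)])

text \<open>The inner lift gives additivity in t when s is a generator; both sides of the equation
  are additive in s, which extends it to every s.\<close>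

lemma tensor_join_add_hom_right:
  assumes s: "s \<in> carrier (tensor_pow R M i)"
  shows "tensor_join R M N i j s \<in> add_hom (tensor_chain R M j N) (tensor_chain R M (i + j) N)"
proof -
  let ?T = "tensor_chain R M j N" and ?T' = "tensor_chain R M (i + j) N"
  interpret reg: bimodule_pair R M "reg_lmod R" by (rule bimodule_pair_reg)
  interpret T: abelian_group ?T by (rule tensor_chain_abelian_group)
  interpret T': abelian_group ?T' by (rule tensor_chain_abelian_group)
  have "tensor_join R M N i j s (t \<oplus>\<^bsub>?T\<^esub> u) = tensor_join R M N i j s t \<oplus>\<^bsub>?T'\<^esub> tensor_join R M N i j s u"
    if tu: "t \<in> carrier ?T" "u \<in> carrier ?T" for t u
  proof (rule reg.tensor_chain_hom_eqI[OF tensor_chain_abelian_group _ _ _ s[unfolded tensor_pow_def]])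
    note h = tensor_join_add_hom_left[unfolded tensor_pow_def]
    show "(\<lambda>s. tensor_join R M N i j s (t \<oplus>\<^bsub>?T\<^esub> u)) \<in> add_hom (tensor_chain R M i (reg_lmod R)) ?T'"
      using tu by (intro h) simp
    show "(\<lambda>s. tensor_join R M N i j s t \<oplus>\<^bsub>?T'\<^esub> tensor_join R M N i j s u)
        \<in> add_hom (tensor_chain R M i (reg_lmod R)) ?T'"
      using tu by (intro add_hom_sum h T'.abelian_monoid_axioms) simp_all
    fix us r assume p: "(us, r) \<in> chain_gens M i (reg_lmod R)"
    show "tensor_join R M N i j (chain_of R M i (reg_lmod R) (us, r)) (t \<oplus>\<^bsub>?T\<^esub> u)
      = tensor_join R M N i j (chain_of R M i (reg_lmod R) (us, r)) t \<oplus>\<^bsub>?T'\<^esub>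
        tensor_join R M N i j (chain_of R M i (reg_lmod R) (us, r)) u"
      using add_hom_add[OF chain_lift_add_hom[OF tensor_chain_abelian_group gen_join_multilinear_right[OF p]] tu]
      by (simp add: tensor_join_of_left p tu)
  qed
  then show ?thesis
    using add_hom_closed[OF tensor_join_add_hom_left s] by (intro add_homI)
qed

lemma tensor_chain_smult:
  "smult (tensor_chain R M j N) r = chain_lift (add_monoid (tensor_chain R M j N))
    (\<lambda>q. chain_of R M j N (gen_smult M N r q))"
  unfolding chain_lift_chain_group[symmetric] by (simp add: tensor_chain_def Let_def)

text \<open>Acting by r is joining with the generator \<open>([], r)\<close> of degree 0.\<close>

lemma gen_smult_multilinear:
  "r \<in> carrier R \<Longrightarrow> chain_multilinear R M j N (tensor_chain R M j N)
    (\<lambda>q. chain_of R M j N (gen_smult M N r q))"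
  using gen_join_multilinear_right[of "([], r)" 0 j]
  by (simp add: gen_join_def chain_gens_iff reg_lmod_def)

lemma tensor_smult_of:
  "\<lbrakk>r \<in> carrier R; q \<in> chain_gens M j N\<rbrakk> \<Longrightarrow>
    r \<odot>\<^bsub>tensor_chain R M j N\<^esub> chain_of R M j N q = chain_of R M j N (gen_smult M N r q)"
  unfolding tensor_chain_smult
  by (rule chain_lift_of[OF tensor_chain_abelian_group gen_smult_multilinear])

lemma tensor_smult_add_hom:
  "r \<in> carrier R \<Longrightarrow> smult (tensor_chain R M j N) r \<in> add_hom (tensor_chain R M j N) (tensor_chain R M j N)"
  unfolding tensor_chain_smult
  by (rule chain_lift_add_hom[OF tensor_chain_abelian_group gen_smult_multilinear])

lemma tensor_chain_left_module: "left_module R (tensor_chain R M j N)"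
proof -
  let ?T = "tensor_chain R M j N"
  interpret T: abelian_group ?T by (rule tensor_chain_abelian_group)
  note hom = tensor_smult_add_hom[of _ j]
  show ?thesis
  proof (intro left_module.intro left_module_axioms.intro R.ring_axioms tensor_chain_abelian_group, goal_cases)
    case (1 a x) then show ?case by (intro add_hom_closed[OF hom])
  next
    case (2 a b t)
    show ?case
    proof (rule tensor_chain_hom_eqI[OF tensor_chain_abelian_group _ _ _ 2(3)])
      show "(\<lambda>t. a \<odot>\<^bsub>?T\<^esub> t \<oplus>\<^bsub>?T\<^esub> b \<odot>\<^bsub>?T\<^esub> t) \<in> add_hom ?T ?T"
        using 2 by (intro add_hom_sum hom T.abelian_monoid_axioms)
      fix ms x assume q: "(ms, x) \<in> chain_gens M j N"
      have "chain_of R M j N (gen_smult M N (a \<oplus>\<^bsub>R\<^esub> b) (ms, x))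
        = chain_of R M j N (gen_smult M N a (ms, x)) \<oplus>\<^bsub>?T\<^esub> chain_of R M j N (gen_smult M N b (ms, x))"
        \<comment> \<open>Additivity in the scalar is additivity of the degree-0 join in the last
          factor of its left argument.\<close>
        using 2 chain_multilinear_add_right[OF gen_join_multilinear_left[OF q, of 0], of "[]" a b]
        by (simp add: gen_join_def chain_gens_iff reg_lmod_def)
      then show "(a \<oplus>\<^bsub>R\<^esub> b) \<odot>\<^bsub>?T\<^esub> chain_of R M j N (ms, x)
        = a \<odot>\<^bsub>?T\<^esub> chain_of R M j N (ms, x) \<oplus>\<^bsub>?T\<^esub> b \<odot>\<^bsub>?T\<^esub> chain_of R M j N (ms, x)"
        using 2 q by (simp add: tensor_smult_of)
    qed (use 2 hom in simp)
  next
    case (3 a x y) then show ?case by (intro add_hom_add[OF hom])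
  next
    case (4 a b t)
    show ?case
    proof (rule tensor_chain_hom_eqI[OF tensor_chain_abelian_group _ _ _ 4(3)])
      show "(\<lambda>t. a \<odot>\<^bsub>?T\<^esub> (b \<odot>\<^bsub>?T\<^esub> t)) \<in> add_hom ?T ?T"
        using 4 by (intro add_hom_comp[OF hom hom])
      fix ms x assume q: "(ms, x) \<in> chain_gens M j N"
      have "gen_smult M N (a \<otimes>\<^bsub>R\<^esub> b) (ms, x) = gen_smult M N a (gen_smult M N b (ms, x))"
        using q 4 by (cases ms) (auto simp: chain_gens_iff smult_assoc1 N.smult_assoc1)
      then show "(a \<otimes>\<^bsub>R\<^esub> b) \<odot>\<^bsub>?T\<^esub> chain_of R M j N (ms, x)
        = a \<odot>\<^bsub>?T\<^esub> (b \<odot>\<^bsub>?T\<^esub> chain_of R M j N (ms, x))"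
        using 4 q by (simp add: tensor_smult_of gen_smult_closed)
    qed (use 4 hom in simp)
  next
    case (5 t)
    show ?case
    proof (rule tensor_chain_hom_eqI[OF tensor_chain_abelian_group _ _ _ 5])
      show "(\<lambda>t. t) \<in> add_hom ?T ?T" by (simp add: add_hom_def)
      fix ms x assume q: "(ms, x) \<in> chain_gens M j N"
      have "gen_smult M N \<one>\<^bsub>R\<^esub> (ms, x) = (ms, x)"
        using q by (cases ms) (auto simp: chain_gens_iff)
      then show "\<one>\<^bsub>R\<^esub> \<odot>\<^bsub>?T\<^esub> chain_of R M j N (ms, x) = chain_of R M j N (ms, x)"
        using q by (simp add: tensor_smult_of)
    qed (use hom in simp)
  qed
qed

end

section \<open>The trivial extension is a ring\<close>

lemma add_hom_PiE:
  assumes G: "carrier G = (\<Pi>\<^sub>E i\<in>I. carrier (T i))" "\<And>v w. v \<oplus>\<^bsub>G\<^esub> w = (\<lambda>i\<in>I. v i \<oplus>\<^bsub>T i\<^esub> w i)"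
    and h: "\<And>i. i \<in> I \<Longrightarrow> h i \<in> add_hom A (T i)"
  shows "(\<lambda>a. \<lambda>i\<in>I. h i a) \<in> add_hom A G"
  using h by (intro add_homI) (auto simp: G add_hom_def intro!: restrict_ext)

lemma reg_lmod_simps:
  "carrier (reg_lmod R) = carrier R" "smult (reg_lmod R) = mult R"
  "\<zero>\<^bsub>reg_lmod R\<^esub> = \<zero>\<^bsub>R\<^esub>" "add (reg_lmod R) = add R"
  by (simp_all add: reg_lmod_def)

text \<open>By convention \<open>homog R M n p\<close> is zero when its degree exceeds \<open>n\<close>, so that products of
  homogeneous elements need no case distinction.\<close>

definition homog ::
  "('r, 'a) ring_scheme \<Rightarrow> ('r, 'm, 'b) bimod_scheme \<Rightarrow> nat \<Rightarrow> 'm list \<times> 'r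
    \<Rightarrow> nat \<Rightarrow> ('m list \<times> 'r \<Rightarrow>\<^sub>0 int) set"
  where "homog R M n p = (\<lambda>k\<in>{..n}. if k = length (fst p) then chain_of R M k (reg_lmod R) p
    else \<zero>\<^bsub>tensor_pow R M k\<^esub>)"

text \<open>In contrast with \<open>chain_gens\<close> no length is fixed, because multiplying
  homogeneous elements changes the degree.\<close>

definition hgens :: "('r, 'a) ring_scheme \<Rightarrow> ('r, 'm, 'b) bimod_scheme \<Rightarrow> ('m list \<times> 'r) set"
  where "hgens R M = {(us, r). set us \<subseteq> carrier M \<and> r \<in> carrier R}"

locale triv_extension = bimodule R M
  for R :: "('r, 'a) ring_scheme" (structure) and M :: "('r, 'm, 'b) bimod_scheme" (structure) +
  fixes n :: nat
begin

abbreviation "S \<equiv> triv_ext R M n"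
abbreviation "T \<equiv> tensor_pow R M"

sublocale reg: bimodule_pair R M "reg_lmod R" by (rule bimodule_pair_reg)

lemma T_abelian_group: "abelian_group (T k)"
  unfolding tensor_pow_def by (rule reg.tensor_chain_abelian_group)

lemma S_simps:
  "carrier S = (\<Pi>\<^sub>E k\<in>{..n}. carrier (T k))"
  "\<zero>\<^bsub>S\<^esub> = (\<lambda>k\<in>{..n}. \<zero>\<^bsub>T k\<^esub>)"
  "a \<oplus>\<^bsub>S\<^esub> b = (\<lambda>k\<in>{..n}. a k \<oplus>\<^bsub>T k\<^esub> b k)"
  by (simp_all add: triv_ext_def)

lemma S_abelian_group: "abelian_group S"
  by (rule abelian_group_PiE[OF T_abelian_group S_simps])

interpretation S: abelian_group S by (rule S_abelian_group)

lemma T_zero: "\<zero>\<^bsub>T k\<^esub> \<in> carrier (T k)"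
  by (rule abelian_monoid.zero_closed[OF abelian_group.axioms(1)[OF T_abelian_group]])

lemma chain_of_T: "(us, r) \<in> hgens R M \<Longrightarrow> chain_of R M (length us) (reg_lmod R) (us, r) \<in> carrier (T (length us))"
  unfolding tensor_pow_def
  by (rule reg.chain_of_closed) (simp add: chain_gens_iff hgens_def reg_lmod_def)

lemma homog_closed: "p \<in> hgens R M \<Longrightarrow> homog R M n p \<in> carrier S"
  using chain_of_T[of "fst p" "snd p"] T_zero by (auto simp: homog_def S_simps)

lemma homog_gens_closed: "homog R M n ` hgens R M \<subseteq> carrier S"
  using homog_closed by blast

text \<open>The inclusion of degree l into S. For l > n it is the zero map, in agreement with the
  convention for \<open>homog\<close>, so additivity holds for every l.\<close>

definition place :: "nat \<Rightarrow> ('m list \<times> 'r \<Rightarrow>\<^sub>0 int) set \<Rightarrow> nat \<Rightarrow> ('m list \<times> 'r \<Rightarrow>\<^sub>0 int) set"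
  where "place l t = (\<lambda>k\<in>{..n}. if k = l then t else \<zero>\<^bsub>T k\<^esub>)"

lemma place_add_hom: "place l \<in> add_hom (T l) S"
  unfolding place_def
proof (rule add_hom_PiE[OF S_simps(1,3)])
  fix k
  show "(\<lambda>t. if k = l then t else \<zero>\<^bsub>T k\<^esub>) \<in> add_hom (T l) (T k)"
  proof (cases "k = l")
    case True then show ?thesis by (simp add: add_hom_def)
  next
    case False
    then show ?thesis by (simp add: zero_add_hom abelian_group.axioms(1)[OF T_abelian_group])
  qed
qed

lemma place_aspan:
  assumes "t \<in> carrier (T l)"
  shows "place l t \<in> aspan S (homog R M n ` hgens R M)"
proof (rule aspan_image[OF T_abelian_group S_abelian_group place_add_hom _ _ homog_gens_closed])
  show "t \<in> aspan (T l) (chain_of R M l (reg_lmod R) ` chain_gens M l (reg_lmod R))"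
    using assms unfolding tensor_pow_def by (rule reg.tensor_chain_aspan)
  show "chain_of R M l (reg_lmod R) ` chain_gens M l (reg_lmod R) \<subseteq> carrier (T l)"
    unfolding tensor_pow_def by (rule reg.chain_of_gens_closed)
  fix g assume "g \<in> chain_of R M l (reg_lmod R) ` chain_gens M l (reg_lmod R)"
  then obtain us r where p: "g = chain_of R M l (reg_lmod R) (us, r)" "(us, r) \<in> chain_gens M l (reg_lmod R)"
    by auto
  then have h: "(us, r) \<in> hgens R M" and "place l g = homog R M n (us, r)"
    by (auto simp: hgens_def chain_gens_iff reg_lmod_def place_def homog_def intro!: restrict_ext)
  then show "place l g \<in> aspan S (homog R M n ` hgens R M)"
    using S.aspan_base[OF _ homog_gens_closed] by auto
qed

lemma S_aspan:
  assumes a: "a \<in> carrier S"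
  shows "a \<in> aspan S (homog R M n ` hgens R M)"
proof -
  \<comment> \<open>Truncation of a to the degrees below m. Degrees run from 0 to n inclusive, so a
    itself is reached at \<open>Suc n\<close>.\<close>
  define w where "w m = (\<lambda>k\<in>{..n}. if k < m then a k else \<zero>\<^bsub>T k\<^esub>)" for m
  have wc: "w m \<in> carrier S" for m
    using a T_zero by (auto simp: w_def S_simps PiE_iff)
  have "m \<le> Suc n \<Longrightarrow> w m \<in> aspan S (homog R M n ` hgens R M)" for m
  proof (induction m)
    case 0
    have "w 0 = \<zero>\<^bsub>S\<^esub>" by (auto simp: w_def S_simps)
    then show ?case by (simp add: aspan.zero)
  next
    case (Suc m)
    have ac: "a m \<in> carrier (T m)" using Suc.prems a by (auto simp: S_simps PiE_iff)
    have "w (Suc m) k = (place m (a m) \<oplus>\<^bsub>S\<^esub> w m) k" for k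
    proof (cases "k \<le> n")
      case True
      interpret Tk: abelian_group "T k" by (rule T_abelian_group)
      have "a k \<in> carrier (T k)" using True a by (auto simp: S_simps PiE_iff)
      from Tk.r_zero[OF this] Tk.l_zero[OF this] show ?thesis
        using True by (cases "k = m") (simp_all add: w_def place_def S_simps less_Suc_eq)
    qed (simp add: w_def S_simps)
    then have "w (Suc m) = place m (a m) \<oplus>\<^bsub>S\<^esub> w m" by (rule ext)
    then show ?case
      using Suc place_aspan[OF ac] by (simp add: S.aspan_add homog_gens_closed)
  qed
  moreover have "w (Suc n) = a"
    using a by (auto simp: w_def S_simps PiE_iff extensional_def fun_eq_iff)
  ultimately show ?thesis by (metis order_refl)
qed

lemma S_hom_eqI:
  assumes "abelian_group Y" "h \<in> add_hom S Y" "g \<in> add_hom S Y"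
    and "\<And>us r. (us, r) \<in> hgens R M \<Longrightarrow> h (homog R M n (us, r)) = g (homog R M n (us, r))"
    and "a \<in> carrier S"
  shows "h a = g a"
  by (rule add_hom_eqI[OF S_abelian_group assms(1-3) _ homog_gens_closed S_aspan[OF assms(5)]])
     (use assms(4) in auto)

lemma S_proj_add_hom: "k \<le> n \<Longrightarrow> (\<lambda>a. a k) \<in> add_hom S (T k)"
  by (rule add_homI) (auto simp: S_simps PiE_iff)

abbreviation join where "join i k s t \<equiv> tensor_join R M (reg_lmod R) i (k - i) s t"

lemma join_left: "\<lbrakk>i \<le> k; t \<in> carrier (T (k - i))\<rbrakk> \<Longrightarrow> (\<lambda>s. join i k s t) \<in> add_hom (T i) (T k)"
  using reg.tensor_join_add_hom_left[of t "k - i" i] by (simp add: tensor_pow_def)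

lemma join_right: "\<lbrakk>i \<le> k; s \<in> carrier (T i)\<rbrakk> \<Longrightarrow> join i k s \<in> add_hom (T (k - i)) (T k)"
  using reg.tensor_join_add_hom_right[of s i "k - i"] by (simp add: tensor_pow_def)

lemma S_mult:
  "a \<otimes>\<^bsub>S\<^esub> b = (\<lambda>k\<in>{..n}. \<Oplus>\<^bsub>T k\<^esub>i\<in>{..k}. join i k (a i) (b (k - i)))"
  by (simp add: triv_ext_def)

lemma S_mult_left:
  assumes "b \<in> carrier S" shows "(\<lambda>a. a \<otimes>\<^bsub>S\<^esub> b) \<in> add_hom S S"
  unfolding S_mult
proof (rule add_hom_PiE[OF S_simps(1,3)], rule add_hom_finsum)
  fix k i assume "k \<in> {..n}" "i \<in> {..k}"
  moreover from this have "b (k - i) \<in> carrier (T (k - i))"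
    using assms by (auto simp: S_simps PiE_iff)
  ultimately show "(\<lambda>a. join i k (a i) (b (k - i))) \<in> add_hom S (T k)"
    by (intro add_hom_comp[OF S_proj_add_hom join_left]) auto
qed (rule abelian_group.axioms(1)[OF T_abelian_group])

lemma S_mult_right:
  assumes "a \<in> carrier S" shows "(\<lambda>b. a \<otimes>\<^bsub>S\<^esub> b) \<in> add_hom S S"
  unfolding S_mult
proof (rule add_hom_PiE[OF S_simps(1,3)], rule add_hom_finsum)
  fix k i assume "k \<in> {..n}" "i \<in> {..k}"
  moreover from this have "a i \<in> carrier (T i)"
    using assms by (auto simp: S_simps PiE_iff)
  ultimately show "(\<lambda>b. join i k (a i) (b (k - i))) \<in> add_hom S (T k)"
    by (intro add_hom_comp[OF S_proj_add_hom join_right]) auto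
qed (rule abelian_group.axioms(1)[OF T_abelian_group])

abbreviation gjoin where "gjoin \<equiv> gen_join M (reg_lmod R)"

lemma gjoin_hgens: "\<lbrakk>p \<in> hgens R M; q \<in> hgens R M\<rbrakk> \<Longrightarrow> gjoin p q \<in> hgens R M"
  using reg.gen_join_closed[of p "length (fst p)" q "length (fst q)"]
  by (auto simp: hgens_def chain_gens_def reg_lmod_simps)

lemma length_gjoin: "length (fst (gjoin p q)) = length (fst p) + length (fst q)"
proof -
  obtain us r vs s where "p = (us, r)" "q = (vs, s)" by fastforce
  then show ?thesis by (cases vs) (auto simp: gen_join_def)
qed

text \<open>In the convolution only the degrees of p and q can contribute, and there
  \<open>tensor_join_of\<close> evaluates the product. If these degrees add up to more than n, every
  component on the left vanishes and the right-hand side is zero by the convention for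
  \<open>homog\<close>.\<close>

lemma homog_mult:
  assumes p: "p \<in> hgens R M" and q: "q \<in> hgens R M"
  shows "homog R M n p \<otimes>\<^bsub>S\<^esub> homog R M n q = homog R M n (gjoin p q)"
proof -
  let ?i = "length (fst p)" and ?j = "length (fst q)"
  have pg: "p \<in> chain_gens M ?i (reg_lmod R)" and qg: "q \<in> chain_gens M ?j (reg_lmod R)"
    using p q by (auto simp: hgens_def chain_gens_def reg_lmod_simps)
  have pT: "chain_of R M ?i (reg_lmod R) p \<in> carrier (T ?i)" and qT: "chain_of R M ?j (reg_lmod R) q \<in> carrier (T ?j)"
    using chain_of_T[of "fst p" "snd p"] chain_of_T[of "fst q" "snd q"] p q by auto
  have "(\<Oplus>\<^bsub>T k\<^esub>i\<in>{..k}. join i k (homog R M n p i) (homog R M n q (k - i)))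
    = (if k = ?i + ?j then chain_of R M k (reg_lmod R) (gjoin p q) else \<zero>\<^bsub>T k\<^esub>)" if k: "k \<le> n" for k
  proof -
    interpret Tk: abelian_group "T k" by (rule T_abelian_group)
    \<comment> \<open>The expected component in degree k. Only the summand at the degree of p can be
      nonzero, so the convolution collapses to it.\<close>
    define c where "c = (if k = ?i + ?j then chain_of R M k (reg_lmod R) (gjoin p q) else \<zero>\<^bsub>T k\<^esub>)"
    have cT: "c \<in> carrier (T k)"
      using gjoin_hgens[OF p q] chain_of_T[of "fst (gjoin p q)" "snd (gjoin p q)"]
      by (auto simp: c_def length_gjoin)
    have summand: "join i k (homog R M n p i) (homog R M n q (k - i)) = (if ?i = i then c else \<zero>\<^bsub>T k\<^esub>)"
      if i: "i \<le> k" for i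
    proof -
      have hp: "homog R M n p i = (if i = ?i then chain_of R M ?i (reg_lmod R) p else \<zero>\<^bsub>T i\<^esub>)"
        and hq: "homog R M n q (k - i) = (if k - i = ?j then chain_of R M ?j (reg_lmod R) q else \<zero>\<^bsub>T (k - i)\<^esub>)"
        using i k by (auto simp: homog_def)
      have hqT: "homog R M n q (k - i) \<in> carrier (T (k - i))"
        using qT T_zero by (simp add: hq)
      show ?thesis
      proof (cases "i = ?i")
        case False
        then show ?thesis
          using add_hom_zero[OF T_abelian_group T_abelian_group join_left[OF i hqT]] by (simp add: hp)
      next
        case True
        show ?thesis
        proof (cases "k - i = ?j")
          case True
          then have k_eq: "k = ?i + ?j" using \<open>i = ?i\<close> i by simp
          have "join i k (homog R M n p i) (homog R M n q (k - i))
            = tensor_join R M (reg_lmod R) ?i ?j (chain_of R M ?i (reg_lmod R) p) (chain_of R M ?j (reg_lmod R) q)"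
            unfolding hp hq using True \<open>i = ?i\<close> by simp
          also have "\<dots> = c"
            unfolding c_def k_eq by (simp add: reg.tensor_join_of[OF pg qg])
          finally show ?thesis using \<open>i = ?i\<close> by simp
        next
          case False
          have "chain_of R M ?i (reg_lmod R) p \<in> carrier (T i)" using pT \<open>i = ?i\<close> by simp
          from add_hom_zero[OF T_abelian_group T_abelian_group join_right[OF i this]]
          have "join i k (homog R M n p i) (homog R M n q (k - i)) = \<zero>\<^bsub>T k\<^esub>"
            unfolding hp hq using False \<open>i = ?i\<close> by simp
          moreover have "c = \<zero>\<^bsub>T k\<^esub>"
            unfolding c_def using False \<open>i = ?i\<close> by auto
          ultimately show ?thesis by simp
        qed
      qed
    qed
    have "(\<Oplus>\<^bsub>T k\<^esub>i\<in>{..k}. join i k (homog R M n p i) (homog R M n q (k - i)))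
      = (\<Oplus>\<^bsub>T k\<^esub>i\<in>{..k}. if ?i = i then c else \<zero>\<^bsub>T k\<^esub>)"
      using cT by (intro Tk.finsum_cong') (auto simp: summand)
    also have "\<dots> = c"
    proof (cases "?i \<le> k")
      case True then show ?thesis using cT by (intro Tk.finsum_singleton) auto
    next
      case False
      \<comment> \<open>The degree of p exceeds k: no summand survives, and c is zero as
        well.\<close>
      then have "(\<Oplus>\<^bsub>T k\<^esub>i\<in>{..k}. if ?i = i then c else \<zero>\<^bsub>T k\<^esub>) = (\<Oplus>\<^bsub>T k\<^esub>i\<in>{..k}. \<zero>\<^bsub>T k\<^esub>)"
        by (intro Tk.finsum_cong') auto
      then show ?thesis using False by (auto simp: c_def Tk.finsum_zero)
    qed
    finally show ?thesis by (simp add: c_def)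
  qed
  then show ?thesis
    by (auto simp: S_mult homog_def[of R M n "gjoin p q"] length_gjoin intro!: restrict_ext)
qed

lemma gjoin_assoc:
  assumes "p \<in> hgens R M" "q \<in> hgens R M" "w \<in> hgens R M"
  shows "gjoin (gjoin p q) w = gjoin p (gjoin q w)"
proof -
  obtain us r vs s ws t where "p = (us, r)" "q = (vs, s)" "w = (ws, t)" by (metis surj_pair)
  then show ?thesis
    using assms by (cases vs; cases ws)
      (auto simp: reg.gen_join_eq hgens_def reg_lmod_simps R.m_assoc smult_assoc1)
qed

lemma S_one: "\<one>\<^bsub>S\<^esub> = homog R M n ([], \<one>\<^bsub>R\<^esub>)"
  by (auto simp: triv_ext_def homog_def intro!: restrict_ext)

lemma S_mult_closed: "\<lbrakk>a \<in> carrier S; b \<in> carrier S\<rbrakk> \<Longrightarrow> a \<otimes>\<^bsub>S\<^esub> b \<in> carrier S"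
  by (rule add_hom_closed[OF S_mult_left])

text \<open>Associativity holds on generators by \<open>gjoin_assoc\<close>. The facts 1, 2 and 3
  free the arguments c, b and a in turn from being generators, each time by additivity in the
  argument concerned.\<close>

lemma S_ring: "ring S"
proof (rule ringI)
  note cl = S_mult_closed homog_closed gjoin_hgens
  have 1: "homog R M n p \<otimes>\<^bsub>S\<^esub> homog R M n q \<otimes>\<^bsub>S\<^esub> c = homog R M n p \<otimes>\<^bsub>S\<^esub> (homog R M n q \<otimes>\<^bsub>S\<^esub> c)"
    if "p \<in> hgens R M" "q \<in> hgens R M" "c \<in> carrier S" for p q c
  proof (rule S_hom_eqI[OF S_abelian_group _ _ _ that(3)])
    show "(\<lambda>c. homog R M n p \<otimes>\<^bsub>S\<^esub> homog R M n q \<otimes>\<^bsub>S\<^esub> c) \<in> add_hom S S"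
      using that by (intro S_mult_right cl)
    show "(\<lambda>c. homog R M n p \<otimes>\<^bsub>S\<^esub> (homog R M n q \<otimes>\<^bsub>S\<^esub> c)) \<in> add_hom S S"
      using that by (intro add_hom_comp[OF S_mult_right S_mult_right] cl)
  qed (use that in \<open>simp add: homog_mult gjoin_hgens gjoin_assoc\<close>)
  have 2: "homog R M n p \<otimes>\<^bsub>S\<^esub> b \<otimes>\<^bsub>S\<^esub> c = homog R M n p \<otimes>\<^bsub>S\<^esub> (b \<otimes>\<^bsub>S\<^esub> c)"
    if "p \<in> hgens R M" "b \<in> carrier S" "c \<in> carrier S" for p b c
  proof (rule S_hom_eqI[OF S_abelian_group _ _ _ that(2)])
    show "(\<lambda>b. homog R M n p \<otimes>\<^bsub>S\<^esub> b \<otimes>\<^bsub>S\<^esub> c) \<in> add_hom S S"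
      using that by (intro add_hom_comp[OF S_mult_right S_mult_left] cl)
    show "(\<lambda>b. homog R M n p \<otimes>\<^bsub>S\<^esub> (b \<otimes>\<^bsub>S\<^esub> c)) \<in> add_hom S S"
      using that by (intro add_hom_comp[OF S_mult_left S_mult_right] cl)
  qed (use that 1 in simp)
  have 3: "a \<otimes>\<^bsub>S\<^esub> b \<otimes>\<^bsub>S\<^esub> c = a \<otimes>\<^bsub>S\<^esub> (b \<otimes>\<^bsub>S\<^esub> c)"
    if "a \<in> carrier S" "b \<in> carrier S" "c \<in> carrier S" for a b c
  proof (rule S_hom_eqI[OF S_abelian_group _ _ _ that(1)])
    show "(\<lambda>a. a \<otimes>\<^bsub>S\<^esub> b \<otimes>\<^bsub>S\<^esub> c) \<in> add_hom S S"
      using that by (intro add_hom_comp[OF S_mult_left S_mult_left] cl)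
    show "(\<lambda>a. a \<otimes>\<^bsub>S\<^esub> (b \<otimes>\<^bsub>S\<^esub> c)) \<in> add_hom S S"
      using that by (intro S_mult_left cl)
  qed (use that 2 in simp)
  have e: "([], \<one>\<^bsub>R\<^esub>) \<in> hgens R M" by (simp add: hgens_def)
  have id: "(\<lambda>a. a) \<in> add_hom S S" by (simp add: add_hom_def)
  show "Group.monoid S"
  proof (rule monoidI)
    show "\<one>\<^bsub>S\<^esub> \<in> carrier S" using e by (simp add: S_one homog_closed)
    fix a assume a: "a \<in> carrier S"
    show "\<one>\<^bsub>S\<^esub> \<otimes>\<^bsub>S\<^esub> a = a"
    proof (rule S_hom_eqI[OF S_abelian_group _ id _ a])
      fix us r assume p: "(us, r) \<in> hgens R M"
      then have "gjoin ([], \<one>\<^bsub>R\<^esub>) (us, r) = (us, r)"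
        by (cases us) (auto simp: reg.gen_join_eq hgens_def reg_lmod_simps)
      then show "\<one>\<^bsub>S\<^esub> \<otimes>\<^bsub>S\<^esub> homog R M n (us, r) = homog R M n (us, r)"
        using p e by (simp add: S_one homog_mult)
    qed (use e in \<open>simp add: S_one S_mult_right homog_closed\<close>)
    show "a \<otimes>\<^bsub>S\<^esub> \<one>\<^bsub>S\<^esub> = a"
    proof (rule S_hom_eqI[OF S_abelian_group _ id _ a])
      fix us r assume p: "(us, r) \<in> hgens R M"
      then have "gjoin (us, r) ([], \<one>\<^bsub>R\<^esub>) = (us, r)"
        by (auto simp: reg.gen_join_eq hgens_def reg_lmod_simps)
      then show "homog R M n (us, r) \<otimes>\<^bsub>S\<^esub> \<one>\<^bsub>S\<^esub> = homog R M n (us, r)"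
        using p e by (simp add: S_one homog_mult)
    qed (use e in \<open>simp add: S_one S_mult_left homog_closed\<close>)
  qed (simp_all add: S_mult_closed 3)
next
  fix a b c assume abc: "a \<in> carrier S" "b \<in> carrier S" "c \<in> carrier S"
  show "(a \<oplus>\<^bsub>S\<^esub> b) \<otimes>\<^bsub>S\<^esub> c = a \<otimes>\<^bsub>S\<^esub> c \<oplus>\<^bsub>S\<^esub> b \<otimes>\<^bsub>S\<^esub> c"
    using add_hom_add[OF S_mult_left[OF abc(3)] abc(1,2)] .
  show "c \<otimes>\<^bsub>S\<^esub> (a \<oplus>\<^bsub>S\<^esub> b) = c \<otimes>\<^bsub>S\<^esub> a \<oplus>\<^bsub>S\<^esub> c \<otimes>\<^bsub>S\<^esub> b"
    using add_hom_add[OF S_mult_right[OF abc(3)] abc(1,2)] .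
qed (rule S_abelian_group)

text \<open>Agreement with \<psi> is asked on generators only, since \<open>homog\<close> coincides
  with \<open>place i\<close> after \<open>chain_of\<close> just on words of length i.\<close>

lemma add_hom_multilinear:
  assumes ml: "chain_multilinear R M i N Y \<phi>" and h: "h \<in> add_hom Y Z"
    and N: "left_module R N" and eq: "\<And>p. p \<in> chain_gens M i N \<Longrightarrow> \<psi> p = h (\<phi> p)"
  shows "chain_multilinear R M i N Z \<psi>"
proof -
  interpret N: left_module R N by fact
  note cl = chain_multilinear_closed[OF ml]
  show ?thesis
    unfolding chain_multilinear_def
  proof (intro conjI allI impI, goal_cases)
    case 1 show ?case using add_hom_closed[OF h cl] by (simp add: eq)
  next
    case (2 us a vs x b)
    then have "(us @ (a \<oplus>\<^bsub>M\<^esub> b) # vs, x) \<in> chain_gens M i N" "(us @ b # vs, x) \<in> chain_gens M i N"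
      by (auto simp: chain_gens_iff)
    then show ?case
      using 2 by (simp add: eq chain_multilinear_add_left[OF ml] add_hom_add[OF h] cl)
  next
    case (3 us x y)
    then have "(us, x \<oplus>\<^bsub>N\<^esub> y) \<in> chain_gens M i N" "(us, y) \<in> chain_gens M i N"
      by (auto simp: chain_gens_iff)
    then show ?case
      using 3 by (simp add: eq chain_multilinear_add_right[OF ml] add_hom_add[OF h] cl)
  next
    case (4 us a b vs x r)
    then have "(us @ (a \<odot>r\<^bsub>M\<^esub> r) # b # vs, x) \<in> chain_gens M i N" "(us @ a # (r \<odot>\<^bsub>M\<^esub> b) # vs, x) \<in> chain_gens M i N"
      by (auto simp: chain_gens_iff)
    then show ?case using 4 by (simp add: eq chain_multilinear_balanced[OF ml])
  next
    case (5 us a x r)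
    then have "(us @ [a \<odot>r\<^bsub>M\<^esub> r], x) \<in> chain_gens M i N" "(us @ [a], r \<odot>\<^bsub>N\<^esub> x) \<in> chain_gens M i N"
      by (auto simp: chain_gens_iff)
    then show ?case using 5 by (simp add: eq chain_multilinear_balanced_last[OF ml])
  qed
qed

text \<open>The source of the additivity of the maps \<eta> and \<mu> and of the compatibility of
  \<mu> with right multiplication.\<close>

lemma homog_multilinear: "chain_multilinear R M i (reg_lmod R) S (homog R M n)"
proof (rule add_hom_multilinear[OF reg.chain_of_multilinear, of "place i"])
  show "place i \<in> add_hom (tensor_chain R M i (reg_lmod R)) S"
    using place_add_hom by (simp add: tensor_pow_def)
  show "left_module R (reg_lmod R)" by (rule reg_left_module[OF R.ring_axioms])
  show "homog R M n p = place i (chain_of R M i (reg_lmod R) p)" if "p \<in> chain_gens M i (reg_lmod R)" for p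
    using that by (auto simp: chain_gens_def homog_def place_def intro!: restrict_ext)
qed

end

section \<open>The module of a pair\<close>

locale triv_pair = triv_extension R M n + bimodule_pair R M X
  for R :: "('r, 'a) ring_scheme" (structure) and M :: "('r, 'm, 'b) bimod_scheme" (structure)
    and n :: nat and X :: "('r, 'x, 'c) module_scheme" +
  fixes f :: "('m list \<times> 'x \<Rightarrow>\<^sub>0 int) set \<Rightarrow> 'x"
  assumes f_hom: "f \<in> lmod_hom R (tensor_chain R M 1 X) X"
    and iter_zero: "t \<in> carrier (tensor_chain R M (n + 1) X) \<Longrightarrow> iter_map R M X f t = \<zero>\<^bsub>X\<^esub>"
begin

abbreviation "XS \<equiv> triv_ext_module R M n X f"

text \<open>The intended action of (0, m, 0, ..., 0), available before the action of S has been
  studied.\<close>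

definition act where "act m x = f (chain_of R M 1 X ([m], x))"

lemma chain_1_closed:
  "\<lbrakk>m \<in> carrier M; x \<in> carrier X\<rbrakk> \<Longrightarrow> ([m], x) \<in> chain_gens M 1 X"
  by (simp add: chain_gens_iff)

lemma act_multilinear: "chain_multilinear R M 1 X X (\<lambda>p. f (chain_of R M 1 X p))"
  by (rule add_hom_multilinear[OF chain_of_multilinear lmod_hom_add_hom[OF f_hom] N.left_module_axioms refl])

lemma act_closed: "\<lbrakk>m \<in> carrier M; x \<in> carrier X\<rbrakk> \<Longrightarrow> act m x \<in> carrier X"
  unfolding act_def by (rule chain_multilinear_closed[OF act_multilinear chain_1_closed])

lemma act_add_left:
  "\<lbrakk>m \<in> carrier M; m' \<in> carrier M; x \<in> carrier X\<rbrakk> \<Longrightarrow> act (m \<oplus>\<^bsub>M\<^esub> m') x = act m x \<oplus>\<^bsub>X\<^esub> act m' x"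
  unfolding act_def
  using chain_multilinear_add_left[OF act_multilinear, of "[]" m "[]" x m'] by (simp add: chain_gens_iff)

lemma act_add_hom: "m \<in> carrier M \<Longrightarrow> act m \<in> add_hom X X"
  using chain_multilinear_add_right[OF act_multilinear, of "[m]"]
  by (intro add_homI act_closed) (auto simp: act_def chain_gens_iff)

lemma act_rsmult: "\<lbrakk>m \<in> carrier M; r \<in> carrier R; x \<in> carrier X\<rbrakk> \<Longrightarrow> act (m \<odot>r\<^bsub>M\<^esub> r) x = act m (r \<odot>\<^bsub>X\<^esub> x)"
  unfolding act_def
  using chain_multilinear_balanced_last[OF act_multilinear, of "[]" m x r] by (simp add: chain_gens_iff)

lemma act_smult:
  assumes "m \<in> carrier M" "r \<in> carrier R" "x \<in> carrier X"
  shows "act (r \<odot>\<^bsub>M\<^esub> m) x = r \<odot>\<^bsub>X\<^esub> act m x"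
proof -
  have "([m], x) \<in> chain_gens M 1 X" using assms by (simp add: chain_gens_iff)
  then show ?thesis
    unfolding act_def
    using lmod_hom_smult[OF f_hom assms(2) chain_of_closed] tensor_smult_of[OF assms(2)]
    by (metis gen_smult.simps(2))
qed

lemma foldr_act_add_hom: "set ms \<subseteq> carrier M \<Longrightarrow> foldr act ms \<in> add_hom X X"
proof (induction ms)
  case Nil then show ?case by (simp add: add_hom_def)
next
  case (Cons m ms)
  then have "(\<lambda>x. act m (foldr act ms x)) \<in> add_hom X X"
    by (intro add_hom_comp[OF Cons.IH act_add_hom]) auto
  then show ?case by (simp add: comp_def)
qed

lemma foldr_act_closed: "\<lbrakk>set ms \<subseteq> carrier M; x \<in> carrier X\<rbrakk> \<Longrightarrow> foldr act ms x \<in> carrier X"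
  by (rule add_hom_closed[OF foldr_act_add_hom])

lemma foldr_act_zero: "set ms \<subseteq> carrier M \<Longrightarrow> foldr act ms \<zero>\<^bsub>X\<^esub> = \<zero>\<^bsub>X\<^esub>"
  by (rule add_hom_zero[OF N.M.abelian_group_axioms N.M.abelian_group_axioms foldr_act_add_hom])

text \<open>Between neighbours, a scalar leaves the left letter by balancedness of the tensor
  product and enters the right letter because f is R-linear.\<close>

lemma iter_multilinear: "chain_multilinear R M i X X (\<lambda>(ms, x). foldr act ms x)"
  unfolding chain_multilinear_def
proof (intro conjI allI impI, goal_cases)
  case 1 then show ?case by (auto simp: chain_gens_iff foldr_act_closed)
next
  case (2 us a vs x b)
  then have *: "set us \<subseteq> carrier M" "foldr act vs x \<in> carrier X" "a \<in> carrier M" "b \<in> carrier M"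
    by (auto simp: chain_gens_iff foldr_act_closed)
  then show ?case by (simp add: act_add_left add_hom_add[OF foldr_act_add_hom] act_closed)
next
  case (3 us x y)
  then show ?case by (simp add: chain_gens_iff add_hom_add[OF foldr_act_add_hom])
next
  case (4 us a b vs x r)
  then have "foldr act vs x \<in> carrier X" "a \<in> carrier M" "b \<in> carrier M"
    by (auto simp: chain_gens_iff foldr_act_closed)
  then show ?case using 4 by (simp add: act_rsmult act_smult act_closed)
next
  case (5 us a x r)
  then show ?case by (simp add: act_rsmult chain_gens_iff)
qed

lemma iter_map_eq: "iter_map R M X f = chain_lift (add_monoid X) (\<lambda>(ms, x). foldr act ms x)"
proof -
  have "(\<lambda>m y. f (chain_of R M 1 X ([m], y))) = act" by (intro ext) (simp add: act_def)
  then show ?thesis by (simp add: iter_map_def)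
qed

lemma iter_map_add_hom: "iter_map R M X f \<in> add_hom (tensor_chain R M i X) X"
  unfolding iter_map_eq by (rule chain_lift_add_hom[OF N.M.abelian_group_axioms iter_multilinear])

lemma iter_map_of:
  "(ms, x) \<in> chain_gens M i X \<Longrightarrow> iter_map R M X f (chain_of R M i X (ms, x)) = foldr act ms x"
  unfolding iter_map_eq using chain_lift_of[OF N.M.abelian_group_axioms iter_multilinear] by simp

text \<open>The hypothesis on f concerns words of length exactly n + 1. In a longer word the last n
  + 1 letters act first and give zero, which the remaining letters preserve.\<close>

lemma foldr_act_nilpotent:
  assumes "set ms \<subseteq> carrier M" "n < length ms" "x \<in> carrier X"
  shows "foldr act ms x = \<zero>\<^bsub>X\<^esub>"
proof -
  let ?k = "length ms - Suc n"
  have 1: "set (drop ?k ms) \<subseteq> carrier M" "set (take ?k ms) \<subseteq> carrier M"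
    using assms set_drop_subset set_take_subset by fast+
  have g: "(drop ?k ms, x) \<in> chain_gens M (n + 1) X"
    using assms 1 by (simp add: chain_gens_iff)
  have "foldr act (drop ?k ms) x = \<zero>\<^bsub>X\<^esub>"
    using iter_map_of[OF g] iter_zero[OF chain_of_closed[OF g]] by simp
  then have "foldr act (take ?k ms @ drop ?k ms) x = \<zero>\<^bsub>X\<^esub>"
    using foldr_act_zero 1 by (simp del: append_take_drop_id)
  then show ?thesis by simp
qed

lemma XS_simps [simp]:
  "carrier XS = carrier X" "\<zero>\<^bsub>XS\<^esub> = \<zero>\<^bsub>X\<^esub>" "add XS = add X"
  by (simp_all add: triv_ext_module_def)

definition piece where
  "piece i t x = iter_map R M X f (tensor_join R M X i 0 t (chain_of R M 0 X ([], x)))"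

lemma XS_smult: "a \<odot>\<^bsub>XS\<^esub> x = (\<Oplus>\<^bsub>X\<^esub>i\<in>{..n}. piece i (a i) x)"
  by (simp add: triv_ext_module_def piece_def)

lemma chain_0_add_hom: "(\<lambda>x. chain_of R M 0 X ([], x)) \<in> add_hom X (tensor_chain R M 0 X)"
  using chain_multilinear_add_right[OF chain_of_multilinear[of 0], of "[]"]
  by (intro add_homI chain_of_closed) (auto simp: chain_gens_iff)

lemma piece_left: "x \<in> carrier X \<Longrightarrow> (\<lambda>t. piece i t x) \<in> add_hom (T i) X"
  unfolding piece_def
  using tensor_join_add_hom_left[OF add_hom_closed[OF chain_0_add_hom], of x i]
  by (intro add_hom_comp[OF _ iter_map_add_hom]) simp_all

lemma piece_right: "t \<in> carrier (T i) \<Longrightarrow> piece i t \<in> add_hom X X"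
  unfolding piece_def
  using add_hom_comp[OF add_hom_comp[OF chain_0_add_hom tensor_join_add_hom_right[of t i]] iter_map_add_hom]
  by simp

lemma piece_of:
  assumes "(us, r) \<in> chain_gens M i (reg_lmod R)" "x \<in> carrier X"
  shows "piece i (chain_of R M i (reg_lmod R) (us, r)) x = foldr act us (r \<odot>\<^bsub>X\<^esub> x)"
proof -
  have "([], x) \<in> chain_gens M 0 X" using assms by (simp add: chain_gens_iff)
  from tensor_join_of[OF assms(1) this]
  have "piece i (chain_of R M i (reg_lmod R) (us, r)) x = iter_map R M X f (chain_of R M i X (us, r \<odot>\<^bsub>X\<^esub> x))"
    by (simp add: piece_def gen_join_eq)
  then show ?thesis
    using assms by (simp add: iter_map_of chain_gens_iff reg_lmod_simps)
qed

lemma XS_smult_left: "x \<in> carrier X \<Longrightarrow> (\<lambda>a. a \<odot>\<^bsub>XS\<^esub> x) \<in> add_hom S X"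
  unfolding XS_smult
  by (intro add_hom_finsum N.M.abelian_monoid_axioms add_hom_comp[OF S_proj_add_hom piece_left]) auto

lemma XS_smult_right: "a \<in> carrier S \<Longrightarrow> (\<lambda>x. a \<odot>\<^bsub>XS\<^esub> x) \<in> add_hom X X"
  unfolding XS_smult
  by (intro add_hom_finsum N.M.abelian_monoid_axioms piece_right) (auto simp: S_simps)

text \<open>Only the summand in the degree of the word counts. For words longer than n,
  \<open>homog\<close> is zero by convention and the iterated action is zero by nilpotency of f;
  this is where the condition on the pair is used.\<close>

lemma homog_smult:
  assumes p: "(us, r) \<in> hgens R M" and x: "x \<in> carrier X"
  shows "homog R M n (us, r) \<odot>\<^bsub>XS\<^esub> x = foldr act us (r \<odot>\<^bsub>X\<^esub> x)"
proof -
  let ?y = "foldr act us (r \<odot>\<^bsub>X\<^esub> x)"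
  have us: "set us \<subseteq> carrier M" "r \<in> carrier R" using p by (auto simp: hgens_def)
  have g: "(us, r) \<in> chain_gens M (length us) (reg_lmod R)"
    using us by (simp add: chain_gens_iff reg_lmod_simps)
  have y: "?y \<in> carrier X" using us x by (simp add: foldr_act_closed)
  have summand: "piece i (homog R M n (us, r) i) x = (if length us = i then ?y else \<zero>\<^bsub>X\<^esub>)" if "i \<le> n" for i
    using that piece_of[OF g x] add_hom_zero[OF T_abelian_group N.M.abelian_group_axioms piece_left[OF x, of i]]
    by (auto simp: homog_def)
  have "homog R M n (us, r) \<odot>\<^bsub>XS\<^esub> x = (\<Oplus>\<^bsub>X\<^esub>i\<in>{..n}. if length us = i then ?y else \<zero>\<^bsub>X\<^esub>)"
    unfolding XS_smult using y by (intro N.M.finsum_cong') (auto simp: summand)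
  also have "\<dots> = ?y"
  proof (cases "length us \<le> n")
    case True then show ?thesis using y by (intro N.M.finsum_singleton) auto
  next
    case False
    then have "(\<Oplus>\<^bsub>X\<^esub>i\<in>{..n}. if length us = i then ?y else \<zero>\<^bsub>X\<^esub>) = (\<Oplus>\<^bsub>X\<^esub>i\<in>{..n}. \<zero>\<^bsub>X\<^esub>)"
      by (intro N.M.finsum_cong') auto
    then show ?thesis
      using False us x by (simp add: foldr_act_nilpotent N.M.finsum_zero)
  qed
  finally show ?thesis .
qed

lemma homog_smult_assoc:
  assumes p: "p \<in> hgens R M" and q: "q \<in> hgens R M" and x: "x \<in> carrier X"
  shows "homog R M n (gjoin p q) \<odot>\<^bsub>XS\<^esub> x = homog R M n p \<odot>\<^bsub>XS\<^esub> (homog R M n q \<odot>\<^bsub>XS\<^esub> x)"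
proof -
  obtain us r vs s where pq: "p = (us, r)" "q = (vs, s)" by fastforce
  have c: "set us \<subseteq> carrier M" "r \<in> carrier R" "set vs \<subseteq> carrier M" "s \<in> carrier R"
    using p q by (auto simp: pq hgens_def)
  have "foldr act (fst (gjoin p q)) (snd (gjoin p q) \<odot>\<^bsub>X\<^esub> x) = foldr act us (r \<odot>\<^bsub>X\<^esub> foldr act vs (s \<odot>\<^bsub>X\<^esub> x))"
    using c x
    by (cases vs) (auto simp: pq reg.gen_join_eq reg_lmod_simps N.smult_assoc1 act_smult foldr_act_closed)
  moreover have "foldr act vs (s \<odot>\<^bsub>X\<^esub> x) \<in> carrier X" using c x by (simp add: foldr_act_closed)
  ultimately show ?thesis
    using homog_smult[of "fst (gjoin p q)" "snd (gjoin p q)" x] gjoin_hgens[OF p q] x p q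
    by (simp add: pq homog_smult)
qed

text \<open>As in \<open>S_ring\<close>: associativity of the action holds on generators and is
  extended first in b, then in a.\<close>

lemma XS_left_module: "left_module S XS"
proof -
  interpret S: ring S by (rule S_ring)
  have XS_group: "abelian_group XS"
    by (rule abelian_groupI) (auto simp: N.M.a_ac intro: N.M.l_neg)
  have cl: "a \<odot>\<^bsub>XS\<^esub> x \<in> carrier X" if "a \<in> carrier S" "x \<in> carrier X" for a x
    using add_hom_closed[OF XS_smult_right[OF that(1)] that(2)] .
  have 1: "(homog R M n p \<otimes>\<^bsub>S\<^esub> b) \<odot>\<^bsub>XS\<^esub> x = homog R M n p \<odot>\<^bsub>XS\<^esub> (b \<odot>\<^bsub>XS\<^esub> x)"
    if "p \<in> hgens R M" "b \<in> carrier S" "x \<in> carrier X" for p b x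
  proof (rule S_hom_eqI[OF N.M.abelian_group_axioms _ _ _ that(2)])
    show "(\<lambda>b. (homog R M n p \<otimes>\<^bsub>S\<^esub> b) \<odot>\<^bsub>XS\<^esub> x) \<in> add_hom S X"
      using that by (intro add_hom_comp[OF S_mult_right XS_smult_left] homog_closed)
    show "(\<lambda>b. homog R M n p \<odot>\<^bsub>XS\<^esub> (b \<odot>\<^bsub>XS\<^esub> x)) \<in> add_hom S X"
      using that by (intro add_hom_comp[OF XS_smult_left XS_smult_right] homog_closed)
  qed (use that in \<open>simp add: homog_mult homog_smult_assoc\<close>)
  have 2: "(a \<otimes>\<^bsub>S\<^esub> b) \<odot>\<^bsub>XS\<^esub> x = a \<odot>\<^bsub>XS\<^esub> (b \<odot>\<^bsub>XS\<^esub> x)"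
    if "a \<in> carrier S" "b \<in> carrier S" "x \<in> carrier X" for a b x
  proof (rule S_hom_eqI[OF N.M.abelian_group_axioms _ _ _ that(1)])
    show "(\<lambda>a. (a \<otimes>\<^bsub>S\<^esub> b) \<odot>\<^bsub>XS\<^esub> x) \<in> add_hom S X"
      using that by (intro add_hom_comp[OF S_mult_left XS_smult_left])
    show "(\<lambda>a. a \<odot>\<^bsub>XS\<^esub> (b \<odot>\<^bsub>XS\<^esub> x)) \<in> add_hom S X"
      using that by (intro XS_smult_left cl)
  qed (use that 1 in simp)
  show ?thesis
  proof (intro left_module.intro left_module_axioms.intro S.ring_axioms XS_group)
    fix a x assume a: "a \<in> carrier S" and x: "x \<in> carrier XS"
    show "a \<odot>\<^bsub>XS\<^esub> x \<in> carrier XS" using a x cl by simp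
    show "(a \<oplus>\<^bsub>S\<^esub> b) \<odot>\<^bsub>XS\<^esub> x = a \<odot>\<^bsub>XS\<^esub> x \<oplus>\<^bsub>XS\<^esub> b \<odot>\<^bsub>XS\<^esub> x" if "b \<in> carrier S" for b
      using add_hom_add[OF XS_smult_left a that] x by simp
    show "a \<odot>\<^bsub>XS\<^esub> (x \<oplus>\<^bsub>XS\<^esub> y) = a \<odot>\<^bsub>XS\<^esub> x \<oplus>\<^bsub>XS\<^esub> a \<odot>\<^bsub>XS\<^esub> y" if "y \<in> carrier XS" for y
      using add_hom_add[OF XS_smult_right[OF a]] x that by simp
    show "(a \<otimes>\<^bsub>S\<^esub> b) \<odot>\<^bsub>XS\<^esub> x = a \<odot>\<^bsub>XS\<^esub> (b \<odot>\<^bsub>XS\<^esub> x)" if "b \<in> carrier S" for b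
      using 2 a that x by simp
  next
    fix x assume "x \<in> carrier XS"
    then show "\<one>\<^bsub>S\<^esub> \<odot>\<^bsub>XS\<^esub> x = x"
      using homog_smult[of "[]" "\<one>\<^bsub>R\<^esub>" x] by (simp add: S_one hgens_def)
  qed
qed

end

section \<open>Nilpotent augmented rings\<close>

text \<open>Keeps the \<open>1\<close> in \<^const>\<open>tensor_chain\<close> from being rewritten to \<open>Suc 0\<close>, which would block the facts about
  \<open>tensor_prod\<close>.\<close>

declare One_nat_def [simp del]

text \<open>All that the rest has to know about S. \<open>S_gen\<close> says S = \<eta> R + (\<mu>
  M) S, which makes (\<mu> M) S the kernel of \<epsilon>, and \<open>mu_nilpotent\<close> bounds the
  number of factors from M. Neither tuples nor cosets occur.\<close>

locale augmented_ring = bimodule R M + S: ring S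
  for R :: "('r, 'a) ring_scheme" (structure) and M :: "('r, 'm, 'b) bimod_scheme" (structure)
    and S :: "('s, 'd) ring_scheme" +
  fixes \<eta> :: "'r \<Rightarrow> 's" and \<epsilon> :: "'s \<Rightarrow> 'r" and \<mu> :: "'m \<Rightarrow> 's" and n :: nat
  assumes eta_hom: "\<eta> \<in> ring_hom R S" and eps_hom: "\<epsilon> \<in> ring_hom S R"
    and mu_hom: "\<mu> \<in> add_hom M S"
    and eps_eta: "r \<in> carrier R \<Longrightarrow> \<epsilon> (\<eta> r) = r"
    and eps_mu: "m \<in> carrier M \<Longrightarrow> \<epsilon> (\<mu> m) = \<zero>\<^bsub>R\<^esub>"
    and mu_smult: "\<lbrakk>r \<in> carrier R; m \<in> carrier M\<rbrakk> \<Longrightarrow> \<mu> (r \<odot>\<^bsub>M\<^esub> m) = \<eta> r \<otimes>\<^bsub>S\<^esub> \<mu> m"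
    and mu_rsmult: "\<lbrakk>m \<in> carrier M; r \<in> carrier R\<rbrakk> \<Longrightarrow> \<mu> (m \<odot>r\<^bsub>M\<^esub> r) = \<mu> m \<otimes>\<^bsub>S\<^esub> \<eta> r"
    and S_gen: "s \<in> carrier S \<Longrightarrow>
      s \<in> aspan S (\<eta> ` carrier R \<union> {\<mu> m \<otimes>\<^bsub>S\<^esub> t | m t. m \<in> carrier M \<and> t \<in> carrier S})"
    and mu_nilpotent: "\<lbrakk>length ms = Suc n; set ms \<subseteq> carrier M\<rbrakk> \<Longrightarrow>
      foldr (\<lambda>m s. \<mu> m \<otimes>\<^bsub>S\<^esub> s) ms \<one>\<^bsub>S\<^esub> = \<zero>\<^bsub>S\<^esub>"
begin

lemma eta_closed [simp]: "r \<in> carrier R \<Longrightarrow> \<eta> r \<in> carrier S"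
  using ring_hom_closed[OF eta_hom] .

lemma eps_closed [simp]: "s \<in> carrier S \<Longrightarrow> \<epsilon> s \<in> carrier R"
  using ring_hom_closed[OF eps_hom] .

lemma mu_closed [simp]: "m \<in> carrier M \<Longrightarrow> \<mu> m \<in> carrier S"
  using add_hom_closed[OF mu_hom] .

lemma eta_add_hom: "\<eta> \<in> add_hom R S" and eps_add_hom: "\<epsilon> \<in> add_hom S R"
  using eta_hom eps_hom by (auto simp: add_hom_def ring_hom_def)

lemma eta_zero: "\<eta> \<zero>\<^bsub>R\<^esub> = \<zero>\<^bsub>S\<^esub>" and eps_zero: "\<epsilon> \<zero>\<^bsub>S\<^esub> = \<zero>\<^bsub>R\<^esub>"
  by (rule add_hom_zero[OF _ _ eta_add_hom] add_hom_zero[OF _ _ eps_add_hom],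
      rule R.abelian_group_axioms S.abelian_group_axioms, rule R.abelian_group_axioms S.abelian_group_axioms)+

lemma eps_mu_mult: "\<lbrakk>m \<in> carrier M; s \<in> carrier S\<rbrakk> \<Longrightarrow> \<epsilon> (\<mu> m \<otimes>\<^bsub>S\<^esub> s) = \<zero>\<^bsub>R\<^esub>"
  using ring_hom_mult[OF eps_hom] by (simp add: eps_mu)

section \<open>The submodule M Y and Nakayama's lemma\<close>

text \<open>\<open>rad Y\<close> is \<open>M Y\<close>, the image of \<open>M \<otimes> Y\<close> in \<open>Y\<close>.\<close>

definition rad_gens where "rad_gens Y = {\<mu> m \<odot>\<^bsub>Y\<^esub> y | m y. m \<in> carrier M \<and> y \<in> carrier Y}"

definition rad where "rad Y = aspan Y (rad_gens Y)"

context
  fixes Y assumes Y: "left_module S Y"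
begin

interpretation Y: left_module S Y by (rule Y)

lemma rad_gens_closed: "rad_gens Y \<subseteq> carrier Y"
  by (auto simp: rad_gens_def)

lemma rad_closed: "z \<in> rad Y \<Longrightarrow> z \<in> carrier Y"
  unfolding rad_def using Y.M.aspan_closed rad_gens_closed by blast

lemma rad_zero: "\<zero>\<^bsub>Y\<^esub> \<in> rad Y"
  unfolding rad_def by (rule aspan.zero)

lemma rad_add: "\<lbrakk>x \<in> rad Y; y \<in> rad Y\<rbrakk> \<Longrightarrow> x \<oplus>\<^bsub>Y\<^esub> y \<in> rad Y"
  unfolding rad_def using Y.M.aspan_add rad_gens_closed by blast

lemma rad_base: "\<lbrakk>m \<in> carrier M; y \<in> carrier Y\<rbrakk> \<Longrightarrow> \<mu> m \<odot>\<^bsub>Y\<^esub> y \<in> rad Y"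
  unfolding rad_def by (rule Y.M.aspan_base[OF _ rad_gens_closed]) (auto simp: rad_gens_def)

text \<open>The claim is additive in s. A generator \<eta> r leaves no remainder, and a generator
  \<mu> m t is all remainder, since \<epsilon> kills it.\<close>

lemma smult_decomp:
  assumes s: "s \<in> carrier S" and y: "y \<in> carrier Y"
  shows "\<exists>z\<in>rad Y. s \<odot>\<^bsub>Y\<^esub> y = \<eta> (\<epsilon> s) \<odot>\<^bsub>Y\<^esub> y \<oplus>\<^bsub>Y\<^esub> z"
  using S_gen[OF s]
proof induction
  case zero
  then show ?case using y by (intro bexI[OF _ rad_zero]) (simp add: eps_zero eta_zero)
next
  case (add g s)
  let ?A = "\<eta> ` carrier R \<union> {\<mu> m \<otimes>\<^bsub>S\<^esub> t | m t. m \<in> carrier M \<and> t \<in> carrier S}"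
  have A: "?A \<subseteq> carrier S" by auto
  have s: "s \<in> carrier S" using S.aspan_closed[OF add.hyps(2) A] .
  have g: "g \<in> carrier S" using add.hyps(1) A by blast
  from add.IH obtain z where z: "z \<in> rad Y" "s \<odot>\<^bsub>Y\<^esub> y = \<eta> (\<epsilon> s) \<odot>\<^bsub>Y\<^esub> y \<oplus>\<^bsub>Y\<^esub> z" by blast
  have zc: "z \<in> carrier Y" using z rad_closed by blast
  have eq: "(g \<oplus>\<^bsub>S\<^esub> s) \<odot>\<^bsub>Y\<^esub> y = g \<odot>\<^bsub>Y\<^esub> y \<oplus>\<^bsub>Y\<^esub> (\<eta> (\<epsilon> s) \<odot>\<^bsub>Y\<^esub> y \<oplus>\<^bsub>Y\<^esub> z)"
    "\<eta> (\<epsilon> (g \<oplus>\<^bsub>S\<^esub> s)) \<odot>\<^bsub>Y\<^esub> y = \<eta> (\<epsilon> g) \<odot>\<^bsub>Y\<^esub> y \<oplus>\<^bsub>Y\<^esub> \<eta> (\<epsilon> s) \<odot>\<^bsub>Y\<^esub> y"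
    using g s y z(2) by (simp_all add: Y.smult_l_distr add_hom_add[OF eps_add_hom] add_hom_add[OF eta_add_hom])
  from add.hyps(1) consider r where "r \<in> carrier R" "g = \<eta> r"
    | m t where "m \<in> carrier M" "t \<in> carrier S" "g = \<mu> m \<otimes>\<^bsub>S\<^esub> t" by blast
  then show ?case
  proof cases
    case 1
    then have "(g \<oplus>\<^bsub>S\<^esub> s) \<odot>\<^bsub>Y\<^esub> y = \<eta> (\<epsilon> (g \<oplus>\<^bsub>S\<^esub> s)) \<odot>\<^bsub>Y\<^esub> y \<oplus>\<^bsub>Y\<^esub> z"
      unfolding eq using s y zc by (simp add: eps_eta Y.M.a_assoc)
    then show ?thesis using z(1) by blast
  next
    case 2
    then have "(g \<oplus>\<^bsub>S\<^esub> s) \<odot>\<^bsub>Y\<^esub> y = \<eta> (\<epsilon> (g \<oplus>\<^bsub>S\<^esub> s)) \<odot>\<^bsub>Y\<^esub> y \<oplus>\<^bsub>Y\<^esub> (\<mu> m \<odot>\<^bsub>Y\<^esub> (t \<odot>\<^bsub>Y\<^esub> y) \<oplus>\<^bsub>Y\<^esub> z)"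
      unfolding eq using s y zc
      by (simp add: eps_mu_mult eta_zero Y.smult_assoc1 Y.M.a_lcomm)
    then show ?thesis using rad_add[OF rad_base[OF 2(1)] z(1)] 2(2) y by blast
  qed
qed

lemma rad_eta:
  assumes "r \<in> carrier R" "z \<in> rad Y" shows "\<eta> r \<odot>\<^bsub>Y\<^esub> z \<in> rad Y"
  using assms(2) unfolding rad_def
proof (rule aspan_image[OF Y.M.abelian_group_axioms Y.M.abelian_group_axioms
      Y.smult_add_hom[OF eta_closed[OF assms(1)]], rotated 3])
  fix g assume "g \<in> rad_gens Y"
  then obtain m y where g: "g = \<mu> m \<odot>\<^bsub>Y\<^esub> y" "m \<in> carrier M" "y \<in> carrier Y" by (auto simp: rad_gens_def)
  then have "\<eta> r \<odot>\<^bsub>Y\<^esub> g = \<mu> (r \<odot>\<^bsub>M\<^esub> m) \<odot>\<^bsub>Y\<^esub> y"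
    using assms by (simp add: mu_smult Y.smult_assoc1)
  then show "\<eta> r \<odot>\<^bsub>Y\<^esub> g \<in> aspan Y (rad_gens Y)"
    using rad_base[of "r \<odot>\<^bsub>M\<^esub> m" y] g assms by (simp add: rad_def)
qed (use assms rad_gens_closed in simp_all)

text \<open>\<open>smult_decomp\<close> reduces closure under S to closure under \<eta> R, and there
  the scalar is absorbed into M by \<open>mu_smult\<close>.\<close>

lemma rad_lsubmod: "lsubmod S Y (rad Y)"
  unfolding lsubmod_def
proof (intro conjI ballI)
  fix s z assume s: "s \<in> carrier S" and z: "z \<in> rad Y"
  obtain z' where "z' \<in> rad Y" "s \<odot>\<^bsub>Y\<^esub> z = \<eta> (\<epsilon> s) \<odot>\<^bsub>Y\<^esub> z \<oplus>\<^bsub>Y\<^esub> z'"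
    using smult_decomp[OF s rad_closed[OF z]] by blast
  then show "s \<odot>\<^bsub>Y\<^esub> z \<in> rad Y" using rad_add[OF rad_eta[OF eps_closed[OF s] z]] by simp
qed (auto simp: rad_zero rad_add rad_closed)

text \<open>Carries \<open>mu_nilpotent\<close>, a statement about S, over to every
  S-module.\<close>

lemma foldr_mu_eq:
  assumes "set ms \<subseteq> carrier M" "y \<in> carrier Y"
  shows "foldr (\<lambda>m s. \<mu> m \<otimes>\<^bsub>S\<^esub> s) ms \<one>\<^bsub>S\<^esub> \<in> carrier S \<and>
    foldr (\<lambda>m y. \<mu> m \<odot>\<^bsub>Y\<^esub> y) ms y = foldr (\<lambda>m s. \<mu> m \<otimes>\<^bsub>S\<^esub> s) ms \<one>\<^bsub>S\<^esub> \<odot>\<^bsub>Y\<^esub> y"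
  using assms by (induction ms) (auto simp: Y.smult_assoc1)

text \<open>Substituting Y = N + M Y into itself gives Y = N + M^j Y for every j, and M^(n + 1) Y =
  0.\<close>

lemma nakayama:
  assumes N: "lsubmod S Y N"
    and dec: "\<And>y. y \<in> carrier Y \<Longrightarrow> \<exists>u\<in>N. \<exists>z\<in>rad Y. y = u \<oplus>\<^bsub>Y\<^esub> z"
  shows "carrier Y \<subseteq> N"
proof -
  let ?F = "foldr (\<lambda>m y. \<mu> m \<odot>\<^bsub>Y\<^esub> y)"
  have F_add: "?F ms \<in> add_hom Y Y" if "set ms \<subseteq> carrier M" for ms
    using that
  proof (induction ms)
    case Nil then show ?case by (simp add: add_hom_def)
  next
    case (Cons m ms)
    then have "(\<lambda>y. \<mu> m \<odot>\<^bsub>Y\<^esub> ?F ms y) \<in> add_hom Y Y"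
      by (intro add_hom_comp[OF Cons.IH Y.smult_add_hom]) auto
    then show ?case by (simp add: comp_def)
  qed
  have F_N: "?F ms u \<in> N" if "set ms \<subseteq> carrier M" "u \<in> N" for ms u
    using that N by (induction ms) (auto simp: lsubmod_def)
  \<comment> \<open>The substitution read backwards: words of length \<open>Suc n\<close> send Y to
    zero, and if all words one letter longer map Y into N, so does \<open>ms\<close>. k counts the
    letters still missing.\<close>
  have "?F ms y \<in> N" if "set ms \<subseteq> carrier M" "length ms + k = Suc n" "y \<in> carrier Y" for ms k y
    using that
  proof (induction k arbitrary: ms y)
    case 0
    then have "?F ms y = \<zero>\<^bsub>Y\<^esub>" using foldr_mu_eq[of ms y] mu_nilpotent[of ms] by simp
    then show ?case using N by (simp add: lsubmod_def)
  next
    case (Suc k)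
    obtain u z where uz: "u \<in> N" "z \<in> rad Y" "y = u \<oplus>\<^bsub>Y\<^esub> z" using dec[OF Suc.prems(3)] by blast
    have uc: "u \<in> carrier Y" using uz N by (auto simp: lsubmod_def)
    have "?F ms z \<in> N"
      using uz(2) unfolding rad_def
    proof induction
      case zero
      show ?case
        using add_hom_zero[OF Y.M.abelian_group_axioms Y.M.abelian_group_axioms F_add[OF Suc.prems(1)]] N
        by (simp add: lsubmod_def)
    next
      case (add g z)
      then obtain m y' where g: "g = \<mu> m \<odot>\<^bsub>Y\<^esub> y'" "m \<in> carrier M" "y' \<in> carrier Y"
        by (auto simp: rad_gens_def)
      have zc: "z \<in> carrier Y" using add.hyps rad_closed by (simp add: rad_def)
      \<comment> \<open>\<open>foldr\<close> applies the last letter first, so the factor \<mu> m of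
        g is absorbed by appending m to the word.\<close>
      have "?F (ms @ [m]) y' \<in> N" using Suc.prems g by (intro Suc.IH) auto
      then have "?F ms g \<in> N" using g by simp
      then show ?case
        using add_hom_add[OF F_add[OF Suc.prems(1)] _ zc, of g] add.IH N g by (simp add: lsubmod_def)
    qed
    then show ?case
      using add_hom_add[OF F_add[OF Suc.prems(1)] uc rad_closed[OF uz(2)]] F_N[OF Suc.prems(1) uz(1)] N
      by (simp add: uz(3) lsubmod_def)
  qed
  from this[of "[]" "Suc n"] show ?thesis by auto
qed

end

lemma rad_hom:
  assumes "left_module S Y" "left_module S Z" "h \<in> lmod_hom S Y Z" "z \<in> rad Y"
  shows "h z \<in> rad Z"
proof -
  interpret Y: left_module S Y by fact
  interpret Z: left_module S Z by fact
  show ?thesis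
    using assms(4) unfolding rad_def
  proof (rule aspan_image[OF Y.M.abelian_group_axioms Z.M.abelian_group_axioms lmod_hom_add_hom[OF assms(3)], rotated 3])
    fix g assume "g \<in> rad_gens Y"
    then obtain m y where g: "g = \<mu> m \<odot>\<^bsub>Y\<^esub> y" "m \<in> carrier M" "y \<in> carrier Y" by (auto simp: rad_gens_def)
    then show "h g \<in> aspan Z (rad_gens Z)"
      using rad_base[OF assms(2), of m "h y"] add_hom_closed[OF lmod_hom_add_hom[OF assms(3)]]
      by (simp add: lmod_hom_smult[OF assms(3)] rad_def)
  qed (use rad_gens_closed assms in auto)
qed

lemma rad_surj:
  assumes "left_module S Y" "left_module S Z" "h \<in> lmod_hom S Y Z" "h ` carrier Y = carrier Z" "z \<in> rad Z"
  shows "\<exists>y\<in>rad Y. h y = z"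
proof -
  interpret Y: left_module S Y by fact
  interpret Z: left_module S Z by fact
  note hh = lmod_hom_add_hom[OF assms(3)]
  show ?thesis
    using assms(5) unfolding rad_def[of Z]
  proof induction
    case zero
    show ?case using add_hom_zero[OF Y.M.abelian_group_axioms Z.M.abelian_group_axioms hh] rad_zero[OF assms(1)] by blast
  next
    case (add g z)
    then obtain m y' y where g: "g = \<mu> m \<odot>\<^bsub>Z\<^esub> y'" "m \<in> carrier M" "y' \<in> carrier Z" and y: "y \<in> rad Y" "h y = z"
      by (auto simp: rad_gens_def)
    obtain x where x: "x \<in> carrier Y" "y' = h x" using g(3) assms(4) by blast
    have "h (\<mu> m \<odot>\<^bsub>Y\<^esub> x \<oplus>\<^bsub>Y\<^esub> y) = g \<oplus>\<^bsub>Z\<^esub> z"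
      using g x y rad_closed[OF assms(1) y(1)] by (simp add: add_hom_add[OF hh] lmod_hom_smult[OF assms(3)])
    then show ?case using rad_add[OF assms(1) rad_base[OF assms(1) g(2) x(1)] y(1)] by blast
  qed
qed

section \<open>Passing between R^k and S^k\<close>

definition free_eta where "free_eta k v = (\<lambda>l\<in>{..<k}. \<eta> (v l))"

definition free_eps where "free_eps k w = (\<lambda>l\<in>{..<k}. \<epsilon> (w l))"

lemma free_eta_add_hom: "free_eta k \<in> add_hom (free_lmod R k) (free_lmod S k)"
  unfolding free_eta_def free_lmod_def
  by (intro add_homI) (auto simp: PiE_iff add_hom_add[OF eta_add_hom] intro!: restrict_ext)

lemma free_eps_add_hom: "free_eps k \<in> add_hom (free_lmod S k) (free_lmod R k)"
  unfolding free_eps_def free_lmod_def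
  by (intro add_homI) (auto simp: PiE_iff add_hom_add[OF eps_add_hom] intro!: restrict_ext)

lemma free_eta_smult:
  "\<lbrakk>r \<in> carrier R; v \<in> carrier (free_lmod R k)\<rbrakk> \<Longrightarrow>
    free_eta k (r \<odot>\<^bsub>free_lmod R k\<^esub> v) = \<eta> r \<odot>\<^bsub>free_lmod S k\<^esub> free_eta k v"
  unfolding free_eta_def free_lmod_def
  by (auto simp: PiE_iff ring_hom_mult[OF eta_hom] intro!: restrict_ext)

lemma free_eps_smult:
  "\<lbrakk>s \<in> carrier S; w \<in> carrier (free_lmod S k)\<rbrakk> \<Longrightarrow>
    free_eps k (s \<odot>\<^bsub>free_lmod S k\<^esub> w) = \<epsilon> s \<odot>\<^bsub>free_lmod R k\<^esub> free_eps k w"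
  unfolding free_eps_def free_lmod_def
  by (auto simp: PiE_iff ring_hom_mult[OF eps_hom] intro!: restrict_ext)

lemma free_eps_eta: "v \<in> carrier (free_lmod R k) \<Longrightarrow> free_eps k (free_eta k v) = v"
  unfolding free_eps_def free_eta_def free_lmod_def
  by (auto simp: PiE_iff eps_eta extensional_def fun_eq_iff)

lemma free_eta_unit: "free_eta k (free_unit R k l r) = free_unit S k l (\<eta> r)"
  by (auto simp: free_eta_def free_unit_def eta_zero intro!: restrict_ext)

lemma free_eps_unit: "free_eps k (free_unit S k l s) = free_unit R k l (\<epsilon> s)"
  by (auto simp: free_eps_def free_unit_def eps_zero intro!: restrict_ext)

lemma free_eps_rad:
  assumes "z \<in> rad (free_lmod S k)" shows "free_eps k z = \<zero>\<^bsub>free_lmod R k\<^esub>"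
proof -
  interpret FS: left_module S "free_lmod S k" by (rule S.free_left_module)
  interpret FR: left_module R "free_lmod R k" by (rule R.free_left_module)
  note e = free_eps_add_hom[of k]
  show ?thesis
    using assms unfolding rad_def
  proof induction
    case zero
    show ?case by (rule add_hom_zero[OF FS.M.abelian_group_axioms FR.M.abelian_group_axioms e])
  next
    case (add g z)
    then obtain m y where g: "g = \<mu> m \<odot>\<^bsub>free_lmod S k\<^esub> y" "m \<in> carrier M" "y \<in> carrier (free_lmod S k)"
      by (auto simp: rad_gens_def)
    have "z \<in> carrier (free_lmod S k)"
      using add.hyps rad_closed[OF S.free_left_module] by (simp add: rad_def)
    moreover have "free_eps k g = \<zero>\<^bsub>free_lmod R k\<^esub>"
      using g add_hom_closed[OF e] by (simp add: free_eps_smult eps_mu)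
    ultimately show ?case using g add.IH by (simp add: add_hom_add[OF e])
  qed
qed

text \<open>Together with \<open>free_eps_rad\<close> this identifies the kernel of
  \<open>free_eps\<close> with M F, hence F / M F with R^k. On multiples of unit vectors it is
  \<open>smult_decomp\<close>, and both sides are additive.\<close>

lemma free_decomp:
  assumes w: "w \<in> carrier (free_lmod S k)"
  shows "\<exists>z\<in>rad (free_lmod S k). w = free_eta k (free_eps k w) \<oplus>\<^bsub>free_lmod S k\<^esub> z"
proof -
  let ?F = "free_lmod S k"
  interpret F: left_module S ?F by (rule S.free_left_module)
  \<comment> \<open>The additive idempotent on S^k that keeps the part coming from R^k.\<close>
  define q where "q w = free_eta k (free_eps k w)" for w
  have q: "q \<in> add_hom ?F ?F" unfolding q_def by (rule add_hom_comp[OF free_eps_add_hom free_eta_add_hom])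
  have "\<exists>z\<in>rad ?F. w = q w \<oplus>\<^bsub>?F\<^esub> z"
  proof (rule S.free_lmod_induct[OF w])
    show "\<exists>z\<in>rad ?F. \<zero>\<^bsub>?F\<^esub> = q \<zero>\<^bsub>?F\<^esub> \<oplus>\<^bsub>?F\<^esub> z"
      using add_hom_zero[OF F.M.abelian_group_axioms F.M.abelian_group_axioms q] rad_zero[OF S.free_left_module[of k]]
      by (metis F.M.r_zero F.M.zero_closed)
    fix l a u assume *: "a \<in> carrier S" "u \<in> carrier ?F" "\<exists>z\<in>rad ?F. u = q u \<oplus>\<^bsub>?F\<^esub> z"
    then obtain z where z: "z \<in> rad ?F" "u = q u \<oplus>\<^bsub>?F\<^esub> z" by blast
    let ?e = "free_unit S k l a"
    have ec: "?e \<in> carrier ?F" by (rule S.free_unit_closed[OF *(1)])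
    have 1: "free_unit S k l b = b \<odot>\<^bsub>?F\<^esub> free_unit S k l \<one>\<^bsub>S\<^esub>" if "b \<in> carrier S" for b
      using S.free_unit_smult[of b "\<one>\<^bsub>S\<^esub>" k l] that by simp
    have qe: "q ?e = \<eta> (\<epsilon> a) \<odot>\<^bsub>?F\<^esub> free_unit S k l \<one>\<^bsub>S\<^esub>"
      using 1[of "\<eta> (\<epsilon> a)"] *(1) by (simp add: q_def free_eps_unit free_eta_unit)
    obtain z' where z': "z' \<in> rad ?F" "?e = q ?e \<oplus>\<^bsub>?F\<^esub> z'"
      using smult_decomp[OF S.free_left_module *(1) S.free_unit_closed[OF S.one_closed, of k l]]
      unfolding 1[OF *(1), symmetric] qe[symmetric] by blast
    have c: "q ?e \<in> carrier ?F" "q u \<in> carrier ?F" "z \<in> carrier ?F" "z' \<in> carrier ?F"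
      using add_hom_closed[OF q] ec * z z' rad_closed[OF S.free_left_module] by auto
    have "?e \<oplus>\<^bsub>?F\<^esub> u = (q ?e \<oplus>\<^bsub>?F\<^esub> z') \<oplus>\<^bsub>?F\<^esub> (q u \<oplus>\<^bsub>?F\<^esub> z)" using z z' by simp
    also have "\<dots> = q (?e \<oplus>\<^bsub>?F\<^esub> u) \<oplus>\<^bsub>?F\<^esub> (z' \<oplus>\<^bsub>?F\<^esub> z)"
      using c ec * by (simp add: add_hom_add[OF q] F.M.a_ac)
    finally show "\<exists>z\<in>rad ?F. ?e \<oplus>\<^bsub>?F\<^esub> u = q (?e \<oplus>\<^bsub>?F\<^esub> u) \<oplus>\<^bsub>?F\<^esub> z"
      using rad_add[OF S.free_left_module z'(1) z(1)] by blast
  qed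
  then show ?thesis by (simp add: q_def)
qed

end

text \<open>X and Y are one abelian group held in two records, with scalars from R and from S; by
  \<open>eta_smult\<close>, X is the restriction of Y along \<eta>. The facts \<open>same\<close>
  move sums and spans between the two.\<close>

locale augmented_pair = augmented_ring R M S \<eta> \<epsilon> \<mu> n + bimodule_pair R M X + Y: left_module S Y
  for R :: "('r, 'a) ring_scheme" (structure) and M :: "('r, 'm, 'b) bimod_scheme" (structure)
    and S :: "('s, 'd) ring_scheme" and \<eta> \<epsilon> \<mu> n
    and X :: "('r, 'x, 'c) module_scheme" and Y :: "('s, 'x, 'e) module_scheme" +
  fixes f :: "('m list \<times> 'x \<Rightarrow>\<^sub>0 int) set \<Rightarrow> 'x"
  assumes same: "carrier Y = carrier X" "\<zero>\<^bsub>Y\<^esub> = \<zero>\<^bsub>X\<^esub>" "add Y = add X"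
    and eta_smult: "\<lbrakk>r \<in> carrier R; x \<in> carrier X\<rbrakk> \<Longrightarrow> \<eta> r \<odot>\<^bsub>Y\<^esub> x = r \<odot>\<^bsub>X\<^esub> x"
    and f_hom: "f \<in> lmod_hom R (tensor_prod R M X) X"
    and f_of: "\<lbrakk>m \<in> carrier M; x \<in> carrier X\<rbrakk> \<Longrightarrow> f (chain_of R M 1 X ([m], x)) = \<mu> m \<odot>\<^bsub>Y\<^esub> x"
begin

section \<open>The cokernel of f as Y / M Y, and finite generation\<close>

abbreviation "T1 \<equiv> tensor_prod R M X"
abbreviation "C \<equiv> lmod_coker T1 X f"
abbreviation "\<pi> x \<equiv> rad Y +>\<^bsub>X\<^esub> x"

text \<open>Both sides are additive spans of the elements f (m \<otimes> x) = \<mu> m x; this is why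
  coker f is X / M X.\<close>

lemma f_image: "f ` carrier T1 = rad Y"
proof
  note fh = lmod_hom_add_hom[OF f_hom]
  show "f ` carrier T1 \<subseteq> rad Y"
  proof
    fix y assume "y \<in> f ` carrier T1"
    then obtain t where t: "t \<in> carrier T1" "y = f t" by blast
    have "f t \<in> aspan X (rad_gens Y)"
    proof (rule aspan_image[OF tensor_chain_abelian_group N.M.abelian_group_axioms fh
          chain_of_gens_closed _ _ tensor_chain_aspan[OF t(1)]])
      show cl: "rad_gens Y \<subseteq> carrier X" using rad_gens_closed[OF Y.left_module_axioms] by (simp add: same)
      fix g assume "g \<in> chain_of R M 1 X ` chain_gens M 1 X"
      then obtain ms x where g: "g = chain_of R M 1 X (ms, x)" "(ms, x) \<in> chain_gens M 1 X" by auto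
      then obtain m where m: "ms = [m]" "m \<in> carrier M" "x \<in> carrier X"
        by (auto simp: chain_gens_iff One_nat_def length_Suc_conv)
      then have "f g \<in> rad_gens Y" using g f_of[OF m(2,3)] by (auto simp: rad_gens_def same)
      then show "f g \<in> aspan X (rad_gens Y)" using N.M.aspan_base[OF _ cl] by blast
    qed
    then show "y \<in> rad Y"
      unfolding rad_def using t aspan_cong[of X Y "rad_gens Y"] same by simp
  qed
  have "z \<in> f ` carrier T1" if "z \<in> rad Y" for z
    using that unfolding rad_def
  proof induction
    interpret T1: abelian_group T1 by (rule tensor_chain_abelian_group)
    case zero
    show ?case
      using add_hom_zero[OF T1.abelian_group_axioms N.M.abelian_group_axioms fh] T1.zero_closed
      unfolding same(2) by (metis imageI)
  next
    interpret T1: abelian_group T1 by (rule tensor_chain_abelian_group)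
    case (add g z)
    then obtain m y t where *: "g = \<mu> m \<odot>\<^bsub>Y\<^esub> y" "m \<in> carrier M" "y \<in> carrier X" "t \<in> carrier T1" "z = f t"
      by (auto simp: rad_gens_def same)
    have c: "chain_of R M 1 X ([m], y) \<in> carrier T1"
      using * by (intro chain_of_closed) (simp add: chain_gens_iff)
    have "g \<oplus>\<^bsub>Y\<^esub> z = f (chain_of R M 1 X ([m], y) \<oplus>\<^bsub>T1\<^esub> t)"
      using * c by (simp add: add_hom_add[OF fh] f_of same)
    then show ?case using c *(4) by simp
  qed
  then show "rad Y \<subseteq> f ` carrier T1" by blast
qed

lemma coker_eq: "C = quot_lmod X (rad Y)"
  by (simp add: lmod_coker_def f_image)

lemma rad_X: "lsubmod R X (rad Y)"
  using rad_closed[OF Y.left_module_axioms] rad_zero[OF Y.left_module_axioms]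
    rad_add[OF Y.left_module_axioms] rad_eta[OF Y.left_module_axioms]
  by (auto simp: lsubmod_def same eta_smult[symmetric])

lemma C_left_module: "left_module R C"
  unfolding coker_eq by (rule N.quot_left_module[OF rad_X])

interpretation C: left_module R C by (rule C_left_module)

lemma pi_hom: "(\<lambda>x. \<pi> x) \<in> lmod_hom R X C"
  unfolding coker_eq by (rule N.quot_lmod_hom[OF rad_X])

lemma pi_add_hom: "(\<lambda>x. \<pi> x) \<in> add_hom Y C"
  using lmod_hom_add_hom[OF pi_hom] by (simp add: add_hom_def same)

lemma pi_surj: "(\<lambda>x. \<pi> x) ` carrier Y = carrier C"
  unfolding coker_eq by (simp add: N.quot_carrier[OF rad_X] same)

lemma pi_zero_iff: "x \<in> carrier Y \<Longrightarrow> \<pi> x = \<zero>\<^bsub>C\<^esub> \<longleftrightarrow> x \<in> rad Y"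
  unfolding coker_eq by (simp add: N.quot_eq_zero_iff[OF rad_X] same)

lemma pi_smult:
  assumes "s \<in> carrier S" "x \<in> carrier Y"
  shows "\<pi> (s \<odot>\<^bsub>Y\<^esub> x) = \<epsilon> s \<odot>\<^bsub>C\<^esub> \<pi> x"
proof -
  obtain z where z: "z \<in> rad Y" "s \<odot>\<^bsub>Y\<^esub> x = \<eta> (\<epsilon> s) \<odot>\<^bsub>Y\<^esub> x \<oplus>\<^bsub>Y\<^esub> z"
    using smult_decomp[OF Y.left_module_axioms assms] by blast
  have zc: "z \<in> carrier Y" by (rule rad_closed[OF Y.left_module_axioms z(1)])
  have "\<pi> (s \<odot>\<^bsub>Y\<^esub> x) = \<pi> (\<eta> (\<epsilon> s) \<odot>\<^bsub>Y\<^esub> x) \<oplus>\<^bsub>C\<^esub> \<pi> z"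
    unfolding z(2) using assms zc by (intro add_hom_add[OF pi_add_hom]) auto
  also have "\<pi> z = \<zero>\<^bsub>C\<^esub>" using pi_zero_iff[OF zc] z(1) by simp
  also have "\<pi> (\<eta> (\<epsilon> s) \<odot>\<^bsub>Y\<^esub> x) = \<epsilon> s \<odot>\<^bsub>C\<^esub> \<pi> x"
    using lmod_hom_smult[OF pi_hom eps_closed[OF assms(1)]] assms by (simp add: eta_smult same)
  finally show ?thesis
    using C.smult_closed[OF eps_closed[OF assms(1)] add_hom_closed[OF pi_add_hom assms(2)]] by simp
qed

text \<open>The fibres of \<pi> are the cosets of M Y; stated in the shape of the premise of
  \<open>nakayama\<close>.\<close>

lemma pi_eq_decomp:
  assumes "x \<in> carrier Y" "u \<in> carrier Y" "\<pi> x = \<pi> u"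
  shows "\<exists>z\<in>rad Y. x = u \<oplus>\<^bsub>Y\<^esub> z"
proof -
  have "x \<oplus>\<^bsub>X\<^esub> \<ominus>\<^bsub>X\<^esub> u \<in> rad Y" using N.quot_eq_iff[OF rad_X, of x u] assms by (simp add: same)
  moreover have "x = u \<oplus>\<^bsub>X\<^esub> (x \<oplus>\<^bsub>X\<^esub> \<ominus>\<^bsub>X\<^esub> u)"
    using N.M.eq_if_minus_eq[of x u] assms by (simp add: same N.M.minus_eq)
  ultimately show ?thesis unfolding same(3) by blast
qed

text \<open>Forwards, \<pi> is semilinear along \<epsilon> and carries generators to generators.
  Backwards, finitely many generators of coker f are lifted to Y; the S-span of the lifts meets
  every coset of M Y, so it is all of Y by \<open>nakayama\<close>.\<close>

theorem fin_gen_coker_iff: "fin_gen S Y \<longleftrightarrow> fin_gen R C"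
proof
  assume "fin_gen S Y"
  then obtain G where G: "finite G" "G \<subseteq> carrier Y" "carrier Y \<subseteq> lspan S Y G"
    unfolding Y.fin_gen_iff by blast
  have "\<pi> x \<in> lspan R C ((\<lambda>x. \<pi> x) ` G)" if "x \<in> carrier Y" for x
    by (rule lspan_map[OF Y.left_module_axioms C_left_module pi_add_hom G(2), where e = \<epsilon>])
       (use G that pi_smult in auto)
  then have "carrier C \<subseteq> lspan R C ((\<lambda>x. \<pi> x) ` G)" unfolding pi_surj[symmetric] by blast
  moreover have "(\<lambda>x. \<pi> x) ` G \<subseteq> carrier C" using G(2) pi_surj by auto
  ultimately show "fin_gen R C" unfolding C.fin_gen_iff using G(1) by blast
next
  assume "fin_gen R C"
  then obtain D where D: "finite D" "D \<subseteq> carrier C" "carrier C \<subseteq> lspan R C D"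
    unfolding C.fin_gen_iff by blast
  obtain G where G: "G \<subseteq> carrier Y" "finite G" "D = (\<lambda>x. \<pi> x) ` G"
    using finite_subset_image[OF D(1)] D(2) unfolding pi_surj[symmetric] by blast
  have "carrier Y \<subseteq> lspan S Y G"
  proof (rule nakayama[OF Y.left_module_axioms Y.lsubmod_lspan[OF G(1)]])
    fix x assume x: "x \<in> carrier Y"
    have "\<pi> x \<in> lspan R C ((\<lambda>x. \<pi> x) ` G)" using D(3) add_hom_closed[OF pi_add_hom x] G(3) by blast
    then have "\<exists>u\<in>lspan S Y G. \<pi> x = \<pi> u"
      by (rule lspan_lift[OF Y.left_module_axioms C.M.abelian_group_axioms pi_add_hom G(1), where e = \<eta>, rotated])
         (use G(1) pi_smult eps_eta in auto)
    then obtain u where u: "u \<in> lspan S Y G" "\<pi> x = \<pi> u" by blast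
    then show "\<exists>u\<in>lspan S Y G. \<exists>z\<in>rad Y. x = u \<oplus>\<^bsub>Y\<^esub> z"
      using pi_eq_decomp[OF x Y.lspan_closed[OF G(1) u(1)] u(2)] by blast
  qed
  then show "fin_gen S Y" unfolding Y.fin_gen_iff using G by blast
qed

section \<open>A map from S^k to Y and its reduction modulo M\<close>

context
  fixes k h assumes h: "h \<in> lmod_hom S (free_lmod S k) Y"
begin

abbreviation "F \<equiv> free_lmod S k"
abbreviation "FR \<equiv> free_lmod R k"

interpretation F: left_module S F by (rule S.free_left_module)
interpretation FR: left_module R FR by (rule R.free_left_module)

text \<open>The map from R^k = F / M F to Y / M Y induced by h, written through the section
  \<open>free_eta\<close>; \<open>hbar_eps\<close> shows that any other lift to F gives the same
  value.\<close>

definition "hbar v = \<pi> (h (free_eta k v))"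

lemma hbar_hom: "hbar \<in> lmod_hom R FR C"
  unfolding lmod_hom_iff
proof (intro conjI ballI)
  show "hbar \<in> add_hom FR C"
    unfolding hbar_def
    by (rule add_hom_comp[OF add_hom_comp[OF free_eta_add_hom lmod_hom_add_hom[OF h]] pi_add_hom])
  fix r v assume rv: "r \<in> carrier R" "v \<in> carrier FR"
  have c: "free_eta k v \<in> carrier F" by (rule add_hom_closed[OF free_eta_add_hom rv(2)])
  then have "h (free_eta k v) \<in> carrier Y" by (rule add_hom_closed[OF lmod_hom_add_hom[OF h]])
  then show "hbar (r \<odot>\<^bsub>FR\<^esub> v) = r \<odot>\<^bsub>C\<^esub> hbar v"
    unfolding hbar_def using rv c
    by (simp add: free_eta_smult lmod_hom_smult[OF h] pi_smult eps_eta)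
qed

lemma hbar_eps:
  assumes w: "w \<in> carrier F" shows "hbar (free_eps k w) = \<pi> (h w)"
proof -
  note hh = lmod_hom_add_hom[OF h]
  obtain z where z: "z \<in> rad F" "w = free_eta k (free_eps k w) \<oplus>\<^bsub>F\<^esub> z" using free_decomp[OF w] by blast
  have c: "free_eta k (free_eps k w) \<in> carrier F" "z \<in> carrier F"
    using add_hom_closed[OF free_eta_add_hom add_hom_closed[OF free_eps_add_hom w]]
      rad_closed[OF F.left_module_axioms z(1)] by auto
  have hz: "h z \<in> rad Y" by (rule rad_hom[OF F.left_module_axioms Y.left_module_axioms h z(1)])
  have "h w = h (free_eta k (free_eps k w)) \<oplus>\<^bsub>Y\<^esub> h z"
    using add_hom_add[OF hh c] z(2) by simp
  then have "\<pi> (h w) = hbar (free_eps k w) \<oplus>\<^bsub>C\<^esub> \<pi> (h z)"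
    unfolding hbar_def using add_hom_add[OF pi_add_hom] add_hom_closed[OF hh] c by simp
  also have "\<pi> (h z) = \<zero>\<^bsub>C\<^esub>" using hz pi_zero_iff add_hom_closed[OF hh c(2)] by blast
  finally show ?thesis
    using add_hom_closed[OF lmod_hom_add_hom[OF hbar_hom] add_hom_closed[OF free_eps_add_hom w]] by simp
qed

abbreviation "K \<equiv> lmod_ker F Y h"

lemma K_left_module: "left_module S K"
  by (rule ker_left_module[OF F.left_module_axioms Y.left_module_axioms h])

interpretation K: left_module S K by (rule K_left_module)

lemma K_simps:
  "carrier K = {w \<in> carrier F. h w = \<zero>\<^bsub>Y\<^esub>}" "add K = add F" "\<zero>\<^bsub>K\<^esub> = \<zero>\<^bsub>F\<^esub>" "smult K = smult F"
  by (simp_all add: lmod_ker_def)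

text \<open>If the reduction kills v, then h sends the lift \<eta> v into M Y. As h is onto, it maps
  M F onto M Y; subtracting a suitable z in M F brings the lift into K, and \<epsilon> does not
  notice z.\<close>

lemma hbar_lift:
  assumes surj: "h ` carrier F = carrier Y" and v: "v \<in> carrier FR" "hbar v = \<zero>\<^bsub>C\<^esub>"
  shows "\<exists>w\<in>carrier K. free_eps k w = v"
proof -
  note hh = lmod_hom_add_hom[OF h]
  have e: "free_eta k v \<in> carrier F" by (rule add_hom_closed[OF free_eta_add_hom v(1)])
  then have "h (free_eta k v) \<in> rad Y"
    using v(2) pi_zero_iff[OF add_hom_closed[OF hh]] by (simp add: hbar_def)
  then obtain z where z: "z \<in> rad F" "h z = h (free_eta k v)"
    using rad_surj[OF F.left_module_axioms Y.left_module_axioms h surj] by blast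
  have zc: "z \<in> carrier F" by (rule rad_closed[OF F.left_module_axioms z(1)])
  let ?w = "free_eta k v \<oplus>\<^bsub>F\<^esub> \<ominus>\<^bsub>F\<^esub> z"
  have "h ?w = \<zero>\<^bsub>Y\<^esub>"
    using e zc z add_hom_closed[OF hh zc]
    by (simp add: add_hom_add[OF hh] add_hom_a_inv[OF F.M.abelian_group_axioms Y.M.abelian_group_axioms hh] Y.M.r_neg)
  moreover have "free_eps k ?w = v"
    using e zc v(1) free_eps_rad[OF z(1)]
    by (simp add: add_hom_add[OF free_eps_add_hom]
        add_hom_a_inv[OF F.M.abelian_group_axioms FR.M.abelian_group_axioms free_eps_add_hom]
        free_eps_eta FR.M.a_inv_zero)
  ultimately show ?thesis using e zc by (intro bexI[of _ ?w]) (simp_all add: K_simps)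
qed

lemma fin_pres_coker:
  assumes surj: "h ` carrier F = carrier Y" and ker: "fin_gen S K"
  shows "fin_pres R C"
  unfolding fin_pres_def
proof (intro exI bexI conjI)
  note hh = lmod_hom_add_hom[OF h]
  show "hbar \<in> lmod_hom R FR C" by (rule hbar_hom)
  show "hbar ` carrier FR = carrier C"
  proof
    show "hbar ` carrier FR \<subseteq> carrier C" using add_hom_closed[OF lmod_hom_add_hom[OF hbar_hom]] by blast
    show "carrier C \<subseteq> hbar ` carrier FR"
    proof
      fix c assume "c \<in> carrier C"
      then obtain w where "w \<in> carrier F" "c = \<pi> (h w)" unfolding pi_surj[symmetric] surj[symmetric] by blast
      then show "c \<in> hbar ` carrier FR" using hbar_eps add_hom_closed[OF free_eps_add_hom] by blast
    qed
  qed
  let ?KR = "lmod_ker FR C hbar"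
  interpret KR: left_module R ?KR by (rule ker_left_module[OF FR.left_module_axioms C_left_module hbar_hom])
  have KR: "carrier ?KR = {v \<in> carrier FR. hbar v = \<zero>\<^bsub>C\<^esub>}" "add ?KR = add FR" "\<zero>\<^bsub>?KR\<^esub> = \<zero>\<^bsub>FR\<^esub>" "smult ?KR = smult FR"
    by (simp_all add: lmod_ker_def)
  have eps_K: "free_eps k w \<in> carrier ?KR" if "w \<in> carrier K" for w
  proof -
    have w: "w \<in> carrier F" "h w = \<zero>\<^bsub>Y\<^esub>" using that by (simp_all add: K_simps)
    have "\<pi> (h w) = \<zero>\<^bsub>C\<^esub>"
      unfolding w(2) using pi_zero_iff[OF Y.M.zero_closed] rad_zero[OF Y.left_module_axioms] by blast
    then show ?thesis
      using hbar_eps[OF w(1)] add_hom_closed[OF free_eps_add_hom w(1)] by (simp add: KR)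
  qed
  obtain G where G: "finite G" "G \<subseteq> carrier K" "carrier K \<subseteq> lspan S K G"
    using ker unfolding K.fin_gen_iff by blast
  have "v \<in> lspan R ?KR (free_eps k ` G)" if "v \<in> carrier ?KR" for v
  proof -
    have "v \<in> carrier FR" "hbar v = \<zero>\<^bsub>C\<^esub>" using that by (simp_all add: KR(1))
    from hbar_lift[OF surj this] obtain w where w: "w \<in> carrier K" "v = free_eps k w" by metis
    have add: "free_eps k \<in> add_hom K ?KR"
      using eps_K add_hom_add[OF free_eps_add_hom] by (intro add_homI) (auto simp: K_simps KR)
    show ?thesis
      unfolding w(2)
      by (rule lspan_map[OF K.left_module_axioms KR.left_module_axioms add G(2), where e = \<epsilon>])
         (use G w in \<open>auto simp: KR K_simps free_eps_smult\<close>)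
  qed
  then show "fin_gen R ?KR"
    unfolding KR.fin_gen_iff using G eps_K by (intro exI[of _ "free_eps k ` G"]) auto
qed

text \<open>The snake map: lifting \<open>x\<close> along \<open>h\<close> and multiplying by \<open>m\<close> is well defined modulo \<open>M K\<close>,
  so \<open>m \<otimes> x \<mapsto> [\<mu> m \<sigma>(x)]\<close> maps \<open>M \<otimes> X\<close> to \<open>F / M K\<close>; on \<open>ker f\<close> it takes values in \<open>K / M K\<close>.\<close>

abbreviation "Q \<equiv> quot_lmod F (rad K)"
abbreviation "\<tau> w \<equiv> rad K +>\<^bsub>F\<^esub> w"

lemma rad_K: "lsubmod S F (rad K)"
proof (rule lsubmod_trans)
  show "lsubmod S F (carrier K)"
    using lsubmod_ker[OF F.left_module_axioms Y.left_module_axioms h] by (simp add: K_simps)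
  have "F\<lparr>carrier := carrier K\<rparr> = K" by (simp add: lmod_ker_def)
  then show "lsubmod S (F\<lparr>carrier := carrier K\<rparr>) (rad K)"
    using rad_lsubmod[OF K.left_module_axioms] by simp
qed

lemma Q_left_module: "left_module S Q"
  by (rule F.quot_left_module[OF rad_K])

interpretation Q: left_module S Q by (rule Q_left_module)

lemma tau_hom: "(\<lambda>w. \<tau> w) \<in> lmod_hom S F Q"
  by (rule F.quot_lmod_hom[OF rad_K])

lemmas tau_add_hom = lmod_hom_add_hom[OF tau_hom]

text \<open>Two lifts of the same element differ by an element of K, and \<mu> m sends K into M K.
  This makes the snake map independent of the chosen lifts.\<close>

lemma tau_mu_eq:
  assumes "m \<in> carrier M" "y \<in> carrier F" "y' \<in> carrier F" "h y = h y'"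
  shows "\<tau> (\<mu> m \<odot>\<^bsub>F\<^esub> y) = \<tau> (\<mu> m \<odot>\<^bsub>F\<^esub> y')"
proof -
  note hh = lmod_hom_add_hom[OF h]
  let ?d = "y \<oplus>\<^bsub>F\<^esub> \<ominus>\<^bsub>F\<^esub> y'"
  have "h ?d = \<zero>\<^bsub>Y\<^esub>"
    using assms add_hom_closed[OF hh]
    by (simp add: add_hom_add[OF hh] add_hom_a_inv[OF F.M.abelian_group_axioms Y.M.abelian_group_axioms hh] Y.M.r_neg)
  then have "?d \<in> carrier K" using assms by (simp add: K_simps)
  then have "\<mu> m \<odot>\<^bsub>F\<^esub> ?d \<in> rad K" using rad_base[OF K.left_module_axioms assms(1)] by (simp add: K_simps)
  moreover have "\<mu> m \<odot>\<^bsub>F\<^esub> ?d = \<mu> m \<odot>\<^bsub>F\<^esub> y \<oplus>\<^bsub>F\<^esub> \<ominus>\<^bsub>F\<^esub> (\<mu> m \<odot>\<^bsub>F\<^esub> y')"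
    using assms add_hom_a_inv[OF F.M.abelian_group_axioms F.M.abelian_group_axioms F.smult_add_hom[OF mu_closed[OF assms(1)]]]
    by (simp add: F.smult_r_distr)
  ultimately show ?thesis using assms F.quot_eq_iff[OF rad_K] by simp
qed

definition "snake = chain_lift (add_monoid Q) (\<lambda>(ms, x). \<tau> (\<mu> (hd ms) \<odot>\<^bsub>F\<^esub> inv_into (carrier F) h x))"

context
  assumes surj: "h ` carrier F = carrier Y"
begin

text \<open>The choice \<sigma> of lifts is neither additive nor linear. But \<sigma> (x + y) and
  \<sigma> x + \<sigma> y lift the same element, and so do \<sigma> (r x) and \<eta> r \<sigma> x;
  after multiplication by \<mu> m they agree modulo M K by \<open>tau_mu_eq\<close>.\<close>

lemma snake_multilinear:
  "chain_multilinear R M 1 X Q (\<lambda>(ms, x). \<tau> (\<mu> (hd ms) \<odot>\<^bsub>F\<^esub> inv_into (carrier F) h x))"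
proof -
  let ?\<sigma> = "inv_into (carrier F) h"
  note hh = lmod_hom_add_hom[OF h]
  have \<sigma>: "?\<sigma> x \<in> carrier F" "h (?\<sigma> x) = x" if "x \<in> carrier X" for x
    using that inv_into_into[of x h "carrier F"] f_inv_into_f[of x h "carrier F"] surj by (simp_all add: same)
  note ta = add_hom_add[OF tau_add_hom]
  show ?thesis
    unfolding chain_multilinear_def
  proof (intro conjI allI impI, goal_cases)
    case 1
    have "\<tau> (\<mu> m \<odot>\<^bsub>F\<^esub> ?\<sigma> x) \<in> carrier Q" if "m \<in> carrier M" "x \<in> carrier X" for m x
      using that \<sigma> by (intro add_hom_closed[OF tau_add_hom]) simp
    then show ?case by (auto simp: chain_gens_iff One_nat_def length_Suc_conv)
  next
    case (2 us a vs x b)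
    then have "us = []" "a \<in> carrier M" "x \<in> carrier X" by (auto simp: chain_gens_iff)
    then show ?case
      using 2(2) \<sigma> by (simp add: add_hom_add[OF mu_hom] F.smult_l_distr ta)
  next
    case (3 us x y)
    then obtain m where m: "us = [m]" "m \<in> carrier M" "x \<in> carrier X" "y \<in> carrier X"
      by (auto simp: chain_gens_iff One_nat_def length_Suc_conv)
    have "\<tau> (\<mu> m \<odot>\<^bsub>F\<^esub> ?\<sigma> (x \<oplus>\<^bsub>X\<^esub> y)) = \<tau> (\<mu> m \<odot>\<^bsub>F\<^esub> (?\<sigma> x \<oplus>\<^bsub>F\<^esub> ?\<sigma> y))"
      using m \<sigma> by (intro tau_mu_eq) (simp_all add: add_hom_add[OF hh] same)
    then show ?case using m \<sigma> by (simp add: F.smult_r_distr ta)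
  next
    \<comment> \<open>Vacuous: a word of length 1 has no neighbouring letters.\<close>
    case (4 us a b vs x r) then show ?case by (simp add: chain_gens_iff)
  next
    case (5 us a x r)
    then have a: "us = []" "a \<in> carrier M" "x \<in> carrier X" by (auto simp: chain_gens_iff)
    have "\<tau> (\<mu> a \<odot>\<^bsub>F\<^esub> (\<eta> r \<odot>\<^bsub>F\<^esub> ?\<sigma> x)) = \<tau> (\<mu> a \<odot>\<^bsub>F\<^esub> ?\<sigma> (r \<odot>\<^bsub>X\<^esub> x))"
      using a \<sigma> 5(2) by (intro tau_mu_eq) (simp_all add: lmod_hom_smult[OF h] eta_smult)
    then show ?case using a \<sigma> 5(2) by (simp add: mu_rsmult F.smult_assoc1)
  qed
qed

lemma snake_add_hom: "snake \<in> add_hom T1 Q"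
  unfolding snake_def by (rule chain_lift_add_hom[OF Q.M.abelian_group_axioms snake_multilinear])

lemma snake_of:
  assumes "m \<in> carrier M" "y \<in> carrier F"
  shows "snake (chain_of R M 1 X ([m], h y)) = \<tau> (\<mu> m \<odot>\<^bsub>F\<^esub> y)"
proof -
  have hy: "h y \<in> carrier X" using add_hom_closed[OF lmod_hom_add_hom[OF h] assms(2)] by (simp add: same)
  then have "snake (chain_of R M 1 X ([m], h y)) = \<tau> (\<mu> m \<odot>\<^bsub>F\<^esub> inv_into (carrier F) h (h y))"
    unfolding snake_def using chain_lift_of[OF Q.M.abelian_group_axioms snake_multilinear] assms
    by (simp add: chain_gens_iff)
  also have "\<dots> = \<tau> (\<mu> m \<odot>\<^bsub>F\<^esub> y)"
    using assms inv_into_into[of "h y" h "carrier F"] f_inv_into_f[of "h y" h "carrier F"]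
    by (intro tau_mu_eq) simp_all
  finally show ?thesis .
qed

lemma chain_1_cases:
  assumes "g \<in> chain_of R M 1 X ` chain_gens M 1 X"
  obtains m y where "m \<in> carrier M" "y \<in> carrier F" "g = chain_of R M 1 X ([m], h y)"
    "g \<in> carrier T1" "h y \<in> carrier X"
proof -
  obtain ms x where g: "g = chain_of R M 1 X (ms, x)" "(ms, x) \<in> chain_gens M 1 X" using assms by auto
  then obtain m where m: "ms = [m]" "m \<in> carrier M" "x \<in> carrier X"
    by (auto simp: chain_gens_iff One_nat_def length_Suc_conv)
  moreover obtain y where "y \<in> carrier F" "x = h y" using m(3) surj same(1) by (metis imageE)
  ultimately show thesis using that g chain_of_closed by blast
qed

lemma snake_smult:
  assumes r: "r \<in> carrier R" and t: "t \<in> carrier T1"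
  shows "snake (r \<odot>\<^bsub>T1\<^esub> t) = \<eta> r \<odot>\<^bsub>Q\<^esub> snake t"
proof (rule add_hom_eqI[OF tensor_chain_abelian_group Q.M.abelian_group_axioms _ _ _
      chain_of_gens_closed tensor_chain_aspan[OF t]])
  show "(\<lambda>t. snake (r \<odot>\<^bsub>T1\<^esub> t)) \<in> add_hom T1 Q"
    by (rule add_hom_comp[OF tensor_smult_add_hom[OF r] snake_add_hom])
  show "(\<lambda>t. \<eta> r \<odot>\<^bsub>Q\<^esub> snake t) \<in> add_hom T1 Q"
    by (rule add_hom_comp[OF snake_add_hom Q.smult_add_hom[OF eta_closed[OF r]]])
  fix g assume "g \<in> chain_of R M 1 X ` chain_gens M 1 X"
  then obtain m y where g: "m \<in> carrier M" "y \<in> carrier F" "g = chain_of R M 1 X ([m], h y)" "h y \<in> carrier X"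
    using chain_1_cases by metis
  have "r \<odot>\<^bsub>T1\<^esub> g = chain_of R M 1 X ([r \<odot>\<^bsub>M\<^esub> m], h y)"
    using g r by (simp add: tensor_smult_of chain_gens_iff)
  then show "snake (r \<odot>\<^bsub>T1\<^esub> g) = \<eta> r \<odot>\<^bsub>Q\<^esub> snake g"
    using g r by (simp add: snake_of mu_smult F.smult_assoc1 lmod_hom_smult[OF tau_hom])
qed

text \<open>A single w serves both equations, so that w lies in K as soon as f t vanishes.\<close>

lemma snake_lift:
  assumes "t \<in> carrier T1" shows "\<exists>w\<in>carrier F. snake t = \<tau> w \<and> f t = h w"
  using tensor_chain_aspan[OF assms]
proof induction
  case zero
  show ?case
    using add_hom_zero[OF tensor_chain_abelian_group Q.M.abelian_group_axioms snake_add_hom]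
      add_hom_zero[OF F.M.abelian_group_axioms Q.M.abelian_group_axioms tau_add_hom]
      add_hom_zero[OF tensor_chain_abelian_group N.M.abelian_group_axioms lmod_hom_add_hom[OF f_hom]]
      add_hom_zero[OF F.M.abelian_group_axioms Y.M.abelian_group_axioms lmod_hom_add_hom[OF h]]
    by (intro bexI[of _ "\<zero>\<^bsub>F\<^esub>"]) (simp_all add: same)
next
  interpret T1: abelian_group T1 by (rule tensor_chain_abelian_group)
  case (add g t)
  obtain m y where g: "m \<in> carrier M" "y \<in> carrier F" "g = chain_of R M 1 X ([m], h y)"
      "g \<in> carrier T1" "h y \<in> carrier X"
    using chain_1_cases[OF add.hyps(1)] by metis
  obtain w where w: "w \<in> carrier F" "snake t = \<tau> w" "f t = h w" using add.IH by blast
  have t: "t \<in> carrier T1" by (rule T1.aspan_closed[OF add.hyps(2) chain_of_gens_closed])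
  have "snake (g \<oplus>\<^bsub>T1\<^esub> t) = \<tau> (\<mu> m \<odot>\<^bsub>F\<^esub> y \<oplus>\<^bsub>F\<^esub> w)"
    unfolding add_hom_add[OF snake_add_hom g(4) t]
    using g w by (simp add: snake_of add_hom_add[OF tau_add_hom])
  moreover have "f (g \<oplus>\<^bsub>T1\<^esub> t) = h (\<mu> m \<odot>\<^bsub>F\<^esub> y \<oplus>\<^bsub>F\<^esub> w)"
    unfolding add_hom_add[OF lmod_hom_add_hom[OF f_hom] g(4) t]
    using g w by (simp add: f_of lmod_hom_smult[OF h] add_hom_add[OF lmod_hom_add_hom[OF h]] same)
  ultimately show ?case using g w by (intro bexI[of _ "\<mu> m \<odot>\<^bsub>F\<^esub> y \<oplus>\<^bsub>F\<^esub> w"]) simp_all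
qed

text \<open>Exactness at K / M K: a single t serves both equations, so for z in K \<inter> M F it
  lies in ker f and its snake image is the class of z.\<close>

lemma snake_onto:
  assumes "z \<in> rad F" shows "\<exists>t\<in>carrier T1. snake t = \<tau> z \<and> f t = h z"
  using assms unfolding rad_def[of F]
proof induction
  interpret T1: abelian_group T1 by (rule tensor_chain_abelian_group)
  case zero
  show ?case
    using add_hom_zero[OF tensor_chain_abelian_group Q.M.abelian_group_axioms snake_add_hom]
      add_hom_zero[OF F.M.abelian_group_axioms Q.M.abelian_group_axioms tau_add_hom]
      add_hom_zero[OF tensor_chain_abelian_group N.M.abelian_group_axioms lmod_hom_add_hom[OF f_hom]]
      add_hom_zero[OF F.M.abelian_group_axioms Y.M.abelian_group_axioms lmod_hom_add_hom[OF h]]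
    by (intro bexI[of _ "\<zero>\<^bsub>T1\<^esub>"]) (simp_all add: same)
next
  interpret T1: abelian_group T1 by (rule tensor_chain_abelian_group)
  case (add g z)
  obtain m y where g: "g = \<mu> m \<odot>\<^bsub>F\<^esub> y" "m \<in> carrier M" "y \<in> carrier F"
    using add.hyps(1) by (auto simp: rad_gens_def)
  obtain t where t: "t \<in> carrier T1" "snake t = \<tau> z" "f t = h z" using add.IH by blast
  have hy: "h y \<in> carrier X" using add_hom_closed[OF lmod_hom_add_hom[OF h] g(3)] by (simp add: same)
  have z: "z \<in> carrier F" using add.hyps(2) rad_closed[OF F.left_module_axioms] by (simp add: rad_def)
  let ?c = "chain_of R M 1 X ([m], h y)"
  have c: "?c \<in> carrier T1" using g hy by (intro chain_of_closed) (simp add: chain_gens_iff)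
  have "snake (?c \<oplus>\<^bsub>T1\<^esub> t) = \<tau> (g \<oplus>\<^bsub>F\<^esub> z)"
    unfolding add_hom_add[OF snake_add_hom c t(1)]
    using g t z by (simp add: snake_of add_hom_add[OF tau_add_hom])
  moreover have "f (?c \<oplus>\<^bsub>T1\<^esub> t) = h (g \<oplus>\<^bsub>F\<^esub> z)"
    unfolding add_hom_add[OF lmod_hom_add_hom[OF f_hom] c t(1)]
    using g t z hy by (simp add: f_of lmod_hom_smult[OF h] add_hom_add[OF lmod_hom_add_hom[OF h]] same)
  ultimately show ?case using c t(1) by (intro bexI[of _ "?c \<oplus>\<^bsub>T1\<^esub> t"]) simp_all
qed

text \<open>Lifts H1 of generators of the kernel of the reduction and lifts H2 of the snake images
  of generators of ker f generate K modulo M K: H1 corrects an element until \<epsilon> kills it,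
  and H2 accounts for what is left. \<open>nakayama\<close> for K removes the modulus.\<close>

lemma fin_gen_ker:
  assumes fg1: "fin_gen R (lmod_ker FR C hbar)" and fg2: "fin_gen R (lmod_ker T1 X f)"
  shows "fin_gen S K"
proof -
  note hh = lmod_hom_add_hom[OF h]
  let ?KR = "lmod_ker FR C hbar" and ?Kf = "lmod_ker T1 X f"
  interpret KR: left_module R ?KR by (rule ker_left_module[OF FR.left_module_axioms C_left_module hbar_hom])
  interpret T1: left_module R T1 by (rule tensor_chain_left_module)
  interpret Kf: left_module R ?Kf by (rule ker_left_module[OF T1.left_module_axioms N.left_module_axioms f_hom])
  have KR: "carrier ?KR = {v \<in> carrier FR. hbar v = \<zero>\<^bsub>C\<^esub>}" "lspan R ?KR G = lspan R FR G" for G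
    by (simp_all add: lspan_lmod_ker) (simp add: lmod_ker_def)
  have Kf: "carrier ?Kf = {t \<in> carrier T1. f t = \<zero>\<^bsub>X\<^esub>}" "lspan R ?Kf G = lspan R T1 G" for G
    by (simp_all add: lspan_lmod_ker) (simp add: lmod_ker_def)
  obtain G1 where G1: "finite G1" "G1 \<subseteq> carrier ?KR" "carrier ?KR \<subseteq> lspan R FR G1"
    using fg1 unfolding KR.fin_gen_iff KR(2) by blast
  obtain G2 where G2: "finite G2" "G2 \<subseteq> carrier ?Kf" "carrier ?Kf \<subseteq> lspan R T1 G2"
    using fg2 unfolding Kf.fin_gen_iff Kf(2) by blast
  have "G1 \<subseteq> free_eps k ` carrier K"
    using G1(2) hbar_lift[OF surj] by (force simp: KR(1))
  from finite_subset_image[OF G1(1) this]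
  obtain H1 where H1: "H1 \<subseteq> carrier K" "finite H1" "G1 = free_eps k ` H1" by blast
  \<comment> \<open>The representative w of a snake image found by \<open>snake_lift\<close>
    satisfies h w = f t = 0, hence lies in K.\<close>
  have "snake ` G2 \<subseteq> (\<lambda>w. \<tau> w) ` carrier K"
  proof
    fix q assume "q \<in> snake ` G2"
    then obtain t where t: "t \<in> carrier T1" "f t = \<zero>\<^bsub>X\<^esub>" "q = snake t" using G2(2) by (auto simp: Kf(1))
    then show "q \<in> (\<lambda>w. \<tau> w) ` carrier K" using snake_lift[OF t(1)] by (auto simp: K_simps same)
  qed
  from finite_subset_image[OF finite_imageI[OF G2(1)] this]
  obtain H2 where H2: "H2 \<subseteq> carrier K" "finite H2" "snake ` G2 = (\<lambda>w. \<tau> w) ` H2" by blast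
  let ?H = "H1 \<union> H2"
  have H: "?H \<subseteq> carrier K" "finite ?H" using H1 H2 by auto
  have KF: "w \<in> carrier F" if "w \<in> carrier K" for w using that by (simp add: K_simps)
  have HF: "H1 \<subseteq> carrier F" "H2 \<subseteq> carrier F" "?H \<subseteq> carrier F" using H1 H2 KF by auto
  note sub = F.lsubmod_lspan[OF HF(3)]
  have mono: "lspan S F H1 \<subseteq> lspan S F ?H" "lspan S F H2 \<subseteq> lspan S F ?H"
    using F.lspan_base[OF HF(3)] by (intro F.lspan_least[OF sub]; blast)+
  have "carrier K \<subseteq> lspan S K ?H"
  proof (rule nakayama[OF K.left_module_axioms K.lsubmod_lspan[OF H(1)]])
    fix v assume v: "v \<in> carrier K"
    have vF: "v \<in> carrier F" "h v = \<zero>\<^bsub>Y\<^esub>" using v by (simp_all add: K_simps)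
    have "\<pi> (h v) = \<zero>\<^bsub>C\<^esub>"
      unfolding vF(2) using pi_zero_iff[OF Y.M.zero_closed] rad_zero[OF Y.left_module_axioms] by blast
    then have "free_eps k v \<in> carrier ?KR"
      using hbar_eps[OF vF(1)] add_hom_closed[OF free_eps_add_hom vF(1)] by (simp add: KR(1))
    then have "free_eps k v \<in> lspan R FR (free_eps k ` H1)" using G1(3) H1(3) by blast
    then have "\<exists>u\<in>lspan S F H1. free_eps k v = free_eps k u"
      by (rule lspan_lift[OF F.left_module_axioms FR.M.abelian_group_axioms free_eps_add_hom HF(1), where e = \<eta>, rotated])
         (use HF(1) in \<open>auto simp: free_eps_smult eps_eta subset_iff\<close>)
    then obtain u where u: "u \<in> lspan S F H1" "free_eps k v = free_eps k u" by blast
    have uH: "u \<in> lspan S K ?H" unfolding lspan_lmod_ker using u(1) mono by blast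
    then have uK: "u \<in> carrier K" using K.lspan_closed[OF H(1)] by blast
    have uF: "u \<in> carrier F" "h u = \<zero>\<^bsub>Y\<^esub>" using uK by (simp_all add: K_simps)
    \<comment> \<open>The correction by H1: both h and \<epsilon> kill this difference, so it lies
      in K \<inter> M F.\<close>
    let ?d = "v \<ominus>\<^bsub>F\<^esub> u"
    have d: "?d \<in> carrier F" using vF uF by simp
    have hd: "h ?d = \<zero>\<^bsub>Y\<^esub>"
      unfolding F.M.minus_eq using vF uF
      by (simp add: add_hom_add[OF hh] add_hom_a_inv[OF F.M.abelian_group_axioms Y.M.abelian_group_axioms hh] Y.M.a_inv_zero)
    have "free_eps k ?d = \<zero>\<^bsub>FR\<^esub>"
      unfolding F.M.minus_eq using vF uF u(2) add_hom_closed[OF free_eps_add_hom uF(1)]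
      by (simp add: add_hom_add[OF free_eps_add_hom]
          add_hom_a_inv[OF F.M.abelian_group_axioms FR.M.abelian_group_axioms free_eps_add_hom] FR.M.r_neg)
    moreover have "free_eta k \<zero>\<^bsub>FR\<^esub> = \<zero>\<^bsub>F\<^esub>"
      by (rule add_hom_zero[OF FR.M.abelian_group_axioms F.M.abelian_group_axioms free_eta_add_hom])
    \<comment> \<open>Since \<epsilon> kills \<open>?d\<close>, its decomposition by
      \<open>free_decomp\<close> reduces to the part in M F.\<close>
    ultimately have "?d \<in> rad F"
      using free_decomp[OF d] rad_closed[OF F.left_module_axioms] by (metis F.M.l_zero)
    then obtain t where t: "t \<in> carrier T1" "snake t = \<tau> ?d" "f t = h ?d" using snake_onto by blast
    then have "t \<in> carrier ?Kf" using hd by (simp add: Kf(1) same)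
    then have "t \<in> lspan R T1 G2" using G2(3) by blast
    moreover have G2T: "G2 \<subseteq> carrier T1" using G2(2) by (auto simp: Kf(1))
    ultimately have "snake t \<in> lspan S Q (snake ` G2)"
      by (intro lspan_map[OF T1.left_module_axioms Q.left_module_axioms snake_add_hom, where e = \<eta>])
         (auto simp: snake_smult subset_iff)
    then have "\<tau> ?d \<in> lspan S Q ((\<lambda>w. \<tau> w) ` H2)" unfolding t(2) H2(3) .
    then have "\<exists>w\<in>lspan S F H2. \<tau> ?d = \<tau> w"
      by (rule lspan_lift[OF F.left_module_axioms Q.M.abelian_group_axioms tau_add_hom HF(2), where e = id, rotated])
         (use HF(2) in \<open>auto simp: lmod_hom_smult[OF tau_hom] subset_iff\<close>)
    then obtain w where w: "w \<in> lspan S F H2" "\<tau> ?d = \<tau> w" by blast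
    have wH: "w \<in> lspan S K ?H" unfolding lspan_lmod_ker using w(1) mono by blast
    have wF: "w \<in> carrier F" using KF[OF subsetD[OF _ wH]] K.lspan_closed[OF H(1)] by blast
    let ?z = "?d \<ominus>\<^bsub>F\<^esub> w"
    have z: "?z \<in> rad K" using F.quot_eq_iff[OF rad_K d wF] w(2) by (simp add: F.M.minus_eq)
    have zF: "?z \<in> carrier F" using d wF by simp
    \<comment> \<open>v is split into u from the span of H1, w from the span of H2 and a remainder
      in M K.\<close>
    have "v = u \<oplus>\<^bsub>F\<^esub> ?d" by (rule F.M.eq_if_minus_eq[OF vF(1) uF(1) refl])
    also have "?d = w \<oplus>\<^bsub>F\<^esub> ?z" by (rule F.M.eq_if_minus_eq[OF d wF refl])
    also have "u \<oplus>\<^bsub>F\<^esub> (w \<oplus>\<^bsub>F\<^esub> ?z) = (u \<oplus>\<^bsub>F\<^esub> w) \<oplus>\<^bsub>F\<^esub> ?z" using uF wF zF by (simp add: F.M.a_assoc)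
    finally have "v = (u \<oplus>\<^bsub>K\<^esub> w) \<oplus>\<^bsub>K\<^esub> ?z" unfolding K_simps(2) .
    then show "\<exists>u\<in>lspan S K ?H. \<exists>z\<in>rad K. v = u \<oplus>\<^bsub>K\<^esub> z"
      using K.lspan_add[OF H(1) uH wH] z by blast
  qed
  then show ?thesis unfolding K.fin_gen_iff using H by blast
qed

end

end

section \<open>Finite presentation of Y and of the cokernel\<close>

theorem fin_pres_coker_if:
  assumes "fin_pres S Y" shows "fin_pres R C"
  using assms fin_pres_coker unfolding fin_pres_def[of S] by blast

text \<open>Lifting the values of g on the unit vectors to Y gives a map from S^k whose reduction is
  g. It is onto by \<open>nakayama\<close>, applied to its image, and \<open>fin_gen_ker\<close>
  takes care of its kernel.\<close>

theorem fin_pres_if_coker: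
  assumes ker: "fin_gen R (lmod_ker T1 X f)" and C: "fin_pres R C"
  shows "fin_pres S Y"
proof -
  obtain k g where g: "g \<in> lmod_hom R (free_lmod R k) C" "g ` carrier (free_lmod R k) = carrier C"
    "fin_gen R (lmod_ker (free_lmod R k) C g)"
    using C unfolding fin_pres_def by blast
  \<comment> \<open>For l \<ge> k the unit vector is the zero vector, so lifts can be chosen for all
    l without a bound.\<close>
  have "\<exists>x\<in>carrier Y. \<pi> x = g (free_unit R k l \<one>\<^bsub>R\<^esub>)" for l
    using add_hom_closed[OF lmod_hom_add_hom[OF g(1)] R.free_unit_closed[OF R.one_closed]]
    unfolding pi_surj[symmetric] by (metis imageE)
  then obtain x where x: "\<And>l. x l \<in> carrier Y" "\<And>l. \<pi> (x l) = g (free_unit R k l \<one>\<^bsub>R\<^esub>)" by metis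
  let ?h = "free_lift Y k x"
  have xP: "x \<in> {..<k} \<rightarrow> carrier Y" using x by auto
  have h: "?h \<in> lmod_hom S (free_lmod S k) Y" by (rule Y.free_lift_hom[OF xP])
  have one: "\<eta> \<one>\<^bsub>R\<^esub> = \<one>\<^bsub>S\<^esub>" by (rule ring_hom_one[OF eta_hom])
  have eq: "hbar k ?h v = g v" if "v \<in> carrier (free_lmod R k)" for v
  proof (rule R.free_lmod_hom_eqI[OF C_left_module hbar_hom[OF h] g(1) _ that])
    show "hbar k ?h (free_unit R k l \<one>\<^bsub>R\<^esub>) = g (free_unit R k l \<one>\<^bsub>R\<^esub>)" if "l < k" for l
      unfolding hbar_def[OF h] using Y.free_lift_unit[OF xP that S.one_closed] x
      by (simp add: free_eta_unit one)
  qed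
  have surj: "?h ` carrier (free_lmod S k) = carrier Y"
  proof
    interpret F: left_module S "free_lmod S k" by (rule S.free_left_module)
    note hh = lmod_hom_add_hom[OF h]
    show "?h ` carrier (free_lmod S k) \<subseteq> carrier Y" using add_hom_closed[OF hh] by blast
    have "lsubmod S Y (?h ` carrier (free_lmod S k))"
      unfolding lsubmod_def
    proof (intro conjI ballI)
      show "?h ` carrier (free_lmod S k) \<subseteq> carrier Y" using add_hom_closed[OF hh] by blast
      show "\<zero>\<^bsub>Y\<^esub> \<in> ?h ` carrier (free_lmod S k)"
        using add_hom_zero[OF F.M.abelian_group_axioms Y.M.abelian_group_axioms hh] F.M.zero_closed by (metis imageI)
      fix a assume "a \<in> ?h ` carrier (free_lmod S k)"
      then obtain a' where a': "a' \<in> carrier (free_lmod S k)" "a = ?h a'" by blast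
      show "s \<odot>\<^bsub>Y\<^esub> a \<in> ?h ` carrier (free_lmod S k)" if "s \<in> carrier S" for s
        using lmod_hom_smult[OF h that a'(1)] a' F.smult_closed[OF that a'(1)] by (metis imageI)
      fix b assume "b \<in> ?h ` carrier (free_lmod S k)"
      then obtain b' where b': "b' \<in> carrier (free_lmod S k)" "b = ?h b'" by blast
      show "a \<oplus>\<^bsub>Y\<^esub> b \<in> ?h ` carrier (free_lmod S k)"
        using add_hom_add[OF hh a'(1) b'(1)] a' b' F.M.a_closed by (metis imageI)
    qed
    then show "carrier Y \<subseteq> ?h ` carrier (free_lmod S k)"
    proof (rule nakayama[OF Y.left_module_axioms])
      fix y assume y: "y \<in> carrier Y"
      then have "\<pi> y \<in> g ` carrier (free_lmod R k)" unfolding g(2) by (rule add_hom_closed[OF pi_add_hom])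
      then obtain v where v: "v \<in> carrier (free_lmod R k)" "\<pi> y = g v" by blast
      have e: "free_eta k v \<in> carrier (free_lmod S k)" by (rule add_hom_closed[OF free_eta_add_hom v(1)])
      have "\<pi> y = \<pi> (?h (free_eta k v))" using v eq[OF v(1)] by (simp add: hbar_def[OF h])
      from pi_eq_decomp[OF y add_hom_closed[OF hh e] this] e
      show "\<exists>u\<in>?h ` carrier (free_lmod S k). \<exists>z\<in>rad Y. y = u \<oplus>\<^bsub>Y\<^esub> z" by blast
    qed
  qed
  \<comment> \<open>The reduction equals g on the carrier of R^k only; outside it the two functions
    may differ, but the kernels are the same record.\<close>
  have "lmod_ker (free_lmod R k) C (hbar k ?h) = lmod_ker (free_lmod R k) C g"
    unfolding lmod_ker_def by (simp add: eq cong: conj_cong)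
  then have "fin_gen S (lmod_ker (free_lmod S k) Y ?h)"
    using fin_gen_ker[OF h surj] g(3) ker by simp
  then show ?thesis unfolding fin_pres_def using h surj by blast
qed

end

section \<open>The trivial extension as an augmented ring\<close>

context triv_extension
begin

definition eta where "eta r = homog R M n ([], r)"

definition mu where "mu m = homog R M n ([m], \<one>\<^bsub>R\<^esub>)"

text \<open>Degree 0 is stored as a tensor chain without letters from M, that is, as cosets of
  formal sums of pairs \<open>([], r)\<close>. Lifting \<open>snd\<close> reads off the element of
  R.\<close>

definition eps where "eps a = chain_lift (add_monoid R) snd (a 0)"

lemma snd_multilinear: "chain_multilinear R M 0 (reg_lmod R) R snd"
  by (auto simp: chain_multilinear_def chain_gens_iff reg_lmod_simps)

lemma eps_add_hom: "eps \<in> add_hom S R"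
  using add_hom_comp[OF S_proj_add_hom[of 0] reg.chain_lift_add_hom[OF R.abelian_group_axioms snd_multilinear, folded tensor_pow_def]]
  by (simp add: eps_def[abs_def])

lemma eps_homog:
  assumes "(us, r) \<in> hgens R M" shows "eps (homog R M n (us, r)) = (if us = [] then r else \<zero>\<^bsub>R\<^esub>)"
proof (cases "us = []")
  case True
  then show ?thesis
    using assms reg.chain_lift_of[OF R.abelian_group_axioms snd_multilinear, of "([], r)"]
    by (simp add: eps_def homog_def chain_gens_iff hgens_def reg_lmod_simps)
next
  case False
  have "chain_lift (add_monoid R) snd \<zero>\<^bsub>T 0\<^esub> = \<zero>\<^bsub>R\<^esub>"
    by (rule add_hom_zero[OF T_abelian_group R.abelian_group_axioms])
       (use reg.chain_lift_add_hom[OF R.abelian_group_axioms snd_multilinear] in \<open>simp add: tensor_pow_def\<close>)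
  then show ?thesis using False by (simp add: eps_def homog_def)
qed

lemma eps_mult_homog:
  assumes "p \<in> hgens R M" "q \<in> hgens R M"
  shows "eps (homog R M n p \<otimes>\<^bsub>S\<^esub> homog R M n q) = eps (homog R M n p) \<otimes>\<^bsub>R\<^esub> eps (homog R M n q)"
proof -
  obtain us r vs s where pq: "p = (us, r)" "q = (vs, s)" by fastforce
  have g: "gjoin p q \<in> hgens R M" by (rule gjoin_hgens[OF assms])
  have c: "r \<in> carrier R" "s \<in> carrier R" using assms by (auto simp: pq hgens_def)
  show ?thesis
    unfolding homog_mult[OF assms]
    using assms g c by (cases vs; cases us) (auto simp: pq reg.gen_join_eq reg_lmod_simps eps_homog)
qed

lemma augmented_ring: "augmented_ring R M S eta eps mu n"
proof -
  interpret S: ring S by (rule S_ring)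
  have e: "([], r) \<in> hgens R M" if "r \<in> carrier R" for r using that by (simp add: hgens_def)
  have m: "([m], \<one>\<^bsub>R\<^esub>) \<in> hgens R M" if "m \<in> carrier M" for m using that by (simp add: hgens_def)
  have eps_mult: "eps (a \<otimes>\<^bsub>S\<^esub> b) = eps a \<otimes>\<^bsub>R\<^esub> eps b" if a: "a \<in> carrier S" and b: "b \<in> carrier S" for a b
  proof -
    have r: "(\<lambda>x. x \<otimes>\<^bsub>R\<^esub> y) \<in> add_hom R R" "(\<lambda>x. y \<otimes>\<^bsub>R\<^esub> x) \<in> add_hom R R" if "y \<in> carrier R" for y
      using that by (auto intro!: add_homI simp: R.l_distr R.r_distr)
    \<comment> \<open>As for associativity, the multiplicativity known on generators is extended
      first in b and then in a.\<close>
    have 1: "eps (homog R M n p \<otimes>\<^bsub>S\<^esub> b) = eps (homog R M n p) \<otimes>\<^bsub>R\<^esub> eps b" if p: "p \<in> hgens R M" for p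
      by (rule S_hom_eqI[OF R.abelian_group_axioms
            add_hom_comp[OF S_mult_right[OF homog_closed[OF p]] eps_add_hom]
            add_hom_comp[OF eps_add_hom r(2)[OF add_hom_closed[OF eps_add_hom homog_closed[OF p]]]] _ b])
         (rule eps_mult_homog[OF p])
    show ?thesis
      by (rule S_hom_eqI[OF R.abelian_group_axioms
            add_hom_comp[OF S_mult_left[OF b] eps_add_hom]
            add_hom_comp[OF eps_add_hom r(1)[OF add_hom_closed[OF eps_add_hom b]]] _ a])
         (rule 1)
  qed
  show ?thesis
  proof (intro augmented_ring.intro augmented_ring_axioms.intro bimodule_axioms S_ring)
    show "eta \<in> ring_hom R S"
    proof (rule ring_hom_memI)
      fix r s assume rs: "r \<in> carrier R" "s \<in> carrier R"
      show "eta (r \<otimes>\<^bsub>R\<^esub> s) = eta r \<otimes>\<^bsub>S\<^esub> eta s"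
        using homog_mult[OF e[OF rs(1)] e[OF rs(2)]] by (simp add: eta_def reg.gen_join_eq reg_lmod_simps)
      show "eta (r \<oplus>\<^bsub>R\<^esub> s) = eta r \<oplus>\<^bsub>S\<^esub> eta s"
        using chain_multilinear_add_right[OF homog_multilinear[of 0], of "[]" r s] rs
        by (simp add: eta_def chain_gens_iff reg_lmod_simps)
    qed (simp_all add: eta_def e homog_closed S_one)
    show "eps \<in> ring_hom S R"
      by (rule ring_hom_memI)
         (simp_all add: eps_mult add_hom_closed[OF eps_add_hom] add_hom_add[OF eps_add_hom] S_one eps_homog e)
    show "mu \<in> add_hom M S"
      using chain_multilinear_add_left[OF homog_multilinear[of 1], of "[]" _ "[]" "\<one>\<^bsub>R\<^esub>"]
      by (intro add_homI) (auto simp: mu_def m homog_closed chain_gens_iff reg_lmod_simps)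
    show "eps (eta r) = r" if "r \<in> carrier R" for r using that by (simp add: eta_def eps_homog e)
    show "eps (mu x) = \<zero>\<^bsub>R\<^esub>" if "x \<in> carrier M" for x using that by (simp add: mu_def eps_homog m)
    show "mu (r \<odot>\<^bsub>M\<^esub> x) = eta r \<otimes>\<^bsub>S\<^esub> mu x" if "r \<in> carrier R" "x \<in> carrier M" for r x
      using homog_mult[OF e[OF that(1)] m[OF that(2)]] by (simp add: mu_def eta_def reg.gen_join_eq)
    \<comment> \<open>Balancedness against the last factor R turns the letter x r with scalar 1 into
      the letter x with scalar r, which is the product on the right.\<close>
    show "mu (x \<odot>r\<^bsub>M\<^esub> r) = mu x \<otimes>\<^bsub>S\<^esub> eta r" if "x \<in> carrier M" "r \<in> carrier R" for x r
      using homog_mult[OF m[OF that(1)] e[OF that(2)]] that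
        chain_multilinear_balanced_last[OF homog_multilinear[of 1], of "[]" x "\<one>\<^bsub>R\<^esub>" r]
      by (simp add: mu_def eta_def reg.gen_join_eq reg_lmod_simps chain_gens_iff)
    show "s \<in> aspan S (eta ` carrier R \<union> {mu x \<otimes>\<^bsub>S\<^esub> t |x t. x \<in> carrier M \<and> t \<in> carrier S})" (is "s \<in> aspan S ?A")
      if s: "s \<in> carrier S" for s
    proof -
      have A: "?A \<subseteq> carrier S" by (auto simp: eta_def mu_def homog_closed e m)
      have "homog R M n ` hgens R M \<subseteq> aspan S ?A"
      proof clarify
        fix us r assume p: "(us, r) \<in> hgens R M"
        have "homog R M n (us, r) \<in> ?A"
        proof (cases us)
          case Nil
          then show ?thesis using p by (auto simp: eta_def hgens_def)
        next
          case (Cons v vs)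
          then have v: "v \<in> carrier M" "(vs, r) \<in> hgens R M" using p by (auto simp: hgens_def)
          \<comment> \<open>The first letter splits off as \<mu> v, and the scalar 1 leaves the
            remaining word unchanged.\<close>
          have "gjoin ([v], \<one>\<^bsub>R\<^esub>) (vs, r) = (us, r)"
            using v Cons by (cases vs) (auto simp: reg.gen_join_eq reg_lmod_simps hgens_def)
          then have "homog R M n (us, r) = mu v \<otimes>\<^bsub>S\<^esub> homog R M n (vs, r)"
            using homog_mult[OF m[OF v(1)] v(2)] by (simp add: mu_def)
          then show ?thesis using v homog_closed by blast
        qed
        then show "homog R M n (us, r) \<in> aspan S ?A" by (rule S.aspan_base[OF _ A])
      qed
      from S.aspan_subset[OF this A] show ?thesis using S_aspan[OF s] by blast
    qed
    show "foldr (\<lambda>x s. mu x \<otimes>\<^bsub>S\<^esub> s) ms \<one>\<^bsub>S\<^esub> = \<zero>\<^bsub>S\<^esub>"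
      if "length ms = Suc n" "set ms \<subseteq> carrier M" for ms
    proof -
      have "foldr (\<lambda>x s. mu x \<otimes>\<^bsub>S\<^esub> s) ms \<one>\<^bsub>S\<^esub> = homog R M n (ms, \<one>\<^bsub>R\<^esub>)"
        using that(2)
      proof (induction ms)
        case Nil then show ?case by (simp add: S_one)
      next
        case (Cons v vs)
        then have v: "v \<in> carrier M" "(vs, \<one>\<^bsub>R\<^esub>) \<in> hgens R M" by (auto simp: hgens_def)
        have "gjoin ([v], \<one>\<^bsub>R\<^esub>) (vs, \<one>\<^bsub>R\<^esub>) = (v # vs, \<one>\<^bsub>R\<^esub>)"
          using v by (cases vs) (auto simp: reg.gen_join_eq reg_lmod_simps hgens_def)
        then show ?case using homog_mult[OF m[OF v(1)] v(2)] Cons by (simp add: mu_def)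
      qed
      \<comment> \<open>The word has n + 1 letters, one more than the top degree of S, so
        \<open>homog\<close> of it is zero.\<close>
      then show ?thesis using that(1) by (auto simp: homog_def S_simps intro!: restrict_ext)
    qed
  qed
qed

end

context triv_pair
begin

lemma augmented_pair: "augmented_pair R M S eta eps mu n X XS f"
proof (intro augmented_pair.intro augmented_pair_axioms.intro augmented_ring bimodule_pair_axioms XS_left_module)
  show "eta r \<odot>\<^bsub>XS\<^esub> x = r \<odot>\<^bsub>X\<^esub> x" if "r \<in> carrier R" "x \<in> carrier X" for r x
    using that by (simp add: eta_def homog_smult hgens_def)
  show "f (chain_of R M 1 X ([m], x)) = mu m \<odot>\<^bsub>XS\<^esub> x" if "m \<in> carrier M" "x \<in> carrier X" for m x
    using that by (simp add: mu_def homog_smult hgens_def act_def)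
qed (simp_all add: f_hom)

end

theorem theorem2p12:
  fixes R :: "('r, 'a) ring_scheme"
    and M :: "('r, 'm, 'b) bimod_scheme"
    and n :: nat
    and X :: "('r, 'x, 'c) module_scheme"
    and f :: "('m list \<times> 'x \<Rightarrow>\<^sub>0 int) set \<Rightarrow> 'x"
  assumes "ring R" and "\<one>\<^bsub>R\<^esub> \<noteq> \<zero>\<^bsub>R\<^esub>"
    and "bimodule R M" and "n \<ge> 1"
    and "triv_ext_pair R M n X f"
  shows
    "(fin_gen (triv_ext R M n) (triv_ext_module R M n X f) \<longleftrightarrow>
        fin_gen R (lmod_coker (tensor_prod R M X) X f)) \<and>
     (fin_pres (triv_ext R M n) (triv_ext_module R M n X f) \<longrightarrow>
        fin_pres R (lmod_coker (tensor_prod R M X) X f)) \<and>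
     (fin_gen R (lmod_ker (tensor_prod R M X) X f) \<longrightarrow>
        fin_pres R (lmod_coker (tensor_prod R M X) X f) \<longrightarrow>
        fin_pres (triv_ext R M n) (triv_ext_module R M n X f))"
proof -
  have "triv_pair R M n X f"
    using assms(3,5)
    by (intro triv_pair.intro triv_extension.intro bimodule_pair.intro triv_pair_axioms.intro)
       (simp_all add: triv_ext_pair_def)
  then interpret augmented_pair R M "triv_ext R M n" "triv_extension.eta R M n" "triv_extension.eps R"
    "triv_extension.mu R M n" n X "triv_ext_module R M n X f" f
    by (rule triv_pair.augmented_pair)
  show ?thesis using fin_gen_coker_iff fin_pres_coker_if fin_pres_if_coker by blast
qed

end
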